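(* Let $\hat f$ be the Godunov flux associated with $f$. For any $u\in\mathbb V^k$, $$\lim_{\Delta t\to 0^+}\frac{\pi S_{\Delta t}u-u}{\Delta t}=F[u]$$ uniformly on $I$, where $F[u]\in\mathbb V^k$ is the right-hand side of the classical semi-discrete discontinuous Galerkin (DG) method with numerical flux $\hat f$.
   Context: Let $f:\mathbb R\to\mathbb R$ be smooth and consider the scalar conservation law $\mathcal U_t+f(\mathcal U)_x=0$ on a bounded interval $I$, $t\ge 0$, with periodic or compactly supported boundary conditions (in the latter case all functions vanish near the end-points of $I$, so that there are no boundary contributions). For $t\ge0$, $S_t$ denotes the exact solution operator mapping an initial condition to the unique entropy solution at time $t$. The interval $I$ is divided into $N$ cells $I_j=[x_{j-\frac12},x_{j+\frac12}]$ with disjoint interiors, $h_j=|I_j|$, $I=\bigcup_{j=1}^N I_j$. Fix $k\ge1$ and let $\mathbb V^k=\{v\in L^2(I): v|_{I_j}\in\mathbb P^k(I_j),\ 1\le j\le N\}$, where $\mathbb P^k$ denotes polynomials of degree at most $k$. Let $\pi:L^2(I)\to\mathbb V^k$ be the $L^2$-projection. For $v\in\mathbb V^k$, $v^{\pm}_{j+\frac12}=v(x_{j+\frac12}^{\pm})$ are one-sided limits. For a numerical flux $\hat f(u^-,u^+)$, put $\hat f_{j+\frac12}=\hat f(u^-_{j+\frac12},u^+_{j+\frac12})$. For $u\in\mathbb V^k$, $F[u]\in\mathbb V^k$ is the unique element such that for all $v\in\mathbb V^k$ and all $j$, $$\int_{I_j}F[u]\,v\,dx=\int_{I_j}f(u)v_x\,dx-\hat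 f_{j+\frac12}v^-_{j+\frac12}+\hat f_{j-\frac12}v^+_{j-\frac12}.$$ The classical semi-discrete DG method is the ODE $u_t=F[u]$ in $\mathbb V^k$. Godunov flux: $\hat f(u^-,u^+)=f(u^* )$, where $u^*$ is the value at $x/t=0$ of the entropy solution of the Riemann problem with left state $u^-$ and right state $u^+$ separated at $x=0$. If this solution has a stationary shock at $x/t=0$, $u^*$ may be taken as either of the two one-sided values, which have equal values of $f$ by the Rankine–Hugoniot condition. *)

theory Defs
  imports "HOL-Analysis.Analysis" "HOL-Computational_Algebra.Polynomial"
begin

definition smooth :: "(real \<Rightarrow> real) \<Rightarrow> bool" where
  "smooth f \<longleftrightarrow> (\<forall>n. (deriv ^^ n) f differentiable_on UNIV)"

section \<open>Entropy solutions of the Cauchy problem on the line\<close>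

text \<open>
  Nonnegative \<open>C\<^sup>1\<close> test functions of \<open>(t, y)\<close> with compact support in the open half plane
  \<open>t > 0\<close>, given together with their partial derivatives.
\<close>

definition test_function ::
    "(real \<times> real \<Rightarrow> real) \<Rightarrow> (real \<times> real \<Rightarrow> real) \<Rightarrow> (real \<times> real \<Rightarrow> real) \<Rightarrow> bool" where
  "test_function \<phi> \<phi>t \<phi>y \<longleftrightarrow>
     (\<forall>p. 0 \<le> \<phi> p) \<and>
     (\<forall>t y. ((\<lambda>s. \<phi> (s, y)) has_real_derivative \<phi>t (t, y)) (at t)) \<and>
     (\<forall>t y. ((\<lambda>z. \<phi> (t, z)) has_real_derivative \<phi>y (t, y)) (at y)) \<and>
     continuous_on UNIV \<phi> \<and> continuous_on UNIV \<phi>t \<and> continuous_on UNIV \<phi>y \<and>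
     (\<exists>K. compact K \<and> K \<subseteq> {0<..} \<times> UNIV \<and> (\<forall>p. p \<notin> K \<longrightarrow> \<phi> p = 0))"

text \<open>
  Kruzhkov entropy solutions of \<open>U\<^sub>t + f(U)\<^sub>y = 0\<close>, \<open>U(0) = u0\<close>, in \<open>L\<^sup>\<infinity>\<close>.  The representative in
  \<open>C([0,\<infinity>); L\<^sup>1\<^sub>l\<^sub>o\<^sub>c)\<close> is taken, so that \<open>U t\<close> is determined almost everywhere for each single
  time \<open>t \<ge> 0\<close>.  The weak form of the equation is the case of \<open>c\<close> beyond the bounds of \<open>U\<close>.
\<close>

definition entropy_solution ::
    "(real \<Rightarrow> real) \<Rightarrow> (real \<Rightarrow> real) \<Rightarrow> (real \<Rightarrow> real \<Rightarrow> real) \<Rightarrow> bool" where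
  "entropy_solution f u0 U \<longleftrightarrow>
     (\<lambda>(t, y). U t y) \<in> borel_measurable (restrict_space borel ({0..} \<times> UNIV)) \<and>
     (\<exists>M. \<forall>t\<ge>0. AE y in lborel. \<bar>U t y\<bar> \<le> M) \<and>
     (AE y in lborel. U 0 y = u0 y) \<and>
     (\<forall>t0\<ge>0. \<forall>R. ((\<lambda>t. LINT y:{-R..R}|lborel. \<bar>U t y - U t0 y\<bar>) \<longlongrightarrow> 0) (at t0 within {0..})) \<and>
     (\<forall>c \<phi> \<phi>t \<phi>y. test_function \<phi> \<phi>t \<phi>y \<longrightarrow>
        0 \<le> (LINT (t, y)|lborel.
               \<bar>U t y - c\<bar> * \<phi>t (t, y) + sgn (U t y - c) * (f (U t y) - f c) * \<phi>y (t, y)))"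

section \<open>Boundary conditions and the solution operator\<close>

datatype boundary_condition = Periodic | Compactly_Supported

text \<open>
  Functions on \<open>I = [a, b]\<close> are identified with their periodic extension, respectively their
  extension by zero, to the line.  Only the values on \<open>[a, b)\<close> are used.
\<close>

fun extend :: "boundary_condition \<Rightarrow> real \<Rightarrow> real \<Rightarrow> (real \<Rightarrow> real) \<Rightarrow> real \<Rightarrow> real" where
  "extend Periodic a b u y = u (a + (b - a) * frac ((y - a) / (b - a)))"
| "extend Compactly_Supported a b u y = (if y \<in> {a..<b} then u y else 0)"

fun satisfies_bc :: "boundary_condition \<Rightarrow> real \<Rightarrow> real \<Rightarrow> (real \<Rightarrow> real) \<Rightarrow> bool" where
  "satisfies_bc Periodic a b g \<longleftrightarrow> (\<forall>y. g (y + (b - a)) = g y)"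
| "satisfies_bc Compactly_Supported a b g \<longleftrightarrow>
     (\<exists>K. compact K \<and> K \<subseteq> {a<..<b} \<and> (\<forall>y. y \<notin> K \<longrightarrow> g y = 0))"

text \<open>
  In the compactly supported case \<open>S t u0\<close> is not required to stay supported in \<open>I\<close>: by finite
  speed of propagation it does so for small \<open>t\<close>, but in general not for all \<open>t\<close>.
\<close>

definition solution_operator ::
    "boundary_condition \<Rightarrow> real \<Rightarrow> real \<Rightarrow> (real \<Rightarrow> real) \<Rightarrow>
     (real \<Rightarrow> (real \<Rightarrow> real) \<Rightarrow> (real \<Rightarrow> real)) \<Rightarrow> bool" where
  "solution_operator bc a b f S \<longleftrightarrow>
     (\<forall>u0. u0 \<in> borel_measurable borel \<and> bounded (range u0) \<and> satisfies_bc bc a b u0 \<longrightarrow>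
        entropy_solution f u0 (\<lambda>t. S t u0) \<and>
        (bc = Periodic \<longrightarrow> (\<forall>t\<ge>0. satisfies_bc Periodic a b (S t u0))))"

section \<open>Godunov flux\<close>

definition riemann_data :: "real \<Rightarrow> real \<Rightarrow> real \<Rightarrow> real" where
  "riemann_data ul ur y = (if y < 0 then ul else ur)"

definition riemann_solution :: "(real \<Rightarrow> real) \<Rightarrow> real \<Rightarrow> real \<Rightarrow> (real \<Rightarrow> real) \<Rightarrow> bool" where
  "riemann_solution f ul ur w \<longleftrightarrow>
     entropy_solution f (riemann_data ul ur)
       (\<lambda>t y. if t = 0 then riemann_data ul ur y else w (y / t))"

text \<open>
  The value of the profile \<open>w\<close> at \<open>y/t = 0\<close> is read off from its one-sided limits, which differ
  only at a stationary shock; either of them is then allowed.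
\<close>

definition godunov_state :: "(real \<Rightarrow> real) \<Rightarrow> real \<Rightarrow> real \<Rightarrow> real \<Rightarrow> bool" where
  "godunov_state f ul ur us \<longleftrightarrow>
     (\<exists>w wm wp. riemann_solution f ul ur w \<and>
        (w \<longlongrightarrow> wm) (at_left 0) \<and> (w \<longlongrightarrow> wp) (at_right 0) \<and> (us = wm \<or> us = wp))"

definition godunov_flux :: "(real \<Rightarrow> real) \<Rightarrow> (real \<Rightarrow> real \<Rightarrow> real) \<Rightarrow> bool" where
  "godunov_flux f fhat \<longleftrightarrow>
     (\<forall>ul ur. \<exists>us. godunov_state f ul ur us \<and> fhat ul ur = f us)"

section \<open>The discontinuous Galerkin method\<close>

text \<open>
  The mesh point \<open>x\<^bsub>j+1/2\<^esub>\<close> is \<open>x j\<close>, so that \<open>I = [x 0, x N]\<close> and \<open>I\<^sub>j = [x (j - 1), x j]\<close>.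
\<close>

definition mesh :: "(nat \<Rightarrow> real) \<Rightarrow> nat \<Rightarrow> bool" where
  "mesh x N \<longleftrightarrow> 1 \<le> N \<and> (\<forall>j<N. x j < x (Suc j))"

text \<open>
  Each class in \<open>V\<^sup>k\<close> is represented by the function that is right-continuous at the mesh points
  and vanishes outside \<open>[x 0, x N)\<close>, which makes equality in \<open>V\<^sup>k\<close> equality of functions.
\<close>

definition dg_space :: "(nat \<Rightarrow> real) \<Rightarrow> nat \<Rightarrow> nat \<Rightarrow> (real \<Rightarrow> real) set" where
  "dg_space x N k =
     {v. (\<forall>j\<in>{1..N}. \<exists>p. degree p \<le> k \<and> (\<forall>y\<in>{x (j - 1)..<x j}. v y = poly p y)) \<and>
         (\<forall>y. y \<notin> {x 0..<x N} \<longrightarrow> v y = 0)}"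

definition L2_projection ::
    "(nat \<Rightarrow> real) \<Rightarrow> nat \<Rightarrow> nat \<Rightarrow> (real \<Rightarrow> real) \<Rightarrow> (real \<Rightarrow> real)" where
  "L2_projection x N k g =
     (THE p. p \<in> dg_space x N k \<and>
        (\<forall>v\<in>dg_space x N k.
           (LINT y:{x 0..x N}|lborel. p y * v y) = (LINT y:{x 0..x N}|lborel. g y * v y)))"

definition trace_left :: "(real \<Rightarrow> real) \<Rightarrow> real \<Rightarrow> real" where
  "trace_left v z = Lim (at_left z) v"

definition trace_right :: "(real \<Rightarrow> real) \<Rightarrow> real \<Rightarrow> real" where
  "trace_right v z = Lim (at_right z) v"

text \<open>The outer traces of \<open>u\<close> at the two end-points of \<open>I\<close> are those of its extension.\<close>

definition interface_flux ::
    "boundary_condition \<Rightarrow> (nat \<Rightarrow> real) \<Rightarrow> nat \<Rightarrow> (real \<Rightarrow> real \<Rightarrow> real) \<Rightarrow>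
     (real \<Rightarrow> real) \<Rightarrow> nat \<Rightarrow> real" where
  "interface_flux bc x N fhat u j =
     fhat (trace_left (extend bc (x 0) (x N) u) (x j))
          (trace_right (extend bc (x 0) (x N) u) (x j))"

definition dg_rhs ::
    "boundary_condition \<Rightarrow> (nat \<Rightarrow> real) \<Rightarrow> nat \<Rightarrow> nat \<Rightarrow> (real \<Rightarrow> real) \<Rightarrow>
     (real \<Rightarrow> real \<Rightarrow> real) \<Rightarrow> (real \<Rightarrow> real) \<Rightarrow> (real \<Rightarrow> real)" where
  "dg_rhs bc x N k f fhat u =
     (THE F. F \<in> dg_space x N k \<and>
        (\<forall>v\<in>dg_space x N k. \<forall>j\<in>{1..N}.
           (LINT y:{x (j - 1)..x j}|lborel. F y * v y) =
             (LINT y:{x (j - 1)..x j}|lborel. f (u y) * deriv v y)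
             - interface_flux bc x N fhat u j * trace_left v (x j)
             + interface_flux bc x N fhat u (j - 1) * trace_right v (x (j - 1))))"

end

theory Submission
  imports Defs
begin

text \<open>
  Tested with a polynomial \<open>v\<close> on one cell, the claim becomes a balance law: over a short time \<open>T\<close> the
  moment of the solution \<open>U\<close> against \<open>v\<close> changes by the space-time integral of \<open>f(U) v'\<close> plus what
  crosses the two edges of the cell.  The first term is \<open>T\<close> times its value at time \<open>0\<close> up to \<open>o(T)\<close>,
  because \<open>U\<close> is continuous in time with values in \<open>L\<^sup>1\<close> (\<open>flux_initial_time\<close>).  The crux is that the
  flux through a mesh point, averaged over a short time, tends to the Godunov flux.

  An entropy solution need not have traces at a mesh point, so the flux is smeared over a width \<open>d\<close>,
  and \<open>d\<close> tends to \<open>0\<close> before \<open>T\<close> does.  The textbook route compares \<open>U\<close> with the Riemann solution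
  and uses the \<open>L\<^sup>1\<close> contraction between two entropy solutions.  Here \<open>U\<close> is compared with constants
  only, which needs nothing but the definition of an entropy solution.  Let \<open>ul\<close>, \<open>ur\<close> be the
  one-sided limits of the initial data at the edge.  If \<open>c > ul\<close>, then \<open>(U - c)\<^sup>+\<close> vanishes initially
  just to the left of the edge.  By finite speed of propagation, that left neighbourhood (shrinking in
  time) receives nothing from further left; as its content stays nonnegative, what it loses through
  the edge is at most the initial content \<open>O(d)\<close> of the smeared edge.  So the flux of \<open>(U - c)\<^sup>+\<close>
  through the edge is at most \<open>O(d)\<close>.  Using \<open>(c - U)\<^sup>+\<close> and the other side of the edge gives four
  such inequalities, all instances of \<open>half_flux\<close>.  Together they squeeze the flux of \<open>f\<close> to Osher's
  formula, the minimum of \<open>f\<close> on \<open>[ul, ur]\<close> or the maximum on \<open>[ur, ul]\<close> (\<open>edge_flux\<close>).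

  The same statement applies to the Riemann solution \<open>w(y/t)\<close>, whose smeared flux tends to the value
  of \<open>f\<close> at the one-sided limit of \<open>w\<close> at \<open>0\<close> by self-similarity.  Hence \<open>f\<close> at the Godunov state is
  given by the same formula (\<open>godunov_state_value\<close>), and the edge fluxes of \<open>U\<close> are those of the
  discontinuous Galerkin method (\<open>cell_balance\<close>).

  Finally, both the projection and the right-hand side of the method are Riesz representers of linear
  functionals on polynomials.  In an orthonormal basis of each cell their coefficients are values of
  these functionals, so the convergence of finitely many numbers gives the uniform limit.
\<close>

section \<open>Integrals of bounded functions with bounded support\<close>

lemma integrable_bounded_box:
  fixes g :: "'a::euclidean_space \<Rightarrow> real"
  assumes "g \<in> borel_measurable borel" and "\<And>x. \<bar>g x\<bar> \<le> B" and "\<And>x. x \<notin> cbox a b \<Longrightarrow> g x = 0"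
  shows "integrable lborel g"
proof (rule Bochner_Integration.integrable_bound)
  show "integrable lborel (\<lambda>x. B * indicator (cbox a b) x)"
    by (intro integrable_mult_right) (use emeasure_lborel_cbox_finite in \<open>auto simp: integrable_indicator_iff less_top\<close>)
  show "AE x in lborel. norm (g x) \<le> norm (B * indicator (cbox a b) x)"
  proof (intro AE_I2)
    fix x
    show "norm (g x) \<le> norm (B * indicator (cbox a b) x)"
      using assms(2)[of x] assms(3)[of x] by (cases "x \<in> cbox a b") auto
  qed
qed (use assms in auto)

lemma integrable_bounded_interval:
  fixes g :: "real \<Rightarrow> real"
  assumes "g \<in> borel_measurable borel" and "\<And>x. \<bar>g x\<bar> \<le> B" and "\<And>x. x < a \<or> b < x \<Longrightarrow> g x = 0"
  shows "integrable lborel g"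
  by (rule integrable_bounded_box[where a = a and b = b]) (use assms in \<open>auto simp: not_le\<close>)

text \<open>
  This makes constants invisible to the weak formulation: only differences of entropies and of
  entropy fluxes matter.
\<close>

lemma integral_derivative_compact_support:
  fixes g g' :: "real \<Rightarrow> real"
  assumes "\<And>x. (g has_real_derivative g' x) (at x)" and "continuous_on UNIV g'"
    and "\<And>x. R < \<bar>x\<bar> \<Longrightarrow> g x = 0" and "\<And>x. R < \<bar>x\<bar> \<Longrightarrow> g' x = 0"
  shows "integral\<^sup>L lborel g' = 0"
proof -
  let ?R = "\<bar>R\<bar> + 1"
  have "has_bochner_integral lborel (\<lambda>x. g' x * indicator {- ?R..?R} x) (g ?R - g (- ?R))"
    by (rule has_bochner_integral_FTC_Icc_real)
       (use assms in \<open>auto simp: continuous_on_eq_continuous_at\<close>)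
  moreover have "(\<lambda>x. g' x * indicator {- ?R..?R} x) = g'"
  proof
    fix x show "g' x * indicator {- ?R..?R} x = g' x"
      using assms(4)[of x] by (cases "\<bar>x\<bar> \<le> \<bar>R\<bar> + 1") (auto simp: indicator_def)
  qed
  ultimately show ?thesis using assms(3)[of ?R] assms(3)[of "- ?R"]
    by (simp add: has_bochner_integral_integral_eq)
qed

lemma abs_integral_le:
  fixes g k :: "'a \<Rightarrow> real"
  assumes "integrable M k" and "AE y in M. \<bar>g y\<bar> \<le> k y"
  shows "\<bar>integral\<^sup>L M g\<bar> \<le> integral\<^sup>L M k"
proof -
  have "\<bar>integral\<^sup>L M g\<bar> \<le> (LINT y|M. \<bar>g y\<bar>)"
    using integral_norm_bound[of M g] by simp
  also have "\<dots> \<le> integral\<^sup>L M k"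
    by (rule integral_mono_AE'[OF assms]) (use assms(2) in \<open>eventually_elim, linarith\<close>)
  finally show ?thesis .
qed

lemma continuous_on_compact_bounded:
  fixes g :: "'a::topological_space \<Rightarrow> real"
  assumes "compact S" and "continuous_on S g"
  obtains C where "0 \<le> C" "\<And>x. x \<in> S \<Longrightarrow> \<bar>g x\<bar> \<le> C"
proof -
  have "bounded (g ` S)" by (intro compact_imp_bounded compact_continuous_image assms)
  then obtain C where C: "\<And>x. x \<in> S \<Longrightarrow> \<bar>g x\<bar> \<le> C"
    unfolding bounded_iff by (metis image_eqI real_norm_def)
  have "\<bar>g x\<bar> \<le> max 0 C" if "x \<in> S" for x using C[OF that] by simp
  then show thesis by (intro that[of "max 0 C"]) auto
qed

lemma integrable_const_indicator_interval [simp]: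
  "integrable lborel (\<lambda>y. K * indicator {a..b} y :: real)" for a b :: real
  by (intro integrable_mult_right integrable_bounded_interval[of _ 1 a b]) (auto simp: indicator_def)

section \<open>A continuously differentiable step\<close>

text \<open>
  The derivative is the piecewise linear hat on \<open>[0, 1]\<close> with peak \<open>2\<close>; the second differences of
  \<open>(max 0 x)\<^sup>2\<close> integrate it in closed form.
\<close>

definition smoothstep :: "real \<Rightarrow> real" where
  "smoothstep x = 2 * ((max 0 x)\<^sup>2 - 2 * (max 0 (x - 1/2))\<^sup>2 + (max 0 (x - 1))\<^sup>2)"

definition smoothstep_deriv :: "real \<Rightarrow> real" where
  "smoothstep_deriv x = 4 * (max 0 x - 2 * max 0 (x - 1/2) + max 0 (x - 1))"

lemma DERIV_max_0_square: "((\<lambda>x. (max 0 x)\<^sup>2) has_real_derivative 2 * max 0 x) (at (x::real))"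
proof -
  consider "x < 0" | "x = 0" | "x > 0" by linarith
  then show ?thesis
  proof cases
    case 1
    have "((\<lambda>x. 0::real) has_real_derivative 2 * max 0 x) (at x)"
      using 1 by simp
    then show ?thesis
      by (rule has_field_derivative_transform_within_open[where S = "{..<0}"]) (use 1 in auto)
  next
    case 3
    have "((\<lambda>x. x\<^sup>2) has_real_derivative 2 * max 0 x) (at x)"
      using 3 by (auto intro!: derivative_eq_intros)
    then show ?thesis
      by (rule has_field_derivative_transform_within_open[where S = "{0<..}"]) (use 3 in auto)
  next
    case 2
    have "((\<lambda>y. (max 0 y)\<^sup>2 / y) \<longlongrightarrow> 0) (at (0::real))"
    proof (rule Lim_null_comparison)
      show "\<forall>\<^sub>F y in at 0. norm ((max 0 y)\<^sup>2 / y) \<le> norm (y::real)"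
        by (intro always_eventually allI) (auto simp: max_def power2_eq_square)
      show "((\<lambda>y::real. norm y) \<longlongrightarrow> 0) (at 0)"
        by (rule tendsto_norm_zero) simp
    qed
    then show ?thesis using 2 by (simp add: has_field_derivative_iff)
  qed
qed

lemma DERIV_smoothstep: "(smoothstep has_real_derivative smoothstep_deriv x) (at x)"
proof -
  have shift: "((\<lambda>x. (max 0 (x - a))\<^sup>2) has_real_derivative 2 * max 0 (x - a)) (at x)" for a :: real
  proof -
    have "((\<lambda>x. x - a) has_real_derivative 1) (at x)"
      by (auto intro!: derivative_eq_intros)
    from DERIV_chain2[OF DERIV_max_0_square this] show ?thesis by simp
  qed
  show ?thesis
    unfolding smoothstep_def[abs_def] smoothstep_deriv_def
    by (rule derivative_eq_intros shift DERIV_max_0_square refl)+ (simp add: algebra_simps)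
qed

lemma smoothstep_le_0 [simp]: "x \<le> 0 \<Longrightarrow> smoothstep x = 0"
  by (simp add: smoothstep_def max_def)

lemma smoothstep_ge_1 [simp]: "1 \<le> x \<Longrightarrow> smoothstep x = 1"
  by (simp add: smoothstep_def max_def power2_eq_square algebra_simps)

lemma smoothstep_deriv_nonneg [simp]: "0 \<le> smoothstep_deriv x"
  by (simp add: smoothstep_deriv_def max_def)

lemma smoothstep_deriv_le_2 [simp]: "smoothstep_deriv x \<le> 2"
  by (simp add: smoothstep_deriv_def max_def)

lemma smoothstep_deriv_outside [simp]: "x \<le> 0 \<or> 1 \<le> x \<Longrightarrow> smoothstep_deriv x = 0"
  by (auto simp add: smoothstep_deriv_def max_def)

lemma smoothstep_mono: "x \<le> y \<Longrightarrow> smoothstep x \<le> smoothstep y"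
  by (rule DERIV_nonneg_imp_nondecreasing) (use DERIV_smoothstep smoothstep_deriv_nonneg in blast)+

lemma smoothstep_nonneg [simp]: "0 \<le> smoothstep x"
  using smoothstep_mono[of 0 x] by (cases "x \<le> 0") auto

lemma smoothstep_le_1 [simp]: "smoothstep x \<le> 1"
  using smoothstep_mono[of x 1] by (cases "1 \<le> x") auto

lemma continuous_on_smoothstep_deriv [continuous_intros]:
  "continuous_on A g \<Longrightarrow> continuous_on A (\<lambda>x. smoothstep_deriv (g x))"
  unfolding smoothstep_deriv_def by (intro continuous_intros)

lemma continuous_on_smoothstep [continuous_intros]:
  "continuous_on A g \<Longrightarrow> continuous_on A (\<lambda>x. smoothstep (g x))"
  unfolding smoothstep_def by (intro continuous_intros)

lemma DERIV_smoothstep_chain [derivative_intros]: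
  assumes "(g has_real_derivative g') (at x within A)"
  shows "((\<lambda>x. smoothstep (g x)) has_real_derivative smoothstep_deriv (g x) * g') (at x within A)"
  using DERIV_chain2[OF DERIV_smoothstep assms] .

lemma integral_smoothstep_deriv: "integral\<^sup>L lborel smoothstep_deriv = 1"
proof -
  have "has_bochner_integral lborel (\<lambda>x. smoothstep_deriv x * indicator {0..1} x) (smoothstep 1 - smoothstep 0)"
    by (rule has_bochner_integral_FTC_Icc_real)
       (use continuous_on_smoothstep_deriv[OF continuous_on_id, of UNIV] DERIV_smoothstep
        in \<open>auto simp: continuous_on_eq_continuous_at\<close>)
  moreover have "(\<lambda>x. smoothstep_deriv x * indicator {0..1} x) = smoothstep_deriv"
  proof
    fix x :: real show "smoothstep_deriv x * indicator {0..1} x = smoothstep_deriv x"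
      by (cases "x \<le> 0 \<or> 1 \<le> x") auto
  qed
  ultimately show ?thesis by (simp add: has_bochner_integral_integral_eq)
qed

section \<open>Test functions\<close>

text \<open>
  The partial derivatives vanish off the support of \<open>\<phi>\<close> because its complement is open.
\<close>

lemma test_function_support:
  assumes "test_function \<phi> \<phi>t \<phi>y"
  obtains R B where "\<And>p. p \<notin> cbox (-R, -R) (R, R) \<Longrightarrow> \<phi> p = 0 \<and> \<phi>t p = 0 \<and> \<phi>y p = 0"
    and "\<And>p. \<bar>\<phi> p\<bar> \<le> B \<and> \<bar>\<phi>t p\<bar> \<le> B \<and> \<bar>\<phi>y p\<bar> \<le> B"
    and "\<And>t y. t \<le> 0 \<Longrightarrow> \<phi>t (t, y) = 0 \<and> \<phi>y (t, y) = 0"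
proof -
  from assms obtain K where K: "compact K" "K \<subseteq> {0<..} \<times> UNIV" "\<And>p. p \<notin> K \<Longrightarrow> \<phi> p = 0"
    and dt: "\<And>t y. ((\<lambda>s. \<phi> (s, y)) has_real_derivative \<phi>t (t, y)) (at t)"
    and dy: "\<And>t y. ((\<lambda>z. \<phi> (t, z)) has_real_derivative \<phi>y (t, y)) (at y)"
    and cont: "continuous_on UNIV \<phi>" "continuous_on UNIV \<phi>t" "continuous_on UNIV \<phi>y"
    unfolding test_function_def by blast
  have "open (- K)" using K(1) compact_imp_closed by blast
  have zt: "\<phi>t p = 0" if "p \<notin> K" for p
  proof -
    obtain t y where p: "p = (t, y)" by (cases p)
    have "open ((\<lambda>s. (s, y)) -` (- K))"
      by (intro open_vimage \<open>open (- K)\<close> continuous_intros)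
    then have "((\<lambda>s. 0) has_real_derivative \<phi>t (t, y)) (at t)"
      by (rule has_field_derivative_transform_within_open[OF dt]) (use that K(3) p in auto)
    then show ?thesis using p using DERIV_unique[OF _ DERIV_const] by blast
  qed
  have zy: "\<phi>y p = 0" if "p \<notin> K" for p
  proof -
    obtain t y where p: "p = (t, y)" by (cases p)
    have "open ((\<lambda>s. (t, s)) -` (- K))"
      by (intro open_vimage \<open>open (- K)\<close> continuous_intros)
    then have "((\<lambda>s. 0) has_real_derivative \<phi>y (t, y)) (at y)"
      by (rule has_field_derivative_transform_within_open[OF dy]) (use that K(3) p in auto)
    then show ?thesis using p using DERIV_unique[OF _ DERIV_const] by blast
  qed
  obtain R where R: "\<And>p. p \<in> K \<Longrightarrow> norm p \<le> R"
    using compact_imp_bounded[OF K(1)] bounded_iff by blast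
  have box: "p \<in> cbox (-R, -R) (R, R)" if "p \<in> K" for p
  proof -
    obtain t y where p: "p = (t, y)" by (cases p)
    have "\<bar>t\<bar> \<le> R" "\<bar>y\<bar> \<le> R"
      using R[OF that] norm_fst_le[of t y] norm_snd_le[of y t] p by auto
    then show ?thesis by (auto simp: p cbox_Pair_eq)
  qed
  have bdd: "\<exists>B. \<forall>p. \<bar>g p\<bar> \<le> B" if c: "continuous_on UNIV g" and z: "\<And>p. p \<notin> K \<Longrightarrow> g p = 0"
    for g :: "real \<times> real \<Rightarrow> real"
  proof -
    obtain B where B: "\<And>p. p \<in> K \<Longrightarrow> \<bar>g p\<bar> \<le> B"
      by (rule continuous_on_compact_bounded[OF K(1) continuous_on_subset[OF c subset_UNIV]]) blast
    have "\<bar>g p\<bar> \<le> max 0 B" for p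
      using B[of p] z[of p] by (cases "p \<in> K") auto
    then show ?thesis by blast
  qed
  obtain B1 where B1: "\<And>p. \<bar>\<phi> p\<bar> \<le> B1" using bdd[OF cont(1) K(3)] by blast
  obtain B2 where B2: "\<And>p. \<bar>\<phi>t p\<bar> \<le> B2" using bdd[OF cont(2) zt] by blast
  obtain B3 where B3: "\<And>p. \<bar>\<phi>y p\<bar> \<le> B3" using bdd[OF cont(3) zy] by blast
  show thesis
  proof (rule that)
    show "\<phi> p = 0 \<and> \<phi>t p = 0 \<and> \<phi>y p = 0" if "p \<notin> cbox (-R, -R) (R, R)" for p
      using that box zt zy K(3) by blast
    show "\<bar>\<phi> p\<bar> \<le> max B1 (max B2 B3) \<and> \<bar>\<phi>t p\<bar> \<le> max B1 (max B2 B3) \<and> \<bar>\<phi>y p\<bar> \<le> max B1 (max B2 B3)" for p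
      using B1[of p] B2[of p] B3[of p] by auto
    show "\<phi>t (t, y) = 0 \<and> \<phi>y (t, y) = 0" if "t \<le> 0" for t y
      using zt zy K(2) that by force
  qed
qed

lemma test_function_measurable:
  assumes "test_function \<phi> \<phi>t \<phi>y"
  shows "\<phi> \<in> borel_measurable borel" "\<phi>t \<in> borel_measurable borel" "\<phi>y \<in> borel_measurable borel"
  using assms unfolding test_function_def by (auto intro: borel_measurable_continuous_onI)

lemma integral_test_function_derivs:
  assumes "test_function \<phi> \<phi>t \<phi>y"
  shows "integrable lborel \<phi>t" "integrable lborel \<phi>y"
    and "integral\<^sup>L lborel \<phi>t = 0" "integral\<^sup>L lborel \<phi>y = 0"
proof -
  obtain R B where z: "\<And>p. p \<notin> cbox (-R, -R) (R, R) \<Longrightarrow> \<phi> p = 0 \<and> \<phi>t p = 0 \<and> \<phi>y p = 0"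
    and b: "\<And>p. \<bar>\<phi> p\<bar> \<le> B \<and> \<bar>\<phi>t p\<bar> \<le> B \<and> \<bar>\<phi>y p\<bar> \<le> B"
    using test_function_support[OF assms] by metis
  have z': "\<phi> (t, y) = 0" "\<phi>t (t, y) = 0" "\<phi>y (t, y) = 0" if "R < \<bar>t\<bar> \<or> R < \<bar>y\<bar>" for t y
  proof -
    have "(t, y) \<notin> cbox (-R, -R) (R, R)" using that by (auto simp: cbox_Pair_eq)
    then show "\<phi> (t, y) = 0" "\<phi>t (t, y) = 0" "\<phi>y (t, y) = 0" using z by blast+
  qed
  have dt: "\<And>t y. ((\<lambda>s. \<phi> (s, y)) has_real_derivative \<phi>t (t, y)) (at t)"
    and dy: "\<And>t y. ((\<lambda>z. \<phi> (t, z)) has_real_derivative \<phi>y (t, y)) (at y)"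
    and cont: "continuous_on UNIV \<phi>t" "continuous_on UNIV \<phi>y"
    using assms unfolding test_function_def by blast+
  note m = test_function_measurable[OF assms]
  show it: "integrable lborel \<phi>t"
    by (rule integrable_bounded_box[OF m(2), of B]) (use z b in auto)
  show iy: "integrable lborel \<phi>y"
    by (rule integrable_bounded_box[OF m(3), of B]) (use z b in auto)
  have "integral\<^sup>L lborel \<phi>t = (LINT y|lborel. LINT t|lborel. \<phi>t (t, y))"
    using lborel_pair.integral_snd[of "\<lambda>t y. \<phi>t (t, y)"] it by (simp add: lborel_prod)
  also have "\<dots> = (LINT y::real|lborel. (0::real))"
  proof (rule Bochner_Integration.integral_cong)
    fix y show "(LINT t|lborel. \<phi>t (t, y)) = 0"
    by (rule integral_derivative_compact_support[where g = "\<lambda>t. \<phi> (t, y)" and R = R])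
       (use dt z' in \<open>auto intro!: continuous_on_compose2[OF cont(1)] continuous_intros\<close>)
  qed simp
  finally show "integral\<^sup>L lborel \<phi>t = 0" by simp
  have "integral\<^sup>L lborel \<phi>y = (LINT t|lborel. LINT y|lborel. \<phi>y (t, y))"
    using lborel_pair.integral_fst[of "\<lambda>t y. \<phi>y (t, y)"] iy by (simp add: lborel_prod)
  also have "\<dots> = (LINT t::real|lborel. (0::real))"
  proof (rule Bochner_Integration.integral_cong)
    fix t show "(LINT y|lborel. \<phi>y (t, y)) = 0"
    by (rule integral_derivative_compact_support[where g = "\<lambda>y. \<phi> (t, y)" and R = R])
       (use dy z' in \<open>auto intro!: continuous_on_compose2[OF cont(2)] continuous_intros\<close>)
  qed simp
  finally show "integral\<^sup>L lborel \<phi>y = 0" by simp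
qed

section \<open>Entropy pairs of a bounded solution\<close>

text \<open>
  An entropy solution with a convenient representative: jointly measurable on the whole plane and
  bounded by \<open>M\<close> at every point, so that no almost-everywhere qualifications enter the estimates.
  The initial datum is \<open>V 0\<close>.
\<close>

locale kruzhkov_solution =
  fixes f :: "real \<Rightarrow> real" and V :: "real \<Rightarrow> real \<Rightarrow> real" and M :: real
  assumes f_lipschitz: "\<And>A. \<exists>L. L-lipschitz_on {-A..A} f"
    and measurable_V [measurable]: "case_prod V \<in> borel_measurable (borel \<Otimes>\<^sub>M borel)"
    and V_bound: "\<And>t y. \<bar>V t y\<bar> \<le> M"
    and V_continuous: "\<And>t0 R. 0 \<le> t0 \<Longrightarrow>
      ((\<lambda>t. LINT y:{-R..R}|lborel. \<bar>V t y - V t0 y\<bar>) \<longlongrightarrow> 0) (at t0 within {0..})"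
    and V_entropy: "\<And>c \<phi> \<phi>t \<phi>y. test_function \<phi> \<phi>t \<phi>y \<Longrightarrow>
      0 \<le> (LINT (t, y)|lborel.
             \<bar>V t y - c\<bar> * \<phi>t (t, y) + sgn (V t y - c) * (f (V t y) - f c) * \<phi>y (t, y))"
begin

lemma M_nonneg: "0 \<le> M"
  using V_bound[of 0 0] by linarith

lemma f_continuous: "continuous_on UNIV f"
proof -
  have "isCont f x" for x
  proof -
    obtain L where "L-lipschitz_on {-(\<bar>x\<bar>+1)..\<bar>x\<bar>+1} f" using f_lipschitz by blast
    then have "continuous_on {-(\<bar>x\<bar>+1)..\<bar>x\<bar>+1} f" by (rule lipschitz_on_continuous_on)
    then show ?thesis by (rule continuous_on_interior) auto
  qed
  then show ?thesis by (simp add: continuous_on_eq_continuous_at)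
qed

lemma f_measurable [measurable]: "f \<in> borel_measurable borel"
  using f_continuous by (rule borel_measurable_continuous_onI)

text \<open>
  Only the values on \<open>[-M, M]\<close> matter, since \<open>V\<close> takes no others.  The defining property is the entropy
  inequality for \<open>V\<close>, which makes the pairs a convex cone.  The cone contains the constants, and also
  both signs of \<open>v\<close>, for which the two inequalities together are the weak form of the equation.
\<close>

definition entropy_pair :: "(real \<Rightarrow> real) \<Rightarrow> (real \<Rightarrow> real) \<Rightarrow> bool" where
  "entropy_pair \<eta> q \<longleftrightarrow>
     \<eta> \<in> borel_measurable borel \<and> q \<in> borel_measurable borel \<and>
     (\<exists>L. L-lipschitz_on {-M..M} \<eta>) \<and> (\<exists>B. \<forall>v\<in>{-M..M}. \<bar>q v\<bar> \<le> B) \<and>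
     (\<forall>\<phi> \<phi>t \<phi>y. test_function \<phi> \<phi>t \<phi>y \<longrightarrow>
        0 \<le> (LINT (t, y)|lborel. \<eta> (V t y) * \<phi>t (t, y) + q (V t y) * \<phi>y (t, y)))"

lemma entropy_pairD:
  assumes "entropy_pair \<eta> q"
  shows "\<eta> \<in> borel_measurable borel" "q \<in> borel_measurable borel"
    "test_function \<phi> \<phi>t \<phi>y \<Longrightarrow>
        0 \<le> (LINT (t, y)|lborel. \<eta> (V t y) * \<phi>t (t, y) + q (V t y) * \<phi>y (t, y))"
  using assms unfolding entropy_pair_def by auto

lemma entropy_pair_bound:
  assumes "entropy_pair \<eta> q"
  obtains L B where "0 \<le> L" "0 \<le> B" "\<And>t y. \<bar>\<eta> (V t y)\<bar> \<le> B" "\<And>t y. \<bar>q (V t y)\<bar> \<le> B"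
    "\<And>t y t' y'. \<bar>\<eta> (V t y) - \<eta> (V t' y')\<bar> \<le> L * \<bar>V t y - V t' y'\<bar>"
proof -
  obtain L B where L: "L-lipschitz_on {-M..M} \<eta>" and B: "\<And>v. v \<in> {-M..M} \<Longrightarrow> \<bar>q v\<bar> \<le> B"
    using assms unfolding entropy_pair_def by blast
  have V: "V t y \<in> {-M..M}" for t y using V_bound[of t y] by auto
  have lip: "\<bar>\<eta> v - \<eta> w\<bar> \<le> L * \<bar>v - w\<bar>" if "v \<in> {-M..M}" "w \<in> {-M..M}" for v w
    using lipschitz_onD[OF L that] by (simp add: dist_real_def)
  have L0: "0 \<le> L" using L by (rule lipschitz_on_nonneg)
  have "\<bar>\<eta> v\<bar> \<le> \<bar>\<eta> 0\<bar> + L * M" if "v \<in> {-M..M}" for v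
  proof -
    have "\<bar>\<eta> v - \<eta> 0\<bar> \<le> L * \<bar>v - 0\<bar>" by (rule lip) (use that M_nonneg in auto)
    also have "\<dots> \<le> L * M" using that L0 by (intro mult_left_mono) auto
    finally show ?thesis by linarith
  qed
  then have "\<bar>\<eta> v\<bar> \<le> max B (\<bar>\<eta> 0\<bar> + L * M)" if "v \<in> {-M..M}" for v
    using that by (simp add: le_max_iff_disj)
  moreover have "\<bar>q v\<bar> \<le> max B (\<bar>\<eta> 0\<bar> + L * M)" if "v \<in> {-M..M}" for v
    using B[OF that] by simp
  moreover have "0 \<le> max B (\<bar>\<eta> 0\<bar> + L * M)"
    using L0 M_nonneg by (simp add: le_max_iff_disj)
  ultimately show thesis
    using V by (intro that[of L "max B (\<bar>\<eta> 0\<bar> + L * M)"] L0 lip V) blast+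
qed

lemma integrable_entropy_pair:
  assumes "test_function \<phi> \<phi>t \<phi>y"
    and [measurable]: "g \<in> borel_measurable borel" "h \<in> borel_measurable borel"
    and "\<And>t y. \<bar>g (V t y)\<bar> \<le> B" "\<And>t y. \<bar>h (V t y)\<bar> \<le> B"
  shows "integrable lborel (\<lambda>(t, y). g (V t y) * \<phi>t (t, y) + h (V t y) * \<phi>y (t, y))"
proof -
  obtain R C where z: "\<And>p. p \<notin> cbox (-R, -R) (R, R) \<Longrightarrow> \<phi> p = 0 \<and> \<phi>t p = 0 \<and> \<phi>y p = 0"
    and b: "\<And>p. \<bar>\<phi> p\<bar> \<le> C \<and> \<bar>\<phi>t p\<bar> \<le> C \<and> \<bar>\<phi>y p\<bar> \<le> C"
    using test_function_support[OF assms(1)] by metis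
  have m [measurable]: "\<phi>t \<in> borel_measurable (borel \<Otimes>\<^sub>M borel)" "\<phi>y \<in> borel_measurable (borel \<Otimes>\<^sub>M borel)"
    using test_function_measurable[OF assms(1)] by (simp_all add: borel_prod)
  have B0: "0 \<le> B" using assms(4)[of 0 0] by linarith
  show ?thesis
  proof (rule integrable_bounded_box)
    have "(\<lambda>(t, y). g (V t y) * \<phi>t (t, y) + h (V t y) * \<phi>y (t, y)) \<in> borel_measurable (borel \<Otimes>\<^sub>M borel)"
      by measurable
    then show "(\<lambda>(t, y). g (V t y) * \<phi>t (t, y) + h (V t y) * \<phi>y (t, y)) \<in> borel_measurable borel"
      by (simp add: borel_prod)
    show "\<bar>case p of (t, y) \<Rightarrow> g (V t y) * \<phi>t (t, y) + h (V t y) * \<phi>y (t, y)\<bar> \<le> B * C + B * C" for p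
    proof -
      obtain t y where p: "p = (t, y)" by (cases p)
      have "\<bar>g (V t y) * \<phi>t p\<bar> \<le> B * C" "\<bar>h (V t y) * \<phi>y p\<bar> \<le> B * C"
        unfolding abs_mult using assms(4,5) b[of p] B0 by (auto intro!: mult_mono)
      then show ?thesis unfolding p by simp
    qed
    show "(case p of (t, y) \<Rightarrow> g (V t y) * \<phi>t (t, y) + h (V t y) * \<phi>y (t, y)) = 0"
      if "p \<notin> cbox (-R, -R) (R, R)" for p
      using z[OF that] by (cases p) auto
  qed
qed

lemma entropy_pair_abs: "entropy_pair (\<lambda>v. \<bar>v - c\<bar>) (\<lambda>v. sgn (v - c) * (f v - f c))"
  unfolding entropy_pair_def
proof (intro conjI allI impI)
  show "\<exists>L. L-lipschitz_on {-M..M} (\<lambda>v. \<bar>v - c\<bar>)"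
    by (rule exI[of _ 1]) (auto simp: lipschitz_on_def dist_real_def)
  obtain B where B: "\<And>v. v \<in> {-M..M} \<Longrightarrow> \<bar>f v\<bar> \<le> B"
    by (rule continuous_on_compact_bounded[OF compact_Icc continuous_on_subset[OF f_continuous subset_UNIV]]) blast
  have "\<bar>sgn (v - c) * (f v - f c)\<bar> \<le> B + \<bar>f c\<bar>" if "v \<in> {-M..M}" for v
  proof -
    have "\<bar>sgn (v - c) * (f v - f c)\<bar> \<le> \<bar>f v - f c\<bar>"
      by (auto simp: abs_mult abs_sgn_eq)
    then show ?thesis using B[OF that] by linarith
  qed
  then show "\<exists>B. \<forall>v\<in>{-M..M}. \<bar>sgn (v - c) * (f v - f c)\<bar> \<le> B" by blast
qed (use V_entropy in auto)

lemma entropy_pair_add_scaled: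
  assumes "entropy_pair \<eta> q" and "entropy_pair \<eta>' q'" and a: "0 \<le> a" "0 \<le> b"
  shows "entropy_pair (\<lambda>v. a * \<eta> v + b * \<eta>' v + d) (\<lambda>v. a * q v + b * q' v + e)"
proof -
  note m [measurable] = entropy_pairD(1,2)[OF assms(1)] entropy_pairD(1,2)[OF assms(2)]
  obtain B where B: "\<And>t y. \<bar>\<eta> (V t y)\<bar> \<le> B" "\<And>t y. \<bar>q (V t y)\<bar> \<le> B"
    using entropy_pair_bound[OF assms(1)] by metis
  obtain B' where B': "\<And>t y. \<bar>\<eta>' (V t y)\<bar> \<le> B'" "\<And>t y. \<bar>q' (V t y)\<bar> \<le> B'"
    using entropy_pair_bound[OF assms(2)] by metis
  show ?thesis
    unfolding entropy_pair_def
  proof (intro conjI allI impI)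
    obtain L L' where L: "L-lipschitz_on {-M..M} \<eta>" "L'-lipschitz_on {-M..M} \<eta>'"
      using assms unfolding entropy_pair_def by auto
    have "(\<bar>a\<bar> * L + \<bar>b\<bar> * L' + 0)-lipschitz_on {-M..M} (\<lambda>v. a * \<eta> v + b * \<eta>' v + d)"
      using L by (intro lipschitz_on_add lipschitz_on_cmult_real lipschitz_on_constant)
    then show "\<exists>L. L-lipschitz_on {-M..M} (\<lambda>v. a * \<eta> v + b * \<eta>' v + d)" by blast
    obtain C C' where C: "\<And>v. v \<in> {-M..M} \<Longrightarrow> \<bar>q v\<bar> \<le> C" "\<And>v. v \<in> {-M..M} \<Longrightarrow> \<bar>q' v\<bar> \<le> C'"
      using assms unfolding entropy_pair_def by blast
    have "\<bar>a * q v + b * q' v + e\<bar> \<le> a * C + b * C' + \<bar>e\<bar>" if "v \<in> {-M..M}" for v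
    proof -
      have "\<bar>a * q v\<bar> \<le> a * C" "\<bar>b * q' v\<bar> \<le> b * C'"
        using C[OF that] a by (auto simp: abs_mult intro: mult_left_mono)
      then show ?thesis by linarith
    qed
    then show "\<exists>B. \<forall>v\<in>{-M..M}. \<bar>a * q v + b * q' v + e\<bar> \<le> B" by blast
    fix \<phi> \<phi>t \<phi>y :: "real \<times> real \<Rightarrow> real"
    assume \<phi>: "test_function \<phi> \<phi>t \<phi>y"
    let ?I = "\<lambda>g h. (\<lambda>(t, y). g (V t y) * \<phi>t (t, y) + h (V t y) * \<phi>y (t, y))"
    have i1: "integrable lborel (?I \<eta> q)" by (rule integrable_entropy_pair[OF \<phi> m(1,2) B])
    have i2: "integrable lborel (?I \<eta>' q')" by (rule integrable_entropy_pair[OF \<phi> m(3,4) B'])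
    note i3 = integral_test_function_derivs[OF \<phi>]
    have "0 \<le> a * integral\<^sup>L lborel (?I \<eta> q) + b * integral\<^sup>L lborel (?I \<eta>' q')
             + (d * integral\<^sup>L lborel \<phi>t + e * integral\<^sup>L lborel \<phi>y)"
      using entropy_pairD(3)[OF assms(1) \<phi>] entropy_pairD(3)[OF assms(2) \<phi>] a i3 by simp
    also have "\<dots> = (LINT p|lborel. a * ?I \<eta> q p + b * ?I \<eta>' q' p + (d * \<phi>t p + e * \<phi>y p))"
      using i1 i2 i3 by simp
    also have "\<dots> = integral\<^sup>L lborel (?I (\<lambda>v. a * \<eta> v + b * \<eta>' v + d) (\<lambda>v. a * q v + b * q' v + e))"
      by (rule Bochner_Integration.integral_cong) (auto simp: algebra_simps)
    finally show "0 \<le> integral\<^sup>L lborel (?I (\<lambda>v. a * \<eta> v + b * \<eta>' v + d) (\<lambda>v. a * q v + b * q' v + e))" .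
  qed measurable
qed

lemma entropy_pair_cong:
  assumes "entropy_pair \<eta> q"
    and [measurable]: "\<eta>' \<in> borel_measurable borel" "q' \<in> borel_measurable borel"
    and eq: "\<And>v. \<bar>v\<bar> \<le> M \<Longrightarrow> \<eta>' v = \<eta> v" "\<And>v. \<bar>v\<bar> \<le> M \<Longrightarrow> q' v = q v"
  shows "entropy_pair \<eta>' q'"
proof -
  have "L-lipschitz_on {-M..M} \<eta>' \<longleftrightarrow> L-lipschitz_on {-M..M} \<eta>" for L
    using eq(1) by (intro lipschitz_on_cong) auto
  moreover have "(\<forall>v\<in>{-M..M}. \<bar>q' v\<bar> \<le> B) \<longleftrightarrow> (\<forall>v\<in>{-M..M}. \<bar>q v\<bar> \<le> B)" for B
    using eq(2) by (metis abs_le_iff atLeastAtMost_iff minus_le_iff)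
  moreover have "\<eta>' (V t y) = \<eta> (V t y)" "q' (V t y) = q (V t y)" for t y
    using eq V_bound by auto
  ultimately show ?thesis using assms(1) unfolding entropy_pair_def by simp
qed

text \<open>
  Kruzhkov's entropy for \<open>c = -M\<close> is \<open>v + M\<close> on the range of the solution.
\<close>

lemma entropy_pair_id: "entropy_pair (\<lambda>v. v) f"
proof (rule entropy_pair_cong[OF entropy_pair_add_scaled[OF entropy_pair_abs[of "-M"] entropy_pair_abs[of "-M"],
        of 1 0 "-M" "f (-M)"]])
  show "f v = 1 * (sgn (v - - M) * (f v - f (- M))) + 0 * (sgn (v - - M) * (f v - f (- M))) + f (- M)"
    if "\<bar>v\<bar> \<le> M" for v
    using that by (cases "v = -M") (auto simp: sgn_if)
qed auto

lemma entropy_pair_uminus: "entropy_pair (\<lambda>v. - v) (\<lambda>v. - f v)"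
proof (rule entropy_pair_cong[OF entropy_pair_add_scaled[OF entropy_pair_abs[of M] entropy_pair_abs[of M],
        of 1 0 "-M" "- f M"]])
  show "- f v = 1 * (sgn (v - M) * (f v - f M)) + 0 * (sgn (v - M) * (f v - f M)) + - f M"
    if "\<bar>v\<bar> \<le> M" for v
    using that by (cases "v = M") (auto simp: sgn_if)
qed auto

text \<open>
  The half-entropies are means of \<open>\<bar>v - c\<bar>\<close> and \<open>\<plusminus>(v - c)\<close>.  Unlike \<open>\<bar>v - c\<bar>\<close>, they vanish on a whole
  half-line of states, so that they can be switched off by a one-sided bound on the initial data.
\<close>

lemma entropy_pair_above: "entropy_pair (\<lambda>v. max 0 (v - c)) (\<lambda>v. if c < v then f v - f c else 0)"
  by (rule entropy_pair_cong[OF entropy_pair_add_scaled[OF entropy_pair_abs[of c] entropy_pair_id,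
        of "1/2" "1/2" "- c/2" "- f c/2"]]) (auto simp: sgn_if max_def abs_if field_simps)

lemma entropy_pair_below: "entropy_pair (\<lambda>v. max 0 (c - v)) (\<lambda>v. if v < c then f c - f v else 0)"
  by (rule entropy_pair_cong[OF entropy_pair_add_scaled[OF entropy_pair_abs[of c] entropy_pair_uminus,
        of "1/2" "1/2" "c/2" "f c/2"]]) (auto simp: sgn_if max_def abs_if field_simps)

end

section \<open>The entropy inequality up to the initial time\<close>

lemma abs_integral_le_interval:
  fixes g :: "real \<Rightarrow> real"
  assumes "\<And>y. \<bar>g y\<bar> \<le> K" and "\<And>y. y < a \<or> b < y \<Longrightarrow> g y = 0" and "a \<le> b"
  shows "\<bar>integral\<^sup>L lborel g\<bar> \<le> K * (b - a)"
proof -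
  have "\<bar>integral\<^sup>L lborel g\<bar> \<le> (LINT y|lborel. K * indicator {a..b} y)"
  proof (rule abs_integral_le[OF integrable_const_indicator_interval], intro AE_I2)
    show "\<bar>g y\<bar> \<le> K * indicator {a..b} y" for y
      using assms(1)[of y] assms(2)[of y] by (cases "y \<in> {a..b}") auto
  qed
  also have "\<dots> = K * (b - a)" using assms(3) by simp
  finally show ?thesis .
qed

text \<open>
  Here \<open>b\<close> places the kernel to the right of \<open>t0\<close> (\<open>b = -1\<close>) or to its left (\<open>b = 1\<close>), which keeps it
  inside the time interval on which \<open>E\<close> is controlled.
\<close>

lemma smoothstep_kernel_limit:
  fixes E :: "real \<Rightarrow> real"
  assumes [measurable]: "E \<in> borel_measurable borel"
    and bound: "\<And>t. t \<in> {0..T} \<Longrightarrow> \<bar>E t\<bar> \<le> K"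
    and \<epsilon>: "\<And>n. 0 < \<epsilon> n"
    and range: "\<And>n \<tau>. \<tau> \<in> {0..1} \<Longrightarrow> t0 + \<epsilon> n * (\<tau> - b) \<in> {0..T}"
    and lim: "\<And>\<tau>. \<tau> \<in> {0..1} \<Longrightarrow> (\<lambda>n. E (t0 + \<epsilon> n * (\<tau> - b))) \<longlonglongrightarrow> E t0"
  shows "(\<lambda>n. LINT t|lborel. smoothstep_deriv ((t - t0) / \<epsilon> n + b) / \<epsilon> n * E t) \<longlonglongrightarrow> E t0"
proof -
  note [measurable] = borel_measurable_continuous_onI[OF continuous_on_smoothstep_deriv[OF continuous_on_id]]
  have "(LINT t|lborel. smoothstep_deriv ((t - t0) / \<epsilon> n + b) / \<epsilon> n * E t)
      = (LINT \<tau>|lborel. smoothstep_deriv \<tau> * E (t0 + \<epsilon> n * (\<tau> - b)))" for n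
  proof -
    have "(LINT t|lborel. smoothstep_deriv ((t - t0) / \<epsilon> n + b) / \<epsilon> n * E t)
      = \<bar>\<epsilon> n\<bar> *\<^sub>R (LINT \<tau>|lborel. smoothstep_deriv (((t0 - \<epsilon> n * b) + \<epsilon> n * \<tau> - t0) / \<epsilon> n + b) / \<epsilon> n
              * E ((t0 - \<epsilon> n * b) + \<epsilon> n * \<tau>))"
      by (rule lborel_integral_real_affine) (use \<epsilon>[of n] in auto)
    also have "\<dots> = (LINT \<tau>|lborel. \<epsilon> n * (smoothstep_deriv (((t0 - \<epsilon> n * b) + \<epsilon> n * \<tau> - t0) / \<epsilon> n + b) / \<epsilon> n
              * E ((t0 - \<epsilon> n * b) + \<epsilon> n * \<tau>)))"
      using \<epsilon>[of n] by simp
    also have "\<dots> = (LINT \<tau>|lborel. smoothstep_deriv \<tau> * E (t0 + \<epsilon> n * (\<tau> - b)))"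
    proof (rule Bochner_Integration.integral_cong)
      fix \<tau>
      have 1: "((t0 - \<epsilon> n * b) + \<epsilon> n * \<tau> - t0) / \<epsilon> n + b = \<tau>" using \<epsilon>[of n] by (simp add: field_simps)
      have 2: "t0 - \<epsilon> n * b + \<epsilon> n * \<tau> = t0 + \<epsilon> n * (\<tau> - b)" by (simp add: algebra_simps)
      show "\<epsilon> n * (smoothstep_deriv (((t0 - \<epsilon> n * b) + \<epsilon> n * \<tau> - t0) / \<epsilon> n + b) / \<epsilon> n
              * E ((t0 - \<epsilon> n * b) + \<epsilon> n * \<tau>)) = smoothstep_deriv \<tau> * E (t0 + \<epsilon> n * (\<tau> - b))"
        unfolding 1 2 using \<epsilon>[of n] by simp
    qed simp
    finally show ?thesis .
  qed
  moreover have "(\<lambda>n. LINT \<tau>|lborel. smoothstep_deriv \<tau> * E (t0 + \<epsilon> n * (\<tau> - b)))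
      \<longlonglongrightarrow> (LINT \<tau>|lborel. smoothstep_deriv \<tau> * E t0)"
  proof (rule integral_dominated_convergence[where w = "\<lambda>\<tau>. 2 * K * indicator {0..1} \<tau>"])
    show "AE \<tau> in lborel. (\<lambda>n. smoothstep_deriv \<tau> * E (t0 + \<epsilon> n * (\<tau> - b))) \<longlonglongrightarrow> smoothstep_deriv \<tau> * E t0"
    proof (intro AE_I2)
      fix \<tau> show "(\<lambda>n. smoothstep_deriv \<tau> * E (t0 + \<epsilon> n * (\<tau> - b))) \<longlonglongrightarrow> smoothstep_deriv \<tau> * E t0"
      proof (cases "\<tau> \<in> {0..1}")
        case False
        then have "smoothstep_deriv \<tau> = 0" by (intro smoothstep_deriv_outside) auto
        then show ?thesis by simp
      qed (intro tendsto_mult_left lim)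
    qed
    show "AE \<tau> in lborel. norm (smoothstep_deriv \<tau> * E (t0 + \<epsilon> n * (\<tau> - b))) \<le> 2 * K * indicator {0..1} \<tau>" for n
    proof (intro AE_I2)
      fix \<tau>
      show "norm (smoothstep_deriv \<tau> * E (t0 + \<epsilon> n * (\<tau> - b))) \<le> 2 * K * indicator {0..1} \<tau>"
      proof (cases "\<tau> \<in> {0..1}")
        case True
        then have "\<bar>smoothstep_deriv \<tau>\<bar> * \<bar>E (t0 + \<epsilon> n * (\<tau> - b))\<bar> \<le> 2 * K"
          using bound[OF range[OF True, of n]] by (intro mult_mono) auto
        then show ?thesis using True by (simp add: abs_mult)
      qed auto
    qed
  qed auto
  ultimately show ?thesis by (simp add: integral_smoothstep_deriv)
qed

context kruzhkov_solution
begin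

text \<open>
  Test functions vanish near \<open>t = 0\<close>.  To reach the initial time, \<open>\<Psi>\<close> is multiplied by a time cutoff
  \<open>\<theta>\<^sub>n\<close> that tends to the indicator of \<open>(0, T)\<close>.  Its derivative is a difference of two
  approximate identities at \<open>0\<close> and \<open>T\<close>, and these pick out the values of the weighted entropy \<open>E\<close> there
  because \<open>E\<close> is continuous, by the continuity of \<open>V\<close> in \<open>L\<^sup>1\<close>.  The support of \<open>\<Psi>\<close> is restricted only for
  \<open>t \<ge> 0\<close>, so that cutoffs which move in time are admissible.
\<close>

lemma entropy_inequality_from_initial_time:
  fixes \<Psi> \<Psi>t \<Psi>y :: "real \<times> real \<Rightarrow> real"
  assumes pair: "entropy_pair \<eta> q"
    and nonneg: "\<And>p. 0 \<le> \<Psi> p"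
    and dt: "\<And>t y. ((\<lambda>s. \<Psi> (s, y)) has_real_derivative \<Psi>t (t, y)) (at t)"
    and dy: "\<And>t y. ((\<lambda>z. \<Psi> (t, z)) has_real_derivative \<Psi>y (t, y)) (at y)"
    and cont: "continuous_on UNIV \<Psi>" "continuous_on UNIV \<Psi>t" "continuous_on UNIV \<Psi>y"
    and supp: "\<And>t y. 0 \<le> t \<Longrightarrow> R < \<bar>y\<bar> \<Longrightarrow> \<Psi> (t, y) = 0 \<and> \<Psi>t (t, y) = 0 \<and> \<Psi>y (t, y) = 0"
    and T: "0 < T"
  shows "(LINT y|lborel. \<eta> (V T y) * \<Psi> (T, y)) \<le> (LINT y|lborel. \<eta> (V 0 y) * \<Psi> (0, y))
    + (LINT t:{0<..<T}|lborel. LINT y|lborel. \<eta> (V t y) * \<Psi>t (t, y) + q (V t y) * \<Psi>y (t, y))"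
    (is ?ineq)
  and "set_integrable lborel {0<..<T}
    (\<lambda>t. LINT y|lborel. \<eta> (V t y) * \<Psi>t (t, y) + q (V t y) * \<Psi>y (t, y))"
    (is ?integrable)
proof -
  define E where "E = (\<lambda>t. LINT y|lborel. \<eta> (V t y) * \<Psi> (t, y))"
  define D where "D = (\<lambda>t. LINT y|lborel. \<eta> (V t y) * \<Psi>t (t, y) + q (V t y) * \<Psi>y (t, y))"
  define R' where "R' = max 0 R"
  have R': "0 \<le> R'" and supp': "\<And>t y. 0 \<le> t \<Longrightarrow> R' < \<bar>y\<bar> \<Longrightarrow> \<Psi> (t, y) = 0 \<and> \<Psi>t (t, y) = 0 \<and> \<Psi>y (t, y) = 0"
    using supp by (auto simp: R'_def)
  obtain L B where L: "0 \<le> L" "0 \<le> B" "\<And>t y. \<bar>\<eta> (V t y)\<bar> \<le> B" "\<And>t y. \<bar>q (V t y)\<bar> \<le> B"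
    "\<And>t y t' y'. \<bar>\<eta> (V t y) - \<eta> (V t' y')\<bar> \<le> L * \<bar>V t y - V t' y'\<bar>"
    using entropy_pair_bound[OF pair] by metis
  note [measurable] = entropy_pairD(1,2)[OF pair]
  have [measurable]: "\<Psi> \<in> borel_measurable (borel \<Otimes>\<^sub>M borel)" "\<Psi>t \<in> borel_measurable (borel \<Otimes>\<^sub>M borel)"
    "\<Psi>y \<in> borel_measurable (borel \<Otimes>\<^sub>M borel)"
    using cont by (auto simp: borel_prod intro: borel_measurable_continuous_onI)
  have bdd: "\<exists>C. \<forall>p \<in> {0..T} \<times> {-R'..R'}. \<bar>g p\<bar> \<le> C" if "continuous_on UNIV g" for g :: "real \<times> real \<Rightarrow> real"
    by (rule continuous_on_compact_bounded[OF compact_Times[OF compact_Icc compact_Icc]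
          continuous_on_subset[OF that subset_UNIV]]) blast
  obtain C1 C2 C3 where C123: "\<And>p. p \<in> {0..T} \<times> {-R'..R'} \<Longrightarrow> \<bar>\<Psi> p\<bar> \<le> C1"
     "\<And>p. p \<in> {0..T} \<times> {-R'..R'} \<Longrightarrow> \<bar>\<Psi>t p\<bar> \<le> C2" "\<And>p. p \<in> {0..T} \<times> {-R'..R'} \<Longrightarrow> \<bar>\<Psi>y p\<bar> \<le> C3"
    using bdd[OF cont(1)] bdd[OF cont(2)] bdd[OF cont(3)] by blast
  define C where "C = max 0 (max C1 (max C2 C3))"
  have C0: "0 \<le> C" by (simp add: C_def)
  have C: "\<bar>\<Psi> (t, y)\<bar> \<le> C" "\<bar>\<Psi>t (t, y)\<bar> \<le> C" "\<bar>\<Psi>y (t, y)\<bar> \<le> C" if "t \<in> {0..T}" for t y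
  proof -
    have "\<bar>\<Psi> (t, y)\<bar> \<le> C \<and> \<bar>\<Psi>t (t, y)\<bar> \<le> C \<and> \<bar>\<Psi>y (t, y)\<bar> \<le> C"
    proof (cases "\<bar>y\<bar> \<le> R'")
      case True
      then have "(t, y) \<in> {0..T} \<times> {-R'..R'}" using that by auto
      then show ?thesis using C123 by (fastforce simp: C_def)
    next
      case False
      then show ?thesis using supp'[of t y] that C0 by simp
    qed
    then show "\<bar>\<Psi> (t, y)\<bar> \<le> C" "\<bar>\<Psi>t (t, y)\<bar> \<le> C" "\<bar>\<Psi>y (t, y)\<bar> \<le> C" by auto
  qed
  have ym [measurable]: "(\<lambda>y. g (t, y)) \<in> borel_measurable borel"
    if "g \<in> borel_measurable (borel \<Otimes>\<^sub>M borel)" for g :: "real \<times> real \<Rightarrow> real" and t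
    using that by simp
  have Em [measurable]: "E \<in> borel_measurable borel" unfolding E_def by measurable
  have Dm [measurable]: "D \<in> borel_measurable borel" unfolding D_def by measurable
  have prod_le: "\<bar>g * h\<bar> \<le> B * C" if "\<bar>g\<bar> \<le> B" "\<bar>h\<bar> \<le> C" for g h :: real
    unfolding abs_mult using that L(2) by (intro mult_mono) auto
  have int1: "integrable lborel (\<lambda>y. \<eta> (V s y) * \<Psi> (t, y))" if "t \<in> {0..T}" for s t
    by (rule integrable_bounded_interval[of _ "B * C" "-R'" R'])
       (use that L(3) C supp' in \<open>auto intro!: prod_le\<close>)
  have int2: "integrable lborel (\<lambda>y. \<eta> (V t y) * \<Psi>t (t, y))" if "t \<in> {0..T}" for t
    by (rule integrable_bounded_interval[of _ "B * C" "-R'" R'])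
       (use that L(3) C supp' in \<open>auto intro!: prod_le\<close>)
  have int3: "integrable lborel (\<lambda>y. q (V t y) * \<Psi>y (t, y))" if "t \<in> {0..T}" for t
    by (rule integrable_bounded_interval[of _ "B * C" "-R'" R'])
       (use that L(4) C supp' in \<open>auto intro!: prod_le\<close>)
  have E_bound: "\<bar>E t\<bar> \<le> (B * C) * (R' - (-R'))" if "t \<in> {0..T}" for t
    unfolding E_def by (rule abs_integral_le_interval) (use that L(3) C supp' R' in \<open>auto intro!: prod_le\<close>)
  have D_bound: "\<bar>D t\<bar> \<le> (B * C + B * C) * (R' - (-R'))" if "t \<in> {0..T}" for t
    unfolding D_def
  proof (rule abs_integral_le_interval)
    show "\<bar>\<eta> (V t y) * \<Psi>t (t, y) + q (V t y) * \<Psi>y (t, y)\<bar> \<le> B * C + B * C" for y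
      using prod_le[OF L(3) C(2)[OF that], of t y y] prod_le[OF L(4) C(3)[OF that], of t y y] by linarith
  qed (use that supp' R' in auto)
  have E_seq: "(\<lambda>n. E (s n)) \<longlonglongrightarrow> E t0" if s: "\<And>n. s n \<in> {0..T}" "s \<longlonglongrightarrow> t0" "t0 \<in> {0..T}" for s t0
  proof -
    have 1: "(\<lambda>n. LINT y|lborel. \<eta> (V t0 y) * \<Psi> (s n, y)) \<longlonglongrightarrow> E t0"
      unfolding E_def
    proof (rule integral_dominated_convergence[where w = "\<lambda>y. (B * C) * indicator {-R'..R'} y"])
      show "AE y in lborel. (\<lambda>n. \<eta> (V t0 y) * \<Psi> (s n, y)) \<longlonglongrightarrow> \<eta> (V t0 y) * \<Psi> (t0, y)"
      proof (intro AE_I2 tendsto_mult_left)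
        fix y
        have "isCont \<Psi> (t0, y)" using cont(1) by (simp add: continuous_on_eq_continuous_at)
        then show "(\<lambda>n. \<Psi> (s n, y)) \<longlonglongrightarrow> \<Psi> (t0, y)"
          by (rule isCont_tendsto_compose) (intro tendsto_intros s)
      qed
      show "AE y in lborel. norm (\<eta> (V t0 y) * \<Psi> (s n, y)) \<le> B * C * indicator {-R'..R'} y" for n
      proof (intro AE_I2)
        fix y show "norm (\<eta> (V t0 y) * \<Psi> (s n, y)) \<le> B * C * indicator {-R'..R'} y"
          using prod_le[OF L(3) C(1)[OF s(1)], of t0 y n y] supp'[of "s n" y] s(1)[of n]
          by (cases "\<bar>y\<bar> \<le> R'") (auto simp: indicator_def)
      qed
      show "integrable lborel (\<lambda>y. (B * C) * indicator {-R'..R'} y)"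
        by (rule integrable_const_indicator_interval)
    qed auto
    have "continuous (at t0 within {0..}) (\<lambda>t. LINT y:{-R'..R'}|lborel. \<bar>V t y - V t0 y\<bar>)"
      using V_continuous[of t0 R'] s(3) by (simp add: continuous_within)
    then have "(\<lambda>n. LINT y:{-R'..R'}|lborel. \<bar>V (s n) y - V t0 y\<bar>) \<longlonglongrightarrow> 0"
      using s unfolding continuous_within_sequentially comp_def by fastforce
    then have lim0: "(\<lambda>n. L * C * (LINT y:{-R'..R'}|lborel. \<bar>V (s n) y - V t0 y\<bar>)) \<longlonglongrightarrow> 0"
      by (rule tendsto_mult_right_zero)
    have 2: "(\<lambda>n. E (s n) - (LINT y|lborel. \<eta> (V t0 y) * \<Psi> (s n, y))) \<longlonglongrightarrow> 0"
    proof (rule Lim_null_comparison[OF _ lim0], intro always_eventually allI)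
      fix n
      have "E (s n) - (LINT y|lborel. \<eta> (V t0 y) * \<Psi> (s n, y))
          = (LINT y|lborel. \<eta> (V (s n) y) * \<Psi> (s n, y) - \<eta> (V t0 y) * \<Psi> (s n, y))"
        unfolding E_def using int1[OF s(1)] by simp
      also have "norm \<dots> \<le> (LINT y|lborel. L * C * (indicator {-R'..R'} y * \<bar>V (s n) y - V t0 y\<bar>))"
        unfolding real_norm_def
      proof (rule abs_integral_le[OF _ AE_I2])
        show "integrable lborel (\<lambda>y. L * C * (indicator {-R'..R'} y * \<bar>V (s n) y - V t0 y\<bar>))"
        proof (intro integrable_mult_right integrable_bounded_interval[of _ "2 * M" "-R'" R'])
          show "\<bar>indicator {-R'..R'} y * \<bar>V (s n) y - V t0 y\<bar>\<bar> \<le> 2 * M" for y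
            using V_bound[of "s n" y] V_bound[of t0 y] by (auto simp: indicator_def)
        qed auto
        show "\<bar>\<eta> (V (s n) y) * \<Psi> (s n, y) - \<eta> (V t0 y) * \<Psi> (s n, y)\<bar>
            \<le> L * C * (indicator {-R'..R'} y * \<bar>V (s n) y - V t0 y\<bar>)" for y
        proof (cases "\<bar>y\<bar> \<le> R'")
          case True
          have "\<bar>\<eta> (V (s n) y) * \<Psi> (s n, y) - \<eta> (V t0 y) * \<Psi> (s n, y)\<bar>
             = \<bar>\<eta> (V (s n) y) - \<eta> (V t0 y)\<bar> * \<bar>\<Psi> (s n, y)\<bar>"
            by (simp add: abs_mult[symmetric] algebra_simps)
          also have "\<dots> \<le> (L * \<bar>V (s n) y - V t0 y\<bar>) * C"
            using L(1) by (intro mult_mono L(5) C(1) s(1)) auto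
          finally show ?thesis using True by (simp add: mult_ac indicator_def abs_le_iff)
        next
          case False
          then show ?thesis using supp'[of "s n" y] s(1)[of n] L(1) C0 by simp
        qed
      qed
      also have "\<dots> = L * C * (LINT y:{-R'..R'}|lborel. \<bar>V (s n) y - V t0 y\<bar>)"
        by (simp add: set_lebesgue_integral_def)
      finally show "norm (E (s n) - (LINT y|lborel. \<eta> (V t0 y) * \<Psi> (s n, y)))
          \<le> L * C * (LINT y:{-R'..R'}|lborel. \<bar>V (s n) y - V t0 y\<bar>)" .
    qed
    show ?thesis using tendsto_add[OF 2 1] by simp
  qed
  \<comment> \<open>The cutoff rises on \<open>[\<epsilon>, 2\<epsilon>]\<close> and falls on \<open>[T - \<epsilon>, T]\<close>; the offset \<open>3\<close> keeps these ramps apart.\<close>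
  define \<epsilon> where "\<epsilon> = (\<lambda>n. T / real (n + 3))"
  have \<epsilon>0: "0 < \<epsilon> n" and \<epsilon>T: "3 * \<epsilon> n \<le> T" for n
    using T by (auto simp: \<epsilon>_def field_simps)
  have \<epsilon>lim: "\<epsilon> \<longlonglongrightarrow> 0"
    unfolding \<epsilon>_def using LIMSEQ_ignore_initial_segment[OF lim_const_over_n[of T], of 3] by simp
  define k where "k = (\<lambda>t0 b n t. smoothstep_deriv ((t - t0) / \<epsilon> n + b) / \<epsilon> n)"
  define \<theta> where "\<theta> = (\<lambda>n t. smoothstep (t / \<epsilon> n - 1) - smoothstep ((t - T) / \<epsilon> n + 1))"
  define \<theta>' where "\<theta>' = (\<lambda>n t. k 0 (- 1) n t - k T 1 n t)"
  have k_cont: "continuous_on A g \<Longrightarrow> continuous_on A (\<lambda>x. k t0 b n (g x))"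
    for t0 b n and g :: "'z::topological_space \<Rightarrow> real" and A
    unfolding k_def using \<epsilon>0[of n] by (intro continuous_intros) auto
  have [measurable]: "k t0 b n \<in> borel_measurable borel" for t0 b n
    by (rule borel_measurable_continuous_onI[OF k_cont[OF continuous_on_id, unfolded id_def]])
  have \<theta>_cont: "continuous_on A g \<Longrightarrow> continuous_on A (\<lambda>x. \<theta> n (g x))"
    for n and g :: "'z::topological_space \<Rightarrow> real" and A
    unfolding \<theta>_def using \<epsilon>0[of n] by (intro continuous_intros) auto
  have [measurable]: "\<theta> n \<in> borel_measurable borel" for n
    by (rule borel_measurable_continuous_onI[OF \<theta>_cont[OF continuous_on_id, unfolded id_def]])
  have \<theta>'_cont: "continuous_on A g \<Longrightarrow> continuous_on A (\<lambda>x. \<theta>' n (g x))"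
    for n and g :: "'z::topological_space \<Rightarrow> real" and A
    unfolding \<theta>'_def by (intro continuous_intros k_cont)
  have \<theta>_deriv: "(\<theta> n has_real_derivative \<theta>' n t) (at t)" for n t
    unfolding \<theta>_def[abs_def] \<theta>'_def k_def using \<epsilon>0[of n]
    by (auto intro!: derivative_eq_intros)
  have \<theta>_nonneg: "0 \<le> \<theta> n t" for n t
  proof -
    have "(t - T) / \<epsilon> n + 1 \<le> t / \<epsilon> n - 1" using \<epsilon>0[of n] \<epsilon>T[of n] by (simp add: field_simps)
    then show ?thesis unfolding \<theta>_def using smoothstep_mono by simp
  qed
  have \<theta>_le_1: "\<theta> n t \<le> 1" for n t
    unfolding \<theta>_def using smoothstep_le_1[of "t / \<epsilon> n - 1"] smoothstep_nonneg[of "(t - T) / \<epsilon> n + 1"] by linarith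
  have \<theta>_0: "\<theta> n t = 0" if "t \<le> \<epsilon> n \<or> T \<le> t" for n t
  proof -
    have "\<theta> n t = 0" if "t \<le> \<epsilon> n"
    proof -
      have "t / \<epsilon> n - 1 \<le> 0" "(t - T) / \<epsilon> n + 1 \<le> 0"
        using that \<epsilon>0[of n] \<epsilon>T[of n] by (auto simp: field_simps)
      then show ?thesis by (simp add: \<theta>_def)
    qed
    moreover have "\<theta> n t = 0" if "T \<le> t"
    proof -
      have "1 \<le> t / \<epsilon> n - 1" "1 \<le> (t - T) / \<epsilon> n + 1"
        using that \<epsilon>0[of n] \<epsilon>T[of n] by (auto simp: field_simps)
      then show ?thesis by (simp add: \<theta>_def)
    qed
    ultimately show ?thesis using that by blast
  qed
  have k_0: "k 0 (-1) n t = 0 \<and> k T 1 n t = 0" if "t \<notin> {0<..<T}" for n t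
  proof -
    have "(t - 0) / \<epsilon> n + (-1) \<le> 0 \<or> 1 \<le> (t - 0) / \<epsilon> n + (-1)"
      "(t - T) / \<epsilon> n + 1 \<le> 0 \<or> 1 \<le> (t - T) / \<epsilon> n + 1"
      using that \<epsilon>0[of n] \<epsilon>T[of n] by (auto simp: field_simps)
    then show ?thesis by (simp add: k_def)
  qed
  have k_bound: "\<bar>k t0 b n t\<bar> \<le> 2 / \<epsilon> n" for t0 b n t
    unfolding k_def using \<epsilon>0[of n] by (simp add: abs_mult divide_right_mono)
  have intk: "integrable lborel (\<lambda>t. k 0 (-1) n t * E t)" "integrable lborel (\<lambda>t. k T 1 n t * E t)" for n
  proof -
    have b: "\<bar>k t0 b n t * E t\<bar> \<le> 2 / \<epsilon> n * ((B * C) * (R' - (-R')))" if "t \<in> {0..T}" for t0 b t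
      unfolding abs_mult using E_bound[OF that] \<epsilon>0[of n] by (intro mult_mono k_bound) auto
    have pos: "0 \<le> 2 / \<epsilon> n * ((B * C) * (R' - (-R')))" using \<epsilon>0[of n] L(2) C0 R' by simp
    show "integrable lborel (\<lambda>t. k 0 (-1) n t * E t)"
    proof (rule integrable_bounded_interval[of _ "2 / \<epsilon> n * ((B * C) * (R' - (-R')))" 0 T])
      fix t show "\<bar>k 0 (-1) n t * E t\<bar> \<le> 2 / \<epsilon> n * ((B * C) * (R' - (-R')))"
        using b[of t 0 "-1"] pos k_0[of t n] by (cases "t \<in> {0..T}") (auto simp del: abs_mult)
    qed (use k_0 in auto)
    show "integrable lborel (\<lambda>t. k T 1 n t * E t)"
    proof (rule integrable_bounded_interval[of _ "2 / \<epsilon> n * ((B * C) * (R' - (-R')))" 0 T])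
      fix t show "\<bar>k T 1 n t * E t\<bar> \<le> 2 / \<epsilon> n * ((B * C) * (R' - (-R')))"
        using b[of t T 1] pos k_0[of t n] by (cases "t \<in> {0..T}") (auto simp del: abs_mult)
    qed (use k_0 in auto)
  qed
  have \<theta>D_bound: "\<bar>\<theta> n t * D t\<bar> \<le> (B * C + B * C) * (R' - (-R')) * indicator {0..T} t" for n t
  proof (cases "t \<in> {0..T}")
    case True
    then have "\<bar>\<theta> n t\<bar> * \<bar>D t\<bar> \<le> 1 * ((B * C + B * C) * (R' - (-R')))"
      using D_bound[OF True] \<theta>_nonneg[of n t] \<theta>_le_1[of n t] by (intro mult_mono) auto
    then show ?thesis using True by (simp add: abs_mult)
  next
    case False
    then have "\<theta> n t = 0" using \<theta>_0[of t n] \<epsilon>0[of n] by auto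
    then show ?thesis using False by simp
  qed
  have int\<theta>: "integrable lborel (\<lambda>t. \<theta> n t * D t)" for n
  proof (rule integrable_bounded_interval[of _ "(B * C + B * C) * (R' - (-R'))" 0 T])
    fix t show "\<bar>\<theta> n t * D t\<bar> \<le> (B * C + B * C) * (R' - (-R'))"
      using \<theta>D_bound[of n t] L(2) C0 R' by (cases "t \<in> {0..T}") (auto intro: order_trans simp del: abs_mult)
    show "\<theta> n t * D t = 0" if "t < 0 \<or> T < t" using \<theta>D_bound[of n t] that by auto
  qed auto
  have ineq: "0 \<le> (LINT t|lborel. k 0 (-1) n t * E t) - (LINT t|lborel. k T 1 n t * E t)
      + (LINT t|lborel. \<theta> n t * D t)" for n
  proof -
    define \<phi> where "\<phi> = (\<lambda>p. \<theta> n (fst p) * \<Psi> p)"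
    define \<phi>t where "\<phi>t = (\<lambda>p. \<theta>' n (fst p) * \<Psi> p + \<theta> n (fst p) * \<Psi>t p)"
    define \<phi>y where "\<phi>y = (\<lambda>p. \<theta> n (fst p) * \<Psi>y p)"
    have tf: "test_function \<phi> \<phi>t \<phi>y"
      unfolding test_function_def
    proof (intro conjI allI)
      show "0 \<le> \<phi> p" for p unfolding \<phi>_def using \<theta>_nonneg nonneg by simp
      show "((\<lambda>s. \<phi> (s, y)) has_real_derivative \<phi>t (t, y)) (at t)" for t y
        unfolding \<phi>_def \<phi>t_def using DERIV_mult[OF \<theta>_deriv[of n t] dt[of y t]]
        by (simp add: algebra_simps)
      show "((\<lambda>z. \<phi> (t, z)) has_real_derivative \<phi>y (t, y)) (at y)" for t y
        unfolding \<phi>_def \<phi>y_def using DERIV_cmult[OF dy[of t y]] by simp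
      show "continuous_on UNIV \<phi>" "continuous_on UNIV \<phi>t" "continuous_on UNIV \<phi>y"
        unfolding \<phi>_def \<phi>t_def \<phi>y_def by (intro continuous_intros \<theta>_cont \<theta>'_cont cont)+
      show "\<exists>K. compact K \<and> K \<subseteq> {0<..} \<times> UNIV \<and> (\<forall>p. p \<notin> K \<longrightarrow> \<phi> p = 0)"
      proof (intro exI[of _ "{\<epsilon> n..T} \<times> {-R'..R'}"] conjI allI impI)
        show "compact ({\<epsilon> n..T} \<times> {-R'..R'})" by (intro compact_Times) auto
        show "{\<epsilon> n..T} \<times> {-R'..R'} \<subseteq> {0<..} \<times> UNIV" using \<epsilon>0[of n] by auto
        fix p assume p: "p \<notin> {\<epsilon> n..T} \<times> {-R'..R'}"
        obtain t y where ty: "p = (t, y)" by (cases p)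
        show "\<phi> p = 0"
        proof (cases "t \<le> \<epsilon> n \<or> T \<le> t")
          case True then show ?thesis using \<theta>_0[of t n] by (simp add: \<phi>_def ty)
        next
          case False
          then have "R' < \<bar>y\<bar>" "0 \<le> t" using p ty \<epsilon>0[of n] by auto
          then show ?thesis using supp' by (simp add: \<phi>_def ty)
        qed
      qed
    qed
    have "0 \<le> (LINT (t, y)|lborel. \<eta> (V t y) * \<phi>t (t, y) + q (V t y) * \<phi>y (t, y))"
      by (rule entropy_pairD(3)[OF pair tf])
    also have "\<dots> = (LINT t|lborel. LINT y|lborel. \<eta> (V t y) * \<phi>t (t, y) + q (V t y) * \<phi>y (t, y))"
      using lborel_pair.integral_fst[of "\<lambda>t y. \<eta> (V t y) * \<phi>t (t, y) + q (V t y) * \<phi>y (t, y)"]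
        integrable_entropy_pair[OF tf entropy_pairD(1,2)[OF pair] L(3,4)]
      by (simp add: lborel_prod)
    also have "\<dots> = (LINT t|lborel. (k 0 (-1) n t * E t - k T 1 n t * E t) + \<theta> n t * D t)"
    proof (rule Bochner_Integration.integral_cong)
      fix t :: real
      show "(LINT y|lborel. \<eta> (V t y) * \<phi>t (t, y) + q (V t y) * \<phi>y (t, y))
          = (k 0 (-1) n t * E t - k T 1 n t * E t) + \<theta> n t * D t"
      proof (cases "t \<in> {0<..<T}")
        case True
        then have t: "t \<in> {0..T}" by auto
        have "(LINT y|lborel. \<eta> (V t y) * \<phi>t (t, y) + q (V t y) * \<phi>y (t, y))
          = (LINT y|lborel. \<theta>' n t * (\<eta> (V t y) * \<Psi> (t, y)) +
               \<theta> n t * (\<eta> (V t y) * \<Psi>t (t, y) + q (V t y) * \<Psi>y (t, y)))"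
          by (rule Bochner_Integration.integral_cong) (auto simp: \<phi>t_def \<phi>y_def algebra_simps)
        also have "\<dots> = \<theta>' n t * E t + \<theta> n t * D t"
          unfolding E_def D_def using int1[OF t] int2[OF t] int3[OF t] by simp
        finally show ?thesis by (simp add: \<theta>'_def algebra_simps)
      next
        case False
        then have "\<theta> n t = 0" "k 0 (-1) n t = 0" "k T 1 n t = 0" using \<theta>_0[of t n] k_0[of t n] \<epsilon>0[of n] by auto
        then show ?thesis by (simp add: \<phi>t_def \<phi>y_def \<theta>'_def)
      qed
    qed simp
    also have "\<dots> = (LINT t|lborel. k 0 (-1) n t * E t) - (LINT t|lborel. k T 1 n t * E t)
      + (LINT t|lborel. \<theta> n t * D t)"
      using intk int\<theta> by simp
    finally show ?thesis .
  qed
  have \<epsilon>_bounds: "0 + \<epsilon> n * (\<tau> - (-1)) \<in> {0..T}" "T + \<epsilon> n * (\<tau> - 1) \<in> {0..T}" if "\<tau> \<in> {0..1}" for n \<tau>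
  proof -
    have "0 \<le> \<epsilon> n * \<tau>" "\<epsilon> n * \<tau> \<le> \<epsilon> n"
      using that \<epsilon>0[of n] by auto
    then show "0 + \<epsilon> n * (\<tau> - (-1)) \<in> {0..T}" "T + \<epsilon> n * (\<tau> - 1) \<in> {0..T}"
      using \<epsilon>T[of n] \<epsilon>0[of n] unfolding atLeastAtMost_iff right_diff_distrib by linarith+
  qed
  have shrink: "(\<lambda>n. t0 + \<epsilon> n * (\<tau> - b)) \<longlonglongrightarrow> t0" for t0 \<tau> b
    using tendsto_add[OF tendsto_const[of t0] tendsto_mult_left_zero[OF \<epsilon>lim, of "\<tau> - b"]] by simp
  have lim1: "(\<lambda>n. LINT t|lborel. k 0 (-1) n t * E t) \<longlonglongrightarrow> E 0"
    unfolding k_def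
    by (rule smoothstep_kernel_limit[OF Em E_bound \<epsilon>0])
       (use \<epsilon>_bounds(1) T in \<open>auto intro!: E_seq shrink[of 0 _ "-1", simplified]\<close>)
  have lim2: "(\<lambda>n. LINT t|lborel. k T 1 n t * E t) \<longlonglongrightarrow> E T"
    unfolding k_def
    by (rule smoothstep_kernel_limit[OF Em E_bound \<epsilon>0 \<epsilon>_bounds(2)])
       (use \<epsilon>_bounds(2) T shrink[of T _ 1] in \<open>auto intro!: E_seq\<close>)
  have "(\<lambda>n. LINT t|lborel. \<theta> n t * D t) \<longlonglongrightarrow> (LINT t|lborel. indicator {0<..<T} t * D t)"
  proof (rule integral_dominated_convergence[where w = "\<lambda>t. (B * C + B * C) * (R' - (-R')) * indicator {0..T} t"])
    show "AE t in lborel. (\<lambda>n. \<theta> n t * D t) \<longlonglongrightarrow> indicator {0<..<T} t * D t"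
    proof (intro AE_I2 tendsto_mult_right)
      fix t
      show "(\<lambda>n. \<theta> n t) \<longlonglongrightarrow> indicator {0<..<T} t"
      proof (cases "t \<in> {0<..<T}")
        case True
        have "\<forall>\<^sub>F n in sequentially. \<epsilon> n < min (t / 2) (T - t)"
          by (rule order_tendstoD(2)[OF \<epsilon>lim]) (use True in auto)
        then have "\<forall>\<^sub>F n in sequentially. \<theta> n t = 1"
        proof eventually_elim
          case (elim n)
          then have "1 \<le> t / \<epsilon> n - 1" "(t - T) / \<epsilon> n + 1 \<le> 0"
            using \<epsilon>0[of n] by (auto simp: field_simps)
          then show ?case by (simp add: \<theta>_def)
        qed
        then show ?thesis using True by (simp add: tendsto_eventually)
      next
        case False
        then have "\<theta> n t = 0" for n using \<theta>_0[of t n] \<epsilon>0[of n] by auto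
        then show ?thesis using False by simp
      qed
    qed
    show "AE t in lborel. norm (\<theta> n t * D t) \<le> (B * C + B * C) * (R' - (-R')) * indicator {0..T} t" for n
      using \<theta>D_bound[of n] by auto
    show "integrable lborel (\<lambda>t. (B * C + B * C) * (R' - (-R')) * indicator {0..T} t)"
      by (rule integrable_const_indicator_interval)
  qed auto
  then have "0 \<le> E 0 - E T + (LINT t|lborel. indicator {0<..<T} t * D t)"
    by (intro LIMSEQ_le_const[OF tendsto_add[OF tendsto_diff[OF lim1 lim2]]]) (use ineq in auto)
  then show ?ineq unfolding E_def D_def by (simp add: set_lebesgue_integral_def)
  show ?integrable
    unfolding D_def[symmetric] set_integrable_def
  proof (rule integrable_bounded_interval[of _ "(B * C + B * C) * (R' - (-R'))" 0 T])
    fix t show "\<bar>indicator {0<..<T} t *\<^sub>R D t\<bar> \<le> (B * C + B * C) * (R' - (-R'))"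
      using D_bound[of t] L(2) C0 R' by (cases "t \<in> {0<..<T}") auto
  qed auto
qed

end

lemma continuous_bounded_of_support:
  fixes h :: "real \<Rightarrow> real"
  assumes "continuous_on UNIV h" and "\<And>y. y < a \<or> b < y \<Longrightarrow> h y = 0"
  obtains C where "0 \<le> C" "\<And>y. \<bar>h y\<bar> \<le> C"
proof -
  obtain C where C: "\<And>y. y \<in> {a..b} \<Longrightarrow> \<bar>h y\<bar> \<le> C"
    by (rule continuous_on_compact_bounded[OF compact_Icc continuous_on_subset[OF assms(1) subset_UNIV]]) blast
  have "\<bar>h y\<bar> \<le> max 0 C" for y
    using C[of y] assms(2)[of y] by (cases "y \<in> {a..b}") auto
  then show thesis by (intro that[of "max 0 C"]) auto
qed

section \<open>Step profiles\<close>

text \<open>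
  The derivative \<open>\<sigma>'\<close> smears a point evaluation at \<open>z\<close> over the width \<open>d\<close>.  The ramp may sit anywhere
  within \<open>[z - d, z + d]\<close>; this freedom is used to look at a Riemann solution from either side.
\<close>

definition step_profile :: "real \<Rightarrow> real \<Rightarrow> (real \<Rightarrow> real) \<Rightarrow> (real \<Rightarrow> real) \<Rightarrow> bool" where
  "step_profile z d \<sigma> \<sigma>' \<longleftrightarrow>
     (\<forall>y. (\<sigma> has_real_derivative \<sigma>' y) (at y)) \<and> continuous_on UNIV \<sigma>' \<and> (\<forall>y. 0 \<le> \<sigma>' y) \<and>
     (\<forall>y\<le>z - d. \<sigma> y = 0) \<and> (\<forall>y\<ge>z + d. \<sigma> y = 1)"

lemma step_profileD:
  assumes "step_profile z d \<sigma> \<sigma>'"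
  shows "(\<sigma> has_real_derivative \<sigma>' y) (at y)" "continuous_on UNIV \<sigma>'" "0 \<le> \<sigma>' y"
    "y \<le> z - d \<Longrightarrow> \<sigma> y = 0" "z + d \<le> y \<Longrightarrow> \<sigma> y = 1"
  using assms unfolding step_profile_def by auto

lemma step_profile_range:
  assumes "step_profile z d \<sigma> \<sigma>'"
  shows "0 \<le> \<sigma> y" "\<sigma> y \<le> 1"
proof -
  have mono: "\<sigma> x \<le> \<sigma> y" if "x \<le> y" for x y
    by (rule DERIV_nonneg_imp_nondecreasing[OF that]) (use step_profileD[OF assms] in blast)
  show "0 \<le> \<sigma> y" using mono[of "min y (z - d)" y] step_profileD(4)[OF assms, of "min y (z - d)"] by simp
  show "\<sigma> y \<le> 1" using mono[of y "max y (z + d)"] step_profileD(5)[OF assms, of "max y (z + d)"] by simp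
qed

lemma step_profile_deriv_0:
  assumes "step_profile z d \<sigma> \<sigma>'" "y < z - d \<or> z + d < y"
  shows "\<sigma>' y = 0"
proof -
  have "(\<sigma> has_real_derivative 0) (at y)"
    using assms(2)
  proof
    assume y: "y < z - d"
    have "((\<lambda>_. 0) has_real_derivative 0) (at y)" by simp
    then have "(\<sigma> has_real_derivative 0) (at y)"
      by (rule has_field_derivative_transform_within_open[where S = "{..<z - d}"])
         (use y step_profileD(4)[OF assms(1)] in auto)
    then show ?thesis .
  next
    assume y: "z + d < y"
    have "((\<lambda>_. 1) has_real_derivative 0) (at y)" by simp
    then have "(\<sigma> has_real_derivative 0) (at y)"
      by (rule has_field_derivative_transform_within_open[where S = "{z + d<..}"])
         (use y step_profileD(5)[OF assms(1)] in auto)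
    then show ?thesis .
  qed
  then show ?thesis by (rule DERIV_unique[OF step_profileD(1)[OF assms(1)]])
qed

lemma continuous_on_step_profile:
  assumes "step_profile z d \<sigma> \<sigma>'" and "continuous_on A g"
  shows "continuous_on A (\<lambda>x. \<sigma> (g x))" "continuous_on A (\<lambda>x. \<sigma>' (g x))"
proof -
  have "continuous_on UNIV \<sigma>"
    using step_profileD(1)[OF assms(1)] DERIV_isCont by (auto simp: continuous_on_eq_continuous_at)
  then show "continuous_on A (\<lambda>x. \<sigma> (g x))" by (rule continuous_on_compose2[OF _ assms(2)]) auto
  show "continuous_on A (\<lambda>x. \<sigma>' (g x))"
    by (rule continuous_on_compose2[OF step_profileD(2)[OF assms(1)] assms(2)]) auto
qed

lemma step_profile_measurable:
  assumes "step_profile z d \<sigma> \<sigma>'"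
  shows "\<sigma> \<in> borel_measurable borel" "\<sigma>' \<in> borel_measurable borel"
  using continuous_on_step_profile[OF assms continuous_on_id]
  by (auto simp: id_def intro: borel_measurable_continuous_onI)

lemma integral_step_profile_deriv:
  assumes "step_profile z d \<sigma> \<sigma>'" "0 < d"
  shows "integral\<^sup>L lborel \<sigma>' = 1" "integrable lborel \<sigma>'"
proof -
  have "has_bochner_integral lborel (\<lambda>x. \<sigma>' x * indicator {z - d..z + d} x) (\<sigma> (z + d) - \<sigma> (z - d))"
    by (rule has_bochner_integral_FTC_Icc_real)
       (use step_profileD[OF assms(1)] assms(2) in \<open>auto simp: continuous_on_eq_continuous_at\<close>)
  moreover have "(\<lambda>x. \<sigma>' x * indicator {z - d..z + d} x) = \<sigma>'"
  proof
    fix x show "\<sigma>' x * indicator {z - d..z + d} x = \<sigma>' x"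
      using step_profile_deriv_0[OF assms(1), of x] by (cases "x \<in> {z - d..z + d}") auto
  qed
  ultimately show "integral\<^sup>L lborel \<sigma>' = 1" "integrable lborel \<sigma>'"
    using step_profileD(4,5)[OF assms(1)] by (simp_all add: has_bochner_integral_iff)
qed

lemma step_profile_smoothstep:
  assumes "0 < d" and "w = z \<or> w = z - d"
  shows "step_profile z d (\<lambda>y. smoothstep ((y - w) / d)) (\<lambda>y. smoothstep_deriv ((y - w) / d) / d)"
  unfolding step_profile_def
proof (intro conjI allI impI)
  show "((\<lambda>y. smoothstep ((y - w) / d)) has_real_derivative smoothstep_deriv ((y - w) / d) / d) (at y)" for y
    using assms(1) by (auto intro!: derivative_eq_intros)
  show "continuous_on UNIV (\<lambda>y. smoothstep_deriv ((y - w) / d) / d)"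
    using assms(1) by (intro continuous_intros) auto
  show "smoothstep ((y - w) / d) = 0" if "y \<le> z - d" for y
    using that assms by (intro smoothstep_le_0) (auto simp: field_simps)
  show "smoothstep ((y - w) / d) = 1" if "z + d \<le> y" for y
    using that assms by (intro smoothstep_ge_1) (auto simp: field_simps)
qed (use assms in auto)

section \<open>Smeared fluxes\<close>

text \<open>
  Weights need not be continuous: besides the \<open>\<sigma>'\<close> of step profiles they include polynomials
  restricted to a cell.
\<close>

definition weight :: "(real \<Rightarrow> real) \<Rightarrow> bool" where
  "weight h \<longleftrightarrow> h \<in> borel_measurable borel \<and> (\<exists>C. \<forall>y. \<bar>h y\<bar> \<le> C) \<and> (\<exists>R. \<forall>y. R < \<bar>y\<bar> \<longrightarrow> h y = 0)"

lemma weightE: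
  assumes "weight h"
  obtains C R where "0 \<le> C" "0 \<le> R" "\<And>y. \<bar>h y\<bar> \<le> C" "\<And>y. R < \<bar>y\<bar> \<Longrightarrow> h y = 0"
proof -
  obtain C R where "\<And>y. \<bar>h y\<bar> \<le> C" "\<And>y. R < \<bar>y\<bar> \<Longrightarrow> h y = 0"
    using assms unfolding weight_def by blast
  then show thesis
    by (intro that[of "max 0 C" "max 0 R"]) (auto intro: order_trans[OF _ max.cobounded2])
qed

lemma weight_measurable: "weight h \<Longrightarrow> h \<in> borel_measurable borel"
  by (simp add: weight_def)

lemma weight_continuous:
  assumes "continuous_on UNIV h" and "\<And>y. y < a \<or> b < y \<Longrightarrow> h y = 0"
  shows "weight h"
proof -
  obtain C where "\<And>y. \<bar>h y\<bar> \<le> C" using continuous_bounded_of_support[OF assms] by metis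
  moreover have "h y = 0" if "max \<bar>a\<bar> \<bar>b\<bar> < \<bar>y\<bar>" for y
    by (rule assms(2)) (use that in linarith)
  ultimately show ?thesis
    unfolding weight_def using assms(1) by (blast intro: borel_measurable_continuous_onI)
qed

lemma weight_step_profile: "step_profile z d \<sigma> \<sigma>' \<Longrightarrow> weight \<sigma>'"
  by (rule weight_continuous[OF step_profileD(2) step_profile_deriv_0])

lemma weight_indicator_times:
  assumes "continuous_on UNIV g"
  shows "weight (\<lambda>y. indicator {a..b} y * g y)"
proof -
  have [measurable]: "g \<in> borel_measurable borel" using assms by (rule borel_measurable_continuous_onI)
  obtain C where C: "\<And>y. y \<in> {a..b} \<Longrightarrow> \<bar>g y\<bar> \<le> C"
    by (rule continuous_on_compact_bounded[OF compact_Icc continuous_on_subset[OF assms subset_UNIV]]) blast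
  have "\<bar>indicator {a..b} y * g y\<bar> \<le> max 0 C" for y
    using C[of y] by (cases "y \<in> {a..b}") auto
  moreover have "indicator {a..b} y * g y = 0" if "max \<bar>a\<bar> \<bar>b\<bar> < \<bar>y\<bar>" for y
    using that by (auto simp: indicator_def)
  ultimately show ?thesis unfolding weight_def by (intro conjI exI allI impI) measurable
qed

lemma weight_add:
  assumes "weight g" "weight h"
  shows "weight (\<lambda>y. g y + h y)"
proof -
  obtain C R where C: "\<And>y. \<bar>g y\<bar> \<le> C" "\<And>y. R < \<bar>y\<bar> \<Longrightarrow> g y = 0" using weightE[OF assms(1)] by metis
  obtain C' R' where C': "\<And>y. \<bar>h y\<bar> \<le> C'" "\<And>y. R' < \<bar>y\<bar> \<Longrightarrow> h y = 0" using weightE[OF assms(2)] by metis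
  have "\<bar>g y + h y\<bar> \<le> C + C'" for y using C(1)[of y] C'(1)[of y] by linarith
  moreover have "g y + h y = 0" if "max R R' < \<bar>y\<bar>" for y using C(2)[of y] C'(2)[of y] that by simp
  ultimately show ?thesis
    unfolding weight_def using assms[THEN weight_measurable]
    by (intro conjI borel_measurable_add) blast+
qed

lemma weight_cmult: "weight h \<Longrightarrow> weight (\<lambda>y. c * h y)"
proof -
  assume h: "weight h"
  obtain C R where C: "\<And>y. \<bar>h y\<bar> \<le> C" "\<And>y. R < \<bar>y\<bar> \<Longrightarrow> h y = 0" using weightE[OF h] by metis
  have "\<bar>c * h y\<bar> \<le> \<bar>c\<bar> * C" for y using C(1) by (simp add: abs_mult mult_left_mono)
  then show ?thesis
    unfolding weight_def using C(2) weight_measurable[OF h] by auto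
qed

context kruzhkov_solution
begin

text \<open>
  When \<open>\<sigma>'\<close> belongs to a step profile, this is the amount of \<open>q(V)\<close> that crosses the edge up to time
  \<open>T\<close>.  For a general weight it is the interior term of the weak formulation.
\<close>

definition flux :: "(real \<Rightarrow> real) \<Rightarrow> (real \<Rightarrow> real) \<Rightarrow> real \<Rightarrow> real" where
  "flux q \<sigma>' T = (LINT t:{0<..<T}|lborel. LINT y|lborel. \<sigma>' y * q (V t y))"

lemma slice_integrable:
  assumes h: "weight h" and [measurable]: "q \<in> borel_measurable borel"
    and q: "\<And>v. \<bar>v\<bar> \<le> M \<Longrightarrow> \<bar>q v\<bar> \<le> B"
  shows "integrable lborel (\<lambda>y. h y * q (V t y))"
    and "set_integrable lborel {0<..<T} (\<lambda>t. LINT y|lborel. h y * q (V t y))"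
proof -
  note [measurable] = weight_measurable[OF h]
  obtain C R where C: "0 \<le> C" "0 \<le> R" "\<And>y. \<bar>h y\<bar> \<le> C" "\<And>y. R < \<bar>y\<bar> \<Longrightarrow> h y = 0"
    using weightE[OF h] by metis
  have hq: "\<bar>h y * q (V t y)\<bar> \<le> C * B" "y < -R \<or> R < y \<Longrightarrow> h y * q (V t y) = 0" for t y
    unfolding abs_mult using C q[OF V_bound] by (auto intro!: mult_mono)
  show "integrable lborel (\<lambda>y. h y * q (V t y))"
    by (rule integrable_bounded_interval[of _ "C * B" "-R" R]) (use hq in auto)
  have b: "\<bar>LINT y|lborel. h y * q (V t y)\<bar> \<le> C * B * (R - (-R))" for t
    by (rule abs_integral_le_interval) (use hq C(2) in auto)
  show "set_integrable lborel {0<..<T} (\<lambda>t. LINT y|lborel. h y * q (V t y))"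
    unfolding set_integrable_def
  proof (intro integrable_bounded_interval[of _ "C * B * (R - (-R))" 0 T])
    show "\<bar>indicator {0<..<T} t *\<^sub>R (LINT y|lborel. h y * q (V t y))\<bar> \<le> C * B * (R - (-R))" for t
      using b[of t] order_trans[OF abs_ge_zero b[of t]] by (simp add: indicator_def)
  qed auto
qed

lemmas flux_integrable = slice_integrable[OF weight_step_profile]

lemma flux_weight_add:
  assumes "weight g" "weight h" and "q \<in> borel_measurable borel" and "\<And>v. \<bar>v\<bar> \<le> M \<Longrightarrow> \<bar>q v\<bar> \<le> B"
  shows "flux q (\<lambda>y. g y + h y) T = flux q g T + flux q h T"
proof -
  have "(LINT y|lborel. (g y + h y) * q (V t y))
      = (LINT y|lborel. g y * q (V t y)) + (LINT y|lborel. h y * q (V t y))" for t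
    using slice_integrable(1)[OF assms(1,3,4), of t] slice_integrable(1)[OF assms(2-4), of t]
    by (simp add: distrib_right)
  then show ?thesis
    unfolding flux_def
    using slice_integrable(2)[OF assms(1,3,4), of T] slice_integrable(2)[OF assms(2-4), of T]
    by (simp add: set_integral_add)
qed

lemma flux_weight_cmult: "flux q (\<lambda>y. c * h y) T = c * flux q h T"
  unfolding flux_def by (simp add: mult.assoc)

lemma flux_weight_abs_le:
  assumes h: "weight h" and q: "\<And>v. \<bar>v\<bar> \<le> M \<Longrightarrow> \<bar>q v\<bar> \<le> B" and T: "0 \<le> T"
    and k: "integrable lborel k" "\<And>y. \<bar>h y\<bar> \<le> k y"
  shows "\<bar>flux q h T\<bar> \<le> B * integral\<^sup>L lborel k * T"
proof -
  have "\<bar>q 0\<bar> \<le> B" using q[of 0] M_nonneg by simp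
  then have B: "0 \<le> B" by linarith
  have inner: "\<bar>LINT y|lborel. h y * q (V t y)\<bar> \<le> B * integral\<^sup>L lborel k" for t
  proof -
    have "\<bar>LINT y|lborel. h y * q (V t y)\<bar> \<le> (LINT y|lborel. B * k y)"
    proof (rule abs_integral_le, use k in simp, intro AE_I2)
      show "\<bar>h y * q (V t y)\<bar> \<le> B * k y" for y
        unfolding abs_mult mult.commute[of "\<bar>h y\<bar>"] using q[OF V_bound] k(2) B by (intro mult_mono) auto
    qed
    then show ?thesis by simp
  qed
  have "0 \<le> integral\<^sup>L lborel k"
    by (rule integral_nonneg_AE) (use order_trans[OF abs_ge_zero k(2)] in auto)
  then have BK: "0 \<le> B * integral\<^sup>L lborel k" using B by simp
  have "\<bar>flux q h T\<bar> \<le> (LINT t|lborel. B * integral\<^sup>L lborel k * indicator {0..T} t)"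
    unfolding flux_def set_lebesgue_integral_def
  proof (rule abs_integral_le[OF integrable_const_indicator_interval], intro AE_I2)
    fix t show "\<bar>indicator {0<..<T} t *\<^sub>R (LINT y|lborel. h y * q (V t y))\<bar> \<le> B * integral\<^sup>L lborel k * indicator {0..T} t"
      using inner[of t] BK by (auto simp: indicator_def)
  qed
  also have "\<dots> = B * integral\<^sup>L lborel k * T" using T by simp
  finally show ?thesis .
qed

lemma flux_mono:
  assumes "step_profile z d \<sigma> \<sigma>'" and "q \<in> borel_measurable borel" "q' \<in> borel_measurable borel"
    and "\<And>v. \<bar>v\<bar> \<le> M \<Longrightarrow> \<bar>q v\<bar> \<le> B" "\<And>v. \<bar>v\<bar> \<le> M \<Longrightarrow> \<bar>q' v\<bar> \<le> B'"
    and "\<And>v. \<bar>v\<bar> \<le> M \<Longrightarrow> q v \<le> q' v"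
  shows "flux q \<sigma>' T \<le> flux q' \<sigma>' T"
  unfolding flux_def
proof (rule set_integral_mono)
  show "(LINT y|lborel. \<sigma>' y * q (V t y)) \<le> (LINT y|lborel. \<sigma>' y * q' (V t y))" for t
    by (rule integral_mono)
       (use flux_integrable[OF assms(1,2,4)] flux_integrable[OF assms(1,3,5)] assms(6) V_bound
          step_profileD(3)[OF assms(1)] in \<open>auto intro: mult_left_mono\<close>)
qed (use flux_integrable[OF assms(1,2,4)] flux_integrable[OF assms(1,3,5)] in auto)

lemma flux_add:
  assumes "step_profile z d \<sigma> \<sigma>'" and "q \<in> borel_measurable borel" "q' \<in> borel_measurable borel"
    and "\<And>v. \<bar>v\<bar> \<le> M \<Longrightarrow> \<bar>q v\<bar> \<le> B" "\<And>v. \<bar>v\<bar> \<le> M \<Longrightarrow> \<bar>q' v\<bar> \<le> B'"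
  shows "flux (\<lambda>v. q v + q' v) \<sigma>' T = flux q \<sigma>' T + flux q' \<sigma>' T"
proof -
  have "(LINT y|lborel. \<sigma>' y * (q (V t y) + q' (V t y)))
      = (LINT y|lborel. \<sigma>' y * q (V t y)) + (LINT y|lborel. \<sigma>' y * q' (V t y))" for t
    using flux_integrable(1)[OF assms(1,2,4), of t] flux_integrable(1)[OF assms(1,3,5), of t]
    by (simp add: distrib_left)
  then show ?thesis
    unfolding flux_def
    using flux_integrable(2)[OF assms(1,2,4), of T] flux_integrable(2)[OF assms(1,3,5), of T]
    by (simp add: set_integral_add)
qed

lemma flux_uminus: "flux (\<lambda>v. - q v) \<sigma>' T = - flux q \<sigma>' T"
  unfolding flux_def by (simp add: set_lebesgue_integral_def)

lemma flux_const:
  assumes "step_profile z d \<sigma> \<sigma>'" "0 < d" "0 \<le> T"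
  shows "flux (\<lambda>_. c) \<sigma>' T = c * T"
  unfolding flux_def using integral_step_profile_deriv[OF assms(1,2)] assms(3)
  by (simp add: set_lebesgue_integral_def)

text \<open>
  The sign \<open>a\<close> selects a side: \<open>a = 1\<close> is the left of \<open>z\<close>, \<open>a = -1\<close> the right.  The weight is \<open>1\<close> on that side of
  the edge out to a cutoff that starts at distance \<open>r\<close> and moves towards the edge with speed \<open>L\<close>.  Since
  \<open>\<bar>q\<bar> \<le> L \<eta>\<close>, the terms produced by the moving cutoff have a favourable sign; this is finite speed of
  propagation.  What remains is the flux through the edge, and it is bounded by the initial entropy,
  which lives on the part of the smeared edge that lies on the other side.
\<close>

lemma half_flux:
  assumes pair: "entropy_pair \<eta> q"
    and \<eta>: "\<And>v. \<bar>v\<bar> \<le> M \<Longrightarrow> 0 \<le> \<eta> v" "\<And>v. \<bar>v\<bar> \<le> M \<Longrightarrow> \<eta> v \<le> B"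
    and q: "\<And>v. \<bar>v\<bar> \<le> M \<Longrightarrow> \<bar>q v\<bar> \<le> L * \<eta> v" and L: "0 \<le> L"
    and a: "a = 1 \<or> a = -1"
    and zero: "AE y in lborel. 0 < a * (z - y) \<and> a * (z - y) < r \<longrightarrow> \<eta> (V 0 y) = 0"
    and \<sigma>: "step_profile z d \<sigma> \<sigma>'" and d: "0 < d" "4 * d \<le> r" and T: "0 < T" "4 * (L * T) \<le> r"
  shows "a * flux q \<sigma>' T \<le> B * d"
proof -
  \<comment> \<open>Smearing, drift of the cutoff and width of the cutoff take up at most \<open>\<kappa>\<close> each, so that the
    cutoff equals \<open>1\<close> on the smeared edge up to time \<open>T\<close>.\<close>
  define \<kappa> where "\<kappa> = r / 4"
  have \<kappa>: "0 < \<kappa>" "r = 4 * \<kappa>" "d \<le> \<kappa>" "L * T \<le> \<kappa>" using d T by (auto simp: \<kappa>_def)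
  define X where "X = (\<lambda>p::real\<times>real. (r - a * (z - snd p) - L * fst p) / \<kappa>)"
  define \<rho> where "\<rho> = (\<lambda>y. (1 + a) / 2 - a * \<sigma> y)"
  define \<Psi> where "\<Psi> = (\<lambda>p. \<rho> (snd p) * smoothstep (X p))"
  define \<Psi>t where "\<Psi>t = (\<lambda>p. - L / \<kappa> * (\<rho> (snd p) * smoothstep_deriv (X p)))"
  define \<Psi>y where "\<Psi>y = (\<lambda>p. - a * \<sigma>' (snd p) * smoothstep (X p) + a / \<kappa> * (\<rho> (snd p) * smoothstep_deriv (X p)))"
  note \<sigma>r = step_profile_range[OF \<sigma>] and \<sigma>0 = step_profileD(4)[OF \<sigma>] and \<sigma>1 = step_profileD(5)[OF \<sigma>]
    and \<sigma>'0 = step_profile_deriv_0[OF \<sigma>] and \<sigma>'nn = step_profileD(3)[OF \<sigma>]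
  have \<rho>r: "0 \<le> \<rho> y" "\<rho> y \<le> 1" for y using a \<sigma>r[of y] by (auto simp: \<rho>_def)
  have \<rho>0: "\<rho> y = 0" if "a * (y - z) \<ge> d" for y using a that \<sigma>0[of y] \<sigma>1[of y] by (auto simp: \<rho>_def)
  have X0: "X (t, y) \<le> 0" if "0 \<le> t" "a * (z - y) \<ge> r" for t y
    unfolding X_def using that mult_nonneg_nonneg[OF L that(1)] \<kappa>(1) by (auto simp: divide_le_0_iff)
  have supp: "\<Psi> (t, y) = 0 \<and> \<Psi>t (t, y) = 0 \<and> \<Psi>y (t, y) = 0" if t: "0 \<le> t" and y: "\<bar>z\<bar> + r < \<bar>y\<bar>" for t y
  proof -
    have "a * (y - z) > d \<or> a * (z - y) \<ge> r" using a y d \<kappa> by auto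
    then show ?thesis
    proof
      assume *: "a * (y - z) > d"
      then have "\<sigma>' y = 0" using a by (intro \<sigma>'0) auto
      moreover have "\<rho> y = 0" using * by (intro \<rho>0) auto
      ultimately show ?thesis by (simp add: \<Psi>_def \<Psi>t_def \<Psi>y_def)
    next
      assume "a * (z - y) \<ge> r"
      then show ?thesis using X0[OF t, of y] by (simp add: \<Psi>_def \<Psi>t_def \<Psi>y_def)
    qed
  qed
  have contX: "continuous_on A X" for A unfolding X_def using \<kappa>(1) by (intro continuous_intros) auto
  have cont: "continuous_on UNIV \<Psi>" "continuous_on UNIV \<Psi>t" "continuous_on UNIV \<Psi>y"
    unfolding \<Psi>_def \<Psi>t_def \<Psi>y_def \<rho>_def
    by (intro continuous_intros contX continuous_on_step_profile[OF \<sigma>])+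
  have dt: "((\<lambda>s. \<Psi> (s, y)) has_real_derivative \<Psi>t (t, y)) (at t)" for t y
    unfolding \<Psi>_def \<Psi>t_def X_def fst_conv snd_conv using \<kappa>(1)
    by (auto intro!: derivative_eq_intros simp: field_simps)
  have d\<rho>: "(\<rho> has_real_derivative - a * \<sigma>' y) (at y)" for y
    unfolding \<rho>_def by (rule derivative_eq_intros step_profileD(1)[OF \<sigma>] refl | simp)+
  have dy: "((\<lambda>z. \<Psi> (t, z)) has_real_derivative \<Psi>y (t, y)) (at y)" for t y
  proof -
    have "((\<lambda>z. smoothstep (X (t, z))) has_real_derivative smoothstep_deriv (X (t, y)) * (a / \<kappa>)) (at y)"
      unfolding X_def fst_conv snd_conv using \<kappa>(1)
      by (auto intro!: derivative_eq_intros simp: field_simps)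
    from DERIV_mult[OF d\<rho> this] show ?thesis
      unfolding \<Psi>_def \<Psi>y_def by (simp add: algebra_simps)
  qed
  have \<Psi>nn: "0 \<le> \<Psi> p" for p unfolding \<Psi>_def using \<rho>r by simp
  have ineq: "(LINT y|lborel. \<eta> (V T y) * \<Psi> (T, y)) \<le> (LINT y|lborel. \<eta> (V 0 y) * \<Psi> (0, y))
      + (LINT t:{0<..<T}|lborel. LINT y|lborel. \<eta> (V t y) * \<Psi>t (t, y) + q (V t y) * \<Psi>y (t, y))"
    and D_integrable: "set_integrable lborel {0<..<T}
      (\<lambda>t. LINT y|lborel. \<eta> (V t y) * \<Psi>t (t, y) + q (V t y) * \<Psi>y (t, y))"
    using entropy_inequality_from_initial_time[where R = "\<bar>z\<bar> + r", OF pair \<Psi>nn dt dy cont _ T(1)] supp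
    by blast+
  note [measurable] = entropy_pairD(1,2)[OF pair]
  have B: "0 \<le> B" using \<eta>[of 0] M_nonneg by auto
  have qB: "\<bar>q v\<bar> \<le> L * B" if "\<bar>v\<bar> \<le> M" for v
    using q[OF that] mult_left_mono[OF \<eta>(2)[OF that] L] by linarith
  have \<eta>B: "\<bar>\<eta> v\<bar> \<le> B" if "\<bar>v\<bar> \<le> M" for v
    using \<eta>[OF that] by simp
  have "0 \<le> (LINT y|lborel. \<eta> (V T y) * \<Psi> (T, y))"
    by (intro integral_nonneg_AE AE_I2 mult_nonneg_nonneg \<eta>(1) V_bound \<Psi>nn)
  moreover have "(LINT y|lborel. \<eta> (V 0 y) * \<Psi> (0, y)) \<le> B * d"
  proof -
    let ?J = "{min z (z + a * d)..max z (z + a * d)}"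
    have "(LINT y|lborel. \<eta> (V 0 y) * \<Psi> (0, y)) \<le> (LINT y|lborel. B * indicator ?J y)"
    proof (rule integral_mono_AE')
      show "AE y in lborel. \<eta> (V 0 y) * \<Psi> (0, y) \<le> B * indicator ?J y"
        using zero
      proof eventually_elim
        case (elim y)
        consider "0 < a * (z - y) \<and> a * (z - y) < r" | "r \<le> a * (z - y)" | "d \<le> a * (y - z)" | "y \<in> ?J"
        proof -
          have "y \<in> ?J" if "0 \<le> a * (y - z)" "a * (y - z) \<le> d"
            using a that d by (auto simp: min_def max_def)
          moreover have "a * (y - z) = - (a * (z - y))" by (simp add: algebra_simps)
          ultimately show ?thesis using that by linarith
        qed
        then show ?case
        proof cases
          case 2 then show ?thesis using X0[of 0 y] B by (simp add: \<Psi>_def)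
        next
          case 3 then show ?thesis using \<rho>0[of y] B by (simp add: \<Psi>_def)
        next
          case 4
          have "\<Psi> (0, y) \<le> 1" unfolding \<Psi>_def using \<rho>r by (simp add: mult_le_one)
          then have "\<eta> (V 0 y) * \<Psi> (0, y) \<le> B * 1"
            using \<eta>[OF V_bound] B \<Psi>nn by (intro mult_mono) auto
          then show ?thesis using 4 by simp
        qed (use elim B in auto)
      qed
    qed (use B in auto)
    also have "\<dots> = B * d" using a d by (auto simp: min_def max_def)
    finally show ?thesis .
  qed
  moreover have "(LINT t:{0<..<T}|lborel. LINT y|lborel. \<eta> (V t y) * \<Psi>t (t, y) + q (V t y) * \<Psi>y (t, y))
      \<le> (LINT t:{0<..<T}|lborel. LINT y|lborel. \<sigma>' y * (- a * q (V t y)))"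
  proof (rule set_integral_mono)
    have b: "\<bar>- a * q v\<bar> \<le> L * B" if "\<bar>v\<bar> \<le> M" for v using qB[OF that] a by auto
    show "set_integrable lborel {0<..<T} (\<lambda>t. LINT y|lborel. \<sigma>' y * (- a * q (V t y)))"
      by (rule flux_integrable(2)[OF \<sigma> _ b]) auto
    fix t assume t: "t \<in> {0<..<T}"
    have weight: "weight (\<lambda>y. \<Phi> (t, y))"
      if "continuous_on UNIV \<Phi>" "\<And>y. \<bar>z\<bar> + r < \<bar>y\<bar> \<Longrightarrow> \<Phi> (t, y) = 0" for \<Phi>
    proof (rule weight_continuous[where a = "-(\<bar>z\<bar> + r)" and b = "\<bar>z\<bar> + r"])
      show "continuous_on UNIV (\<lambda>y. \<Phi> (t, y))"
        by (rule continuous_on_compose2[OF that(1)]) (auto intro: continuous_intros)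
    qed (use that(2) in auto)
    show "(LINT y|lborel. \<eta> (V t y) * \<Psi>t (t, y) + q (V t y) * \<Psi>y (t, y))
        \<le> (LINT y|lborel. \<sigma>' y * (- a * q (V t y)))"
    proof (rule integral_mono)
      show "integrable lborel (\<lambda>y. \<sigma>' y * (- a * q (V t y)))"
        by (rule flux_integrable(1)[OF \<sigma> _ b]) auto
      show "integrable lborel (\<lambda>y. \<eta> (V t y) * \<Psi>t (t, y) + q (V t y) * \<Psi>y (t, y))"
      proof (intro Bochner_Integration.integrable_add)
        show "integrable lborel (\<lambda>y. \<eta> (V t y) * \<Psi>t (t, y))"
          by (subst mult.commute, rule slice_integrable(1)[OF weight _ \<eta>B]) (use cont supp t in auto)
        show "integrable lborel (\<lambda>y. q (V t y) * \<Psi>y (t, y))"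
          by (subst mult.commute, rule slice_integrable(1)[OF weight _ qB]) (use cont supp t in auto)
      qed
      fix y
      have 1: "\<sigma>' y * smoothstep (X (t, y)) = \<sigma>' y"
      proof (cases "y < z - d \<or> z + d < y")
        case False
        have "L * t \<le> L * T" using t L by (intro mult_left_mono) auto
        then have "\<kappa> \<le> r - a * (z - y) - L * t" using a False \<kappa> by auto
        then have "1 \<le> X (t, y)" using \<kappa>(1) by (simp add: X_def)
        then show ?thesis by simp
      qed (simp add: \<sigma>'0)
      have "a * q (V t y) \<le> L * \<eta> (V t y)" using q[OF V_bound, of t y] a by auto
      then have 2: "\<rho> y * smoothstep_deriv (X (t, y)) / \<kappa> * (a * q (V t y) - L * \<eta> (V t y)) \<le> 0"
        using \<rho>r[of y] \<kappa>(1) by (intro mult_nonneg_nonpos) auto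
      have "\<eta> (V t y) * \<Psi>t (t, y) + q (V t y) * \<Psi>y (t, y)
          = \<rho> y * smoothstep_deriv (X (t, y)) / \<kappa> * (a * q (V t y) - L * \<eta> (V t y))
            - a * q (V t y) * (\<sigma>' y * smoothstep (X (t, y)))"
        unfolding \<Psi>t_def \<Psi>y_def using \<kappa>(1) by (simp add: field_simps)
      then show "\<eta> (V t y) * \<Psi>t (t, y) + q (V t y) * \<Psi>y (t, y) \<le> \<sigma>' y * (- a * q (V t y))"
        using 2 unfolding 1 by (simp add: mult_ac)
    qed
  qed (rule D_integrable)
  moreover have "(LINT t:{0<..<T}|lborel. LINT y|lborel. \<sigma>' y * (- a * q (V t y))) = - (a * flux q \<sigma>' T)"
  proof -
    have inner: "(LINT y|lborel. \<sigma>' y * (- a * q (V t y))) = - a * (LINT y|lborel. \<sigma>' y * q (V t y))" for t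
      using integral_mult_right_zero[of lborel "- a" "\<lambda>y. \<sigma>' y * q (V t y)"] by (simp add: mult_ac)
    show ?thesis unfolding inner flux_def by (subst set_integral_mult_right) simp
  qed
  ultimately show ?thesis using ineq by linarith
qed

end

section \<open>The flux through a jump\<close>

text \<open>
  Osher's formula for the Godunov flux.
\<close>

definition godunov_value :: "(real \<Rightarrow> real) \<Rightarrow> real \<Rightarrow> real \<Rightarrow> real" where
  "godunov_value f ul ur = (if ul \<le> ur then Inf (f ` {ul..ur}) else Sup (f ` {ur..ul}))"

lemma godunov_value_le:
  assumes "continuous_on UNIV f" "ul \<le> ur"
  obtains w where "w \<in> {ul..ur}" "godunov_value f ul ur = f w" "\<And>v. v \<in> {ul..ur} \<Longrightarrow> f w \<le> f v"
proof -
  obtain w where w: "w \<in> {ul..ur}" "\<And>v. v \<in> {ul..ur} \<Longrightarrow> f w \<le> f v"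
    using continuous_attains_inf[of "{ul..ur}" f] continuous_on_subset[OF assms(1)] assms(2) by auto
  have "Inf (f ` {ul..ur}) = f w" by (rule cInf_eq_minimum) (use w in auto)
  then show thesis using that[OF w(1) _ w(2)] assms(2) by (simp add: godunov_value_def)
qed

lemma godunov_value_ge:
  assumes "continuous_on UNIV f" "ur < ul"
  obtains w where "w \<in> {ur..ul}" "godunov_value f ul ur = f w" "\<And>v. v \<in> {ur..ul} \<Longrightarrow> f v \<le> f w"
proof -
  obtain w where w: "w \<in> {ur..ul}" "\<And>v. v \<in> {ur..ul} \<Longrightarrow> f v \<le> f w"
    using continuous_attains_sup[of "{ur..ul}" f] continuous_on_subset[OF assms(1)] assms(2) by auto
  have "Sup (f ` {ur..ul}) = f w" by (rule cSup_eq_maximum) (use w in auto)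
  then show thesis using that[OF w(1) _ w(2)] assms(2) by (simp add: godunov_value_def)
qed

context kruzhkov_solution
begin

lemma f_bounded:
  obtains K where "0 \<le> K" "\<And>v. \<bar>v\<bar> \<le> M \<Longrightarrow> \<bar>f v\<bar> \<le> K"
proof -
  obtain K where K: "0 \<le> K" "\<And>v. v \<in> {-M..M} \<Longrightarrow> \<bar>f v\<bar> \<le> K"
    by (rule continuous_on_compact_bounded[OF compact_Icc continuous_on_subset[OF f_continuous subset_UNIV]])
       (rule that)
  have "\<bar>f v\<bar> \<le> K" if "\<bar>v\<bar> \<le> M" for v by (rule K(2)) (use that in \<open>auto simp: abs_le_iff\<close>)
  with K(1) show thesis by (rule that)
qed

text \<open>
  A state above \<open>c\<close> contributes \<open>f c + H\<close>, one below \<open>c'\<close> contributes \<open>f c' - K\<close>, and one in between is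
  controlled by the bound \<open>m\<close>.  So the flux of \<open>f\<close> is reduced to the fluxes of two half-entropies.
\<close>

lemma flux_sandwich:
  assumes \<sigma>: "step_profile z d \<sigma> \<sigma>'" and d: "0 < d" and T: "0 < T" and c: "c' \<le> c"
  defines "H \<equiv> \<lambda>v. if c < v then f v - f c else 0" and "K \<equiv> \<lambda>v. if v < c' then f c' - f v else 0"
  shows "(\<And>v. v \<in> {c'..c} \<Longrightarrow> f v \<le> m) \<Longrightarrow> flux f \<sigma>' T \<le> m * T + flux H \<sigma>' T - flux K \<sigma>' T"
    and "(\<And>v. v \<in> {c'..c} \<Longrightarrow> m \<le> f v) \<Longrightarrow> m * T + flux H \<sigma>' T - flux K \<sigma>' T \<le> flux f \<sigma>' T"
proof -
  have [measurable]: "H \<in> borel_measurable borel" "K \<in> borel_measurable borel"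
    unfolding H_def K_def by measurable
  obtain B where B: "0 \<le> B" "\<And>v. \<bar>v\<bar> \<le> M \<Longrightarrow> \<bar>f v\<bar> \<le> B" using f_bounded by metis
  have HB: "\<bar>H v\<bar> \<le> B + \<bar>f c\<bar>" "\<bar>- K v\<bar> \<le> B + \<bar>f c'\<bar>" if "\<bar>v\<bar> \<le> M" for v
    using B(2)[OF that] B(1) unfolding H_def K_def by auto
  have HKB: "\<bar>H v + - K v\<bar> \<le> (B + \<bar>f c\<bar>) + (B + \<bar>f c'\<bar>)" if "\<bar>v\<bar> \<le> M" for v
    using HB[OF that] by linarith
  have mHKB: "\<bar>m + (H v + - K v)\<bar> \<le> \<bar>m\<bar> + ((B + \<bar>f c\<bar>) + (B + \<bar>f c'\<bar>))" if "\<bar>v\<bar> \<le> M" for v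
    using HKB[OF that] by linarith
  have "flux (\<lambda>v. m + (H v + - K v)) \<sigma>' T = flux (\<lambda>_. m) \<sigma>' T + flux (\<lambda>v. H v + - K v) \<sigma>' T"
    by (rule flux_add[OF \<sigma> _ _ _ HKB, where B = "\<bar>m\<bar>"]) auto
  also have "flux (\<lambda>v. H v + - K v) \<sigma>' T = flux H \<sigma>' T + flux (\<lambda>v. - K v) \<sigma>' T"
    by (rule flux_add[OF \<sigma> _ _ HB]) auto
  also have "flux (\<lambda>v. - K v) \<sigma>' T = - flux K \<sigma>' T" by (rule flux_uminus)
  also have "flux (\<lambda>_. m) \<sigma>' T = m * T" using flux_const[OF \<sigma> d] T by simp
  finally have eq: "m * T + flux H \<sigma>' T - flux K \<sigma>' T = flux (\<lambda>v. m + (H v + - K v)) \<sigma>' T" by simp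
  show "flux f \<sigma>' T \<le> m * T + flux H \<sigma>' T - flux K \<sigma>' T" if m: "\<And>v. v \<in> {c'..c} \<Longrightarrow> f v \<le> m"
    unfolding eq
  proof (rule flux_mono[OF \<sigma> _ _ B(2) mHKB])
    show "f v \<le> m + (H v + - K v)" for v
      using m[of v] m[of c] m[of c'] c by (auto simp: H_def K_def)
  qed auto
  show "m * T + flux H \<sigma>' T - flux K \<sigma>' T \<le> flux f \<sigma>' T" if m: "\<And>v. v \<in> {c'..c} \<Longrightarrow> m \<le> f v"
    unfolding eq
  proof (rule flux_mono[OF \<sigma> _ _ mHKB B(2)])
    show "m + (H v + - K v) \<le> f v" for v
      using m[of v] m[of c] m[of c'] c by (auto simp: H_def K_def)
  qed auto
qed

text \<open>
  For the upper bound, \<open>c\<close> lies above \<open>ul\<close> and \<open>c'\<close> below \<open>ur\<close>, so that \<open>half_flux\<close> bounds the flux of \<open>H\<close>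
  from the left and that of \<open>K\<close> from the right; the lower bound exchanges \<open>ul\<close> and \<open>ur\<close>.  If \<open>ul \<le> ur\<close>, the
  upper bound may take both constants next to a minimiser of \<open>f\<close>, while the lower bound has to span
  all of \<open>[ul, ur]\<close>; if \<open>ur < ul\<close>, it is the other way round.  The margin \<open>\<epsilon>\<close> absorbs the
  deviation of the data from their one-sided limits near \<open>z\<close>.
\<close>

lemma edge_flux:
  assumes ul: "(u0 \<longlongrightarrow> ul) (at_left z)" and ur: "(u0 \<longlongrightarrow> ur) (at_right z)"
    and init: "AE y in lborel. V 0 y = u0 y" and e: "0 < e"
  obtains T0 d0 C where "0 < T0" "0 < d0" "0 \<le> C"
    "\<And>T d \<sigma> \<sigma>'. step_profile z d \<sigma> \<sigma>' \<Longrightarrow> 0 < d \<Longrightarrow> d \<le> d0 \<Longrightarrow> 0 < T \<Longrightarrow> T \<le> T0 \<Longrightarrow>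
       \<bar>flux f \<sigma>' T - T * godunov_value f ul ur\<bar> \<le> e * T + C * d"
proof -
  define A where "A = M + \<bar>ul\<bar> + \<bar>ur\<bar> + 1"
  obtain L where Lip: "L-lipschitz_on {-A..A} f" using f_lipschitz by blast
  have L0: "0 \<le> L" using Lip by (rule lipschitz_on_nonneg)
  have L: "\<bar>f v - f w\<bar> \<le> L * \<bar>v - w\<bar>" if "\<bar>v\<bar> \<le> A" "\<bar>w\<bar> \<le> A" for v w
  proof -
    have "v \<in> {-A..A}" "w \<in> {-A..A}" using that by auto
    from lipschitz_onD[OF Lip this] show ?thesis by (simp add: dist_real_def)
  qed
  define \<epsilon> where "\<epsilon> = min 1 (e / (L + 1))"
  have \<epsilon>: "0 < \<epsilon>" "\<epsilon> \<le> 1" using e L0 by (auto simp: \<epsilon>_def)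
  have L\<epsilon>: "L * \<epsilon> \<le> e"
  proof -
    have "L * \<epsilon> \<le> (L + 1) * (e / (L + 1))" using L0 \<epsilon> by (intro mult_mono) (auto simp: \<epsilon>_def)
    then show ?thesis using L0 by simp
  qed
  have near: "\<bar>f v - f w\<bar> \<le> e" if "\<bar>v\<bar> \<le> A" "\<bar>w\<bar> \<le> A" "\<bar>v - w\<bar> \<le> \<epsilon>" for v w
    using L[OF that(1,2)] mult_left_mono[OF that(3) L0] L\<epsilon> by linarith
  obtain r1 where r1: "r1 < z" "\<And>y. r1 < y \<Longrightarrow> y < z \<Longrightarrow> dist (u0 y) ul < \<epsilon>"
    using tendstoD[OF ul \<epsilon>(1)] unfolding eventually_at_left_field by blast
  obtain r2 where r2: "z < r2" "\<And>y. z < y \<Longrightarrow> y < r2 \<Longrightarrow> dist (u0 y) ur < \<epsilon>"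
    using tendstoD[OF ur \<epsilon>(1)] unfolding eventually_at_right_field by blast
  define r where "r = min (z - r1) (r2 - z)"
  have r0: "0 < r" using r1(1) r2(1) by (simp add: r_def)
  have left: "AE y in lborel. 0 < 1 * (z - y) \<and> 1 * (z - y) < r \<longrightarrow> \<bar>V 0 y - ul\<bar> < \<epsilon>"
    using init by eventually_elim (use r1(2) in \<open>auto simp: dist_real_def r_def\<close>)
  have right: "AE y in lborel. 0 < -1 * (z - y) \<and> -1 * (z - y) < r \<longrightarrow> \<bar>V 0 y - ur\<bar> < \<epsilon>"
    using init by eventually_elim (use r2(2) in \<open>auto simp: dist_real_def r_def\<close>)
  define T0 where "T0 = r / (4 * (L + 1))"
  have T0: "0 < T0" using r0 L0 by (simp add: T0_def)
  have T0': "4 * (L * T) \<le> r" if "0 < T" "T \<le> T0" for T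
  proof -
    have "L * T \<le> (L + 1) * T0" using that L0 by (intro mult_mono) auto
    also have "\<dots> = r / 4" using L0 by (simp add: T0_def field_simps)
    finally show ?thesis by simp
  qed
  define H where "H = (\<lambda>c v. if c < v then f v - f c else 0)"
  define K where "K = (\<lambda>c v. if v < c then f c - f v else 0)"
  have H_bound: "\<bar>H c v\<bar> \<le> L * max 0 (v - c)" "\<bar>K c v\<bar> \<le> L * max 0 (c - v)" if "\<bar>v\<bar> \<le> M" "\<bar>c\<bar> \<le> A" for c v
    using L[of v c] L[of c v] that by (auto simp: H_def K_def A_def)
  show thesis
  proof (rule that[of T0 "r / 4" "2 * (M + A)"])
    show "0 < T0" "0 < r / 4" "0 \<le> 2 * (M + A)" using T0 r0 M_nonneg by (auto simp: A_def)
    fix T d :: real and \<sigma> \<sigma>' :: "real \<Rightarrow> real"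
    assume \<sigma>: "step_profile z d \<sigma> \<sigma>'" and d: "0 < d" "d \<le> r / 4" and T: "0 < T" "T \<le> T0"
    have d': "4 * d \<le> r" using d by simp
    have bnd: "max 0 (v - c) \<le> M + A" "max 0 (c - v) \<le> M + A" if "\<bar>v\<bar> \<le> M" "\<bar>c\<bar> \<le> A" for v c
      using that by auto
    have half: "a * flux q \<sigma>' T \<le> (M + A) * d"
      if "entropy_pair \<eta> q" "\<And>v. \<bar>v\<bar> \<le> M \<Longrightarrow> 0 \<le> \<eta> v" "\<And>v. \<bar>v\<bar> \<le> M \<Longrightarrow> \<eta> v \<le> M + A"
        "\<And>v. \<bar>v\<bar> \<le> M \<Longrightarrow> \<bar>q v\<bar> \<le> L * \<eta> v" "a = 1 \<or> a = -1"
        "AE y in lborel. 0 < a * (z - y) \<and> a * (z - y) < r \<longrightarrow> \<eta> (V 0 y) = 0" for \<eta> q a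
      by (rule half_flux[OF that(1) _ _ _ L0 that(5,6) \<sigma> d(1) d' T(1) T0'[OF T]]) (use that(2-4) in auto)
    have pairs: "entropy_pair (\<lambda>v. max 0 (v - c)) (H c)" "entropy_pair (\<lambda>v. max 0 (c - v)) (K c)" for c
      unfolding H_def K_def by (rule entropy_pair_above entropy_pair_below)+
    have H_left: "flux (H c) \<sigma>' T \<le> (M + A) * d" if c: "\<bar>c\<bar> \<le> A" "ul + \<epsilon> \<le> c" for c
    proof -
      have "AE y in lborel. 0 < 1 * (z - y) \<and> 1 * (z - y) < r \<longrightarrow> max 0 (V 0 y - c) = 0"
        using left by eventually_elim (use c in auto)
      from half[OF pairs(1) _ bnd(1)[OF _ c(1)] H_bound(1)[OF _ c(1)] _ this]
      show ?thesis by simp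
    qed
    have K_left: "flux (K c) \<sigma>' T \<le> (M + A) * d" if c: "\<bar>c\<bar> \<le> A" "c \<le> ul - \<epsilon>" for c
    proof -
      have "AE y in lborel. 0 < 1 * (z - y) \<and> 1 * (z - y) < r \<longrightarrow> max 0 (c - V 0 y) = 0"
        using left by eventually_elim (use c in auto)
      from half[OF pairs(2) _ bnd(2)[OF _ c(1)] H_bound(2)[OF _ c(1)] _ this]
      show ?thesis by simp
    qed
    have H_right: "- flux (H c) \<sigma>' T \<le> (M + A) * d" if c: "\<bar>c\<bar> \<le> A" "ur + \<epsilon> \<le> c" for c
    proof -
      have "AE y in lborel. 0 < -1 * (z - y) \<and> -1 * (z - y) < r \<longrightarrow> max 0 (V 0 y - c) = 0"
        using right by eventually_elim (use c in auto)
      from half[OF pairs(1) _ bnd(1)[OF _ c(1)] H_bound(1)[OF _ c(1)] _ this]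
      show ?thesis by simp
    qed
    have K_right: "- flux (K c) \<sigma>' T \<le> (M + A) * d" if c: "\<bar>c\<bar> \<le> A" "c \<le> ur - \<epsilon>" for c
    proof -
      have "AE y in lborel. 0 < -1 * (z - y) \<and> -1 * (z - y) < r \<longrightarrow> max 0 (c - V 0 y) = 0"
        using right by eventually_elim (use c in auto)
      from half[OF pairs(2) _ bnd(2)[OF _ c(1)] H_bound(2)[OF _ c(1)] _ this]
      show ?thesis by simp
    qed
    have upper: "flux f \<sigma>' T \<le> m * T + 2 * (M + A) * d"
      if "c' \<le> c" "\<bar>c\<bar> \<le> A" "\<bar>c'\<bar> \<le> A" "ul + \<epsilon> \<le> c" "c' \<le> ur - \<epsilon>" "\<And>v. v \<in> {c'..c} \<Longrightarrow> f v \<le> m" for c c' m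
      using flux_sandwich(1)[OF \<sigma> d(1) T(1) that(1,6)] H_left[OF that(2,4)] K_right[OF that(3,5)]
      unfolding H_def K_def by (simp add: algebra_simps)
    have lower: "m * T - 2 * (M + A) * d \<le> flux f \<sigma>' T"
      if "c' \<le> c" "\<bar>c\<bar> \<le> A" "\<bar>c'\<bar> \<le> A" "ur + \<epsilon> \<le> c" "c' \<le> ul - \<epsilon>" "\<And>v. v \<in> {c'..c} \<Longrightarrow> m \<le> f v" for c c' m
      using flux_sandwich(2)[OF \<sigma> d(1) T(1) that(1,6)] H_right[OF that(2,4)] K_left[OF that(3,5)]
      unfolding H_def K_def by (simp add: algebra_simps)
    have "flux f \<sigma>' T \<le> (godunov_value f ul ur + e) * T + 2 * (M + A) * d \<and>
          (godunov_value f ul ur - e) * T - 2 * (M + A) * d \<le> flux f \<sigma>' T"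
    proof (cases "ul \<le> ur")
      case True
      obtain w where w: "w \<in> {ul..ur}" "godunov_value f ul ur = f w" "\<And>v. v \<in> {ul..ur} \<Longrightarrow> f w \<le> f v"
        using godunov_value_le[OF f_continuous True] by metis
      have "flux f \<sigma>' T \<le> (f w + e) * T + 2 * (M + A) * d"
      proof (rule upper[of "w - \<epsilon>" "w + \<epsilon>"])
        fix v assume v: "v \<in> {w - \<epsilon>..w + \<epsilon>}"
        then have "\<bar>f v - f w\<bar> \<le> e" using w(1) \<epsilon> M_nonneg by (intro near) (auto simp: A_def)
        then show "f v \<le> f w + e" by linarith
      qed (use w(1) \<epsilon> M_nonneg in \<open>auto simp: A_def\<close>)
      moreover have "(f w - e) * T - 2 * (M + A) * d \<le> flux f \<sigma>' T"
      proof (rule lower[of "ul - \<epsilon>" "ur + \<epsilon>"])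
        fix v assume v: "v \<in> {ul - \<epsilon>..ur + \<epsilon>}"
        define v' where "v' = max ul (min ur v)"
        have "\<bar>f v - f v'\<bar> \<le> e" using v True \<epsilon> M_nonneg by (intro near) (auto simp: A_def v'_def)
        moreover have "f w \<le> f v'" using True by (intro w(3)) (auto simp: v'_def)
        ultimately show "f w - e \<le> f v" by linarith
      qed (use True \<epsilon> M_nonneg in \<open>auto simp: A_def\<close>)
      ultimately show ?thesis using w(2) by simp
    next
      case False
      then have lt: "ur < ul" by simp
      obtain w where w: "w \<in> {ur..ul}" "godunov_value f ul ur = f w" "\<And>v. v \<in> {ur..ul} \<Longrightarrow> f v \<le> f w"
        using godunov_value_ge[OF f_continuous lt] by metis
      have "(f w - e) * T - 2 * (M + A) * d \<le> flux f \<sigma>' T"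
      proof (rule lower[of "w - \<epsilon>" "w + \<epsilon>"])
        fix v assume v: "v \<in> {w - \<epsilon>..w + \<epsilon>}"
        then have "\<bar>f v - f w\<bar> \<le> e" using w(1) \<epsilon> M_nonneg by (intro near) (auto simp: A_def)
        then show "f w - e \<le> f v" by linarith
      qed (use w(1) \<epsilon> M_nonneg in \<open>auto simp: A_def\<close>)
      moreover have "flux f \<sigma>' T \<le> (f w + e) * T + 2 * (M + A) * d"
      proof (rule upper[of "ur - \<epsilon>" "ul + \<epsilon>"])
        fix v assume v: "v \<in> {ur - \<epsilon>..ul + \<epsilon>}"
        define v' where "v' = max ur (min ul v)"
        have "\<bar>f v - f v'\<bar> \<le> e" using v lt \<epsilon> M_nonneg by (intro near) (auto simp: A_def v'_def)
        moreover have "f v' \<le> f w" using lt by (intro w(3)) (auto simp: v'_def)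
        ultimately show "f v \<le> f w + e" by linarith
      qed (use lt \<epsilon> M_nonneg in \<open>auto simp: A_def\<close>)
      ultimately show ?thesis using w(2) by simp
    qed
    then show "\<bar>flux f \<sigma>' T - T * godunov_value f ul ur\<bar> \<le> e * T + 2 * (M + A) * d"
      by (auto simp: abs_le_iff algebra_simps)
  qed
qed

text \<open>
  The ramp is put on the side \<open>s\<close> of the origin.  At times \<open>t > d/\<rho>\<close> it sees only arguments \<open>y/t\<close>
  with \<open>0 < s y/t < \<rho>\<close>, where \<open>w\<close> is close to its limit; earlier times contribute \<open>O(d)\<close>.  Thus the smeared
  flux tends to \<open>T f(l)\<close> as \<open>d\<close> tends to \<open>0\<close>, while \<open>edge_flux\<close> gives \<open>T\<close> times Osher's value up to \<open>e T\<close>.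
\<close>

lemma self_similar_flux_value:
  assumes init: "AE y in lborel. V 0 y = riemann_data ul ur y"
    and sim: "\<And>t. 0 < t \<Longrightarrow> AE y in lborel. V t y = w (y / t)"
    and s: "s = 1 \<or> s = -1" and lim: "((\<lambda>\<xi>. w (s * \<xi>)) \<longlongrightarrow> l) (at_right 0)"
  shows "f l = godunov_value f ul ur"
proof -
  have l: "(riemann_data ul ur \<longlongrightarrow> ul) (at_left 0)"
    by (rule tendsto_eventually)
       (auto simp: riemann_data_def eventually_at_left_field intro!: exI[of _ "-1"])
  have r: "(riemann_data ul ur \<longlongrightarrow> ur) (at_right 0)"
    by (rule tendsto_eventually)
       (auto simp: riemann_data_def eventually_at_right_field intro!: exI[of _ 1])
  obtain B where B: "0 \<le> B" "\<And>v. \<bar>v\<bar> \<le> M \<Longrightarrow> \<bar>f v\<bar> \<le> B" using f_bounded by metis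
  define B' where "B' = B + \<bar>f l\<bar>"
  have B': "0 \<le> B'" "\<bar>f (V t y) - f l\<bar> \<le> B'" for t y using B(1) B(2)[OF V_bound[of t y]] by (auto simp: B'_def)
  have "\<bar>f l - godunov_value f ul ur\<bar> \<le> 2 * e" if e: "0 < e" for e
  proof -
    obtain T d0 C where T: "0 < T" and d0: "0 < d0" and C: "0 \<le> C"
      and edge': "\<And>T' d \<sigma> \<sigma>'. step_profile 0 d \<sigma> \<sigma>' \<Longrightarrow> 0 < d \<Longrightarrow> d \<le> d0 \<Longrightarrow> 0 < T' \<Longrightarrow> T' \<le> T \<Longrightarrow>
         \<bar>flux f \<sigma>' T' - T' * godunov_value f ul ur\<bar> \<le> e * T' + C * d"
      by (rule edge_flux[OF l r init e]) (rule that)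
    note edge = edge'[OF _ _ _ T order_refl]
    have "isCont f l" using f_continuous by (simp add: continuous_on_eq_continuous_at)
    then have flim: "((\<lambda>\<xi>. f (w (s * \<xi>))) \<longlongrightarrow> f l) (at_right 0)" by (rule isCont_tendsto_compose) (rule lim)
    obtain \<rho> where \<rho>: "0 < \<rho>" "\<And>\<xi>. 0 < \<xi> \<Longrightarrow> \<xi> < \<rho> \<Longrightarrow> dist (f (w (s * \<xi>))) (f l) < e"
      using tendstoD[OF flim e] unfolding eventually_at_right_field by blast
    have est: "\<bar>T * f l - T * godunov_value f ul ur\<bar> \<le> 2 * e * T + (C + B' / \<rho>) * d" if d: "0 < d" "d \<le> d0" for d
    proof -
      define \<sigma>' where "\<sigma>' = (\<lambda>y. smoothstep_deriv ((y - (if s = 1 then 0 else 0 - d)) / d) / d)"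
      have \<sigma>: "step_profile 0 d (\<lambda>y. smoothstep ((y - (if s = 1 then 0 else 0 - d)) / d)) \<sigma>'"
        unfolding \<sigma>'_def by (rule step_profile_smoothstep) (use d in auto)
      note [measurable] = step_profile_measurable(2)[OF \<sigma>]
      have \<sigma>'0: "\<sigma>' y = 0" if "\<not> (0 < s * y \<and> s * y < d)" for y
      proof -
        have "(y - (if s = 1 then 0 else 0 - d)) / d \<le> 0 \<or> 1 \<le> (y - (if s = 1 then 0 else 0 - d)) / d"
          using s that d(1) by (elim disjE) (simp_all add: divide_le_0_iff le_divide_eq not_less, linarith+)
        then show ?thesis unfolding \<sigma>'_def by simp
      qed
      have inner: "\<bar>LINT y|lborel. \<sigma>' y * (f (V t y) - f l)\<bar> \<le> \<epsilon>"
        if "AE y in lborel. 0 < s * y \<and> s * y < d \<longrightarrow> \<bar>f (V t y) - f l\<bar> \<le> \<epsilon>" and "0 \<le> \<epsilon>" for t \<epsilon>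
      proof -
        have "\<bar>LINT y|lborel. \<sigma>' y * (f (V t y) - f l)\<bar> \<le> (LINT y|lborel. \<sigma>' y * \<epsilon>)"
        proof (rule abs_integral_le)
          show "AE y in lborel. \<bar>\<sigma>' y * (f (V t y) - f l)\<bar> \<le> \<sigma>' y * \<epsilon>"
            using that(1)
          proof eventually_elim
            case (elim y)
            then show ?case using step_profileD(3)[OF \<sigma>, of y] \<sigma>'0[of y]
              by (cases "0 < s * y \<and> s * y < d") (auto simp: abs_mult intro: mult_left_mono)
          qed
        qed (use integral_step_profile_deriv[OF \<sigma> d(1)] in auto)
        also have "\<dots> = \<epsilon>" using integral_step_profile_deriv[OF \<sigma> d(1)] by simp
        finally show ?thesis .
      qed
      have small: "\<bar>LINT y|lborel. \<sigma>' y * (f (V t y) - f l)\<bar> \<le> e" if t: "d / \<rho> < t" for t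
      proof (rule inner)
        have t0: "0 < t" using less_trans[OF divide_pos_pos[OF d(1) \<rho>(1)] t] .
        show "AE y in lborel. 0 < s * y \<and> s * y < d \<longrightarrow> \<bar>f (V t y) - f l\<bar> \<le> e"
          using sim[OF t0]
        proof eventually_elim
          case (elim y)
          show ?case
          proof
            assume y: "0 < s * y \<and> s * y < d"
            have "s * y / t < \<rho>" using y t t0 \<rho>(1) by (simp add: divide_less_eq) (simp add: mult.commute)
            then have "dist (f (w (s * (s * y / t)))) (f l) < e" using y t0 by (intro \<rho>(2)) simp_all
            moreover have "s * (s * y / t) = y / t" using s by auto
            ultimately have "dist (f (w (y / t))) (f l) < e" by (simp only:)
            then show "\<bar>f (V t y) - f l\<bar> \<le> e" unfolding elim by (simp add: dist_real_def)
          qed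
        qed
      qed (use e in simp)
      have "\<bar>flux (\<lambda>v. f v + - f l) \<sigma>' T\<bar> \<le> (LINT t|lborel. e * indicator {0..T} t + B' * indicator {0..d / \<rho>} t)"
        unfolding flux_def set_lebesgue_integral_def
      proof (rule abs_integral_le)
        show "integrable lborel (\<lambda>t. e * indicator {0..T} t + B' * indicator {0..d / \<rho>} t)"
          by (intro Bochner_Integration.integrable_add integrable_const_indicator_interval)
        have "\<bar>indicator {0<..<T} t *\<^sub>R (LINT y|lborel. \<sigma>' y * (f (V t y) + - f l))\<bar>
            \<le> e * indicator {0..T} t + B' * indicator {0..d / \<rho>} t" for t
        proof (cases "t \<in> {0<..<T}")
          case True
          have "\<bar>LINT y|lborel. \<sigma>' y * (f (V t y) - f l)\<bar> \<le> B'"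
            by (rule inner) (use B' in auto)
          then show ?thesis using small[of t] True e by (cases "t \<le> d / \<rho>") simp_all
        next
          case False
          then show ?thesis using e B'(1) by simp
        qed
        then show "AE t in lborel. \<bar>indicator {0<..<T} t *\<^sub>R (LINT y|lborel. \<sigma>' y * (f (V t y) + - f l))\<bar>
            \<le> e * indicator {0..T} t + B' * indicator {0..d / \<rho>} t" by (rule AE_I2)
      qed
      also have "\<dots> = (LINT t|lborel. e * indicator {0..T} t) + (LINT t|lborel. B' * indicator {0..d / \<rho>} t)"
        by (intro Bochner_Integration.integral_add integrable_const_indicator_interval)
      also have "\<dots> = e * T + B' * (d / \<rho>)" using T d \<rho>(1) by simp
      finally have 1: "\<bar>flux (\<lambda>v. f v + - f l) \<sigma>' T\<bar> \<le> e * T + B' * (d / \<rho>)" .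
      have "flux (\<lambda>v. f v + - f l) \<sigma>' T = flux f \<sigma>' T + flux (\<lambda>_. - f l) \<sigma>' T"
        by (rule flux_add[OF \<sigma> _ _ B(2), where B' = "\<bar>f l\<bar>"]) auto
      also have "flux (\<lambda>_. - f l) \<sigma>' T = - f l * T" using flux_const[OF \<sigma> d(1)] T by simp
      finally have "\<bar>flux f \<sigma>' T - T * f l\<bar> \<le> e * T + B' * (d / \<rho>)" using 1 by (simp add: mult.commute)
      then show ?thesis using edge[OF \<sigma> d] by (simp add: algebra_simps)
    qed
    have "\<bar>T * f l - T * godunov_value f ul ur\<bar> \<le> 2 * e * T"
    proof (rule tendsto_lowerbound)
      have "((\<lambda>d. 2 * e * T + (C + B' / \<rho>) * d) \<longlongrightarrow> 2 * e * T + (C + B' / \<rho>) * 0) (at_right 0)"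
        by (intro tendsto_intros)
      then show "((\<lambda>d. 2 * e * T + (C + B' / \<rho>) * d) \<longlongrightarrow> 2 * e * T) (at_right 0)" by simp
      show "\<forall>\<^sub>F d in at_right 0. \<bar>T * f l - T * godunov_value f ul ur\<bar> \<le> 2 * e * T + (C + B' / \<rho>) * d"
        unfolding eventually_at_right_field using est d0 by (auto intro!: exI[of _ d0])
    qed simp
    then have "T * \<bar>f l - godunov_value f ul ur\<bar> \<le> T * (2 * e)"
      using T by (simp add: right_diff_distrib[symmetric] abs_mult mult_ac)
    then show ?thesis using T by simp
  qed
  from this[of "\<bar>f l - godunov_value f ul ur\<bar> / 4"] show ?thesis by (cases "f l = godunov_value f ul ur") auto
qed

end

section \<open>From entropy solutions to bounded representatives\<close>

text \<open>
  The solution is set to zero for negative times and clamped to its essential bound.  At every time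
  \<open>t \<ge> 0\<close> this changes it on a null set only; Fubini's theorem makes the change invisible to the
  space-time integral in the entropy inequality.
\<close>

lemma kruzhkov_solution_of_entropy_solution:
  assumes lip: "\<And>A. \<exists>L. L-lipschitz_on {-A..A} f" and U: "entropy_solution f u0 U"
  obtains V M where "kruzhkov_solution f V M" "\<And>t. 0 \<le> t \<Longrightarrow> AE y in lborel. V t y = U t y"
    "\<And>t. 0 \<le> t \<Longrightarrow> U t \<in> borel_measurable borel" "AE y in lborel. V 0 y = u0 y"
proof -
  obtain M0 where meas: "(\<lambda>(t, y). U t y) \<in> borel_measurable (restrict_space borel ({0..} \<times> UNIV))"
    and bound: "\<And>t. 0 \<le> t \<Longrightarrow> AE y in lborel. \<bar>U t y\<bar> \<le> M0"
    and init: "AE y in lborel. U 0 y = u0 y"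
    and cont: "\<And>t0 R. 0 \<le> t0 \<Longrightarrow> ((\<lambda>t. LINT y:{-R..R}|lborel. \<bar>U t y - U t0 y\<bar>) \<longlongrightarrow> 0) (at t0 within {0..})"
    and ent: "\<And>c \<phi> \<phi>t \<phi>y. test_function \<phi> \<phi>t \<phi>y \<Longrightarrow>
        0 \<le> (LINT (t, y)|lborel.
               \<bar>U t y - c\<bar> * \<phi>t (t, y) + sgn (U t y - c) * (f (U t y) - f c) * \<phi>y (t, y))"
    using U unfolding entropy_solution_def by blast
  define W where "W = (\<lambda>t y. if 0 \<le> t then U t y else 0)"
  have "{0..} \<times> UNIV \<in> sets (borel :: (real \<times> real) measure)"
    by (intro borel_closed closed_Times) auto
  then have "(\<lambda>p. indicator ({0..} \<times> UNIV) p *\<^sub>R (case p of (t, y) \<Rightarrow> U t y)) \<in> borel_measurable borel"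
    using meas by (subst (asm) borel_measurable_restrict_space_iff) auto
  also have "(\<lambda>p. indicator ({0..} \<times> UNIV) p *\<^sub>R (case p of (t, y) \<Rightarrow> U t y)) = (\<lambda>(t, y). W t y)"
    by (auto simp: W_def fun_eq_iff indicator_def)
  finally have Wm [measurable]: "case_prod W \<in> borel_measurable (borel \<Otimes>\<^sub>M borel)"
    by (simp add: borel_prod)
  have Um [measurable]: "U t \<in> borel_measurable borel" if "0 \<le> t" for t
  proof -
    have "(\<lambda>y. W t y) \<in> borel_measurable borel" by measurable
    then show ?thesis using that by (simp add: W_def)
  qed
  define M where "M = \<bar>M0\<bar>"
  define V where "V = (\<lambda>t y. max (- M) (min M (W t y)))"
  have Vm [measurable]: "case_prod V \<in> borel_measurable (borel \<Otimes>\<^sub>M borel)" unfolding V_def by measurable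
  have VW: "AE y in lborel. V t y = W t y" for t
  proof (cases "0 \<le> t")
    case True
    show ?thesis using bound[OF True] by eventually_elim (use True in \<open>auto simp: V_def W_def M_def\<close>)
  qed (simp add: V_def W_def M_def)
  have VU: "AE y in lborel. V t y = U t y" if "0 \<le> t" for t
    using VW[of t] that by (simp add: W_def)
  have fc: "f \<in> borel_measurable borel"
  proof (rule borel_measurable_continuous_onI, unfold continuous_on_eq_continuous_at[OF open_UNIV], rule ballI)
    fix v
    obtain L where "L-lipschitz_on {-(\<bar>v\<bar>+1)..\<bar>v\<bar>+1} f" using lip by blast
    then have "continuous_on {-(\<bar>v\<bar>+1)..\<bar>v\<bar>+1} f" by (rule lipschitz_on_continuous_on)
    then show "isCont f v" by (rule continuous_on_interior) auto
  qed
  have "kruzhkov_solution f V M"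
  proof
    show "\<exists>L. L-lipschitz_on {-A..A} f" for A by (rule lip)
    show "\<bar>V t y\<bar> \<le> M" for t y by (auto simp: V_def M_def)
    show "((\<lambda>t. LINT y:{-R..R}|lborel. \<bar>V t y - V t0 y\<bar>) \<longlongrightarrow> 0) (at t0 within {0..})" if t0: "0 \<le> t0" for t0 R
    proof (rule Lim_transform_eventually[OF cont[OF t0, of R]])
      show "\<forall>\<^sub>F t in at t0 within {0..}. (LINT y:{-R..R}|lborel. \<bar>U t y - U t0 y\<bar>) = (LINT y:{-R..R}|lborel. \<bar>V t y - V t0 y\<bar>)"
        unfolding eventually_at_filter
      proof (intro always_eventually allI impI)
        fix t :: real assume "t \<noteq> t0" "t \<in> {0..}"
        then have t: "0 \<le> t" by simp
        note [measurable] = Um[OF t] Um[OF t0]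
        have "AE y in lborel. y \<in> {-R..R} \<longrightarrow> \<bar>U t y - U t0 y\<bar> = \<bar>V t y - V t0 y\<bar>"
          using VU[OF t] VU[OF t0] by eventually_elim simp
        then show "(LINT y:{-R..R}|lborel. \<bar>U t y - U t0 y\<bar>) = (LINT y:{-R..R}|lborel. \<bar>V t y - V t0 y\<bar>)"
          by (intro set_lebesgue_integral_cong_AE) auto
      qed
    qed
    show "0 \<le> (LINT (t, y)|lborel.
             \<bar>V t y - c\<bar> * \<phi>t (t, y) + sgn (V t y - c) * (f (V t y) - f c) * \<phi>y (t, y))"
      if tf: "test_function \<phi> \<phi>t \<phi>y" for c \<phi> \<phi>t \<phi>y
    proof -
      have [measurable]: "\<phi>t \<in> borel_measurable (borel \<Otimes>\<^sub>M borel)" "\<phi>y \<in> borel_measurable (borel \<Otimes>\<^sub>M borel)"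
        using test_function_measurable[OF tf] by (simp_all add: borel_prod)
      note [measurable] = fc
      have z: "\<phi>t (t, y) = 0 \<and> \<phi>y (t, y) = 0" if "t \<le> 0" for t y
        using test_function_support[OF tf] that by metis
      let ?I = "\<lambda>Z::real\<Rightarrow>real\<Rightarrow>real. (\<lambda>(t, y). \<bar>Z t y - c\<bar> * \<phi>t (t, y) + sgn (Z t y - c) * (f (Z t y) - f c) * \<phi>y (t, y))"
      have "?I U = ?I W" using z by (auto simp: fun_eq_iff W_def)
      then have "0 \<le> integral\<^sup>L lborel (?I W)" using ent[OF tf, of c] by simp
      also have "integral\<^sup>L lborel (?I W) = integral\<^sup>L lborel (?I V)"
      proof (rule integral_cong_AE)
        have m: "?I Z \<in> borel_measurable (borel \<Otimes>\<^sub>M borel)" if [measurable]: "case_prod Z \<in> borel_measurable (borel \<Otimes>\<^sub>M borel)" for Z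
          by measurable
        show "?I W \<in> borel_measurable lborel" "?I V \<in> borel_measurable lborel"
          using m[OF Wm] m[OF Vm] by (simp_all add: borel_prod)
        have "AE p in lborel \<Otimes>\<^sub>M lborel. case_prod V p = case_prod W p"
        proof (rule lborel_pair.AE_pair_measure)
          have [measurable]: "case_prod V \<in> borel_measurable (lborel \<Otimes>\<^sub>M lborel)"
            "case_prod W \<in> borel_measurable (lborel \<Otimes>\<^sub>M lborel)"
            using Vm Wm by (simp_all add: lborel_prod borel_prod)
          show "{p \<in> space (lborel \<Otimes>\<^sub>M lborel). case_prod V p = case_prod W p} \<in> sets (lborel \<Otimes>\<^sub>M lborel)"
            by measurable
          show "AE t in lborel. AE y in lborel. case_prod V (t, y) = case_prod W (t, y)" using VW by simp
        qed
        then have "AE p in lborel. case_prod V p = case_prod W p" unfolding lborel_prod .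
        then show "AE p in lborel. ?I W p = ?I V p" 
        proof eventually_elim
          case (elim p) then show ?case by (cases p) simp
        qed
      qed
      finally show ?thesis .
    qed
  qed measurable
  moreover have "AE y in lborel. V 0 y = u0 y" using VU[OF order_refl] init by eventually_elim simp
  ultimately show thesis using VU Um by (intro that) blast+
qed

text \<open>
  Both one-sided limits of the Riemann profile have the same value of \<open>f\<close>, so the choice of the state
  at a stationary shock is immaterial.
\<close>

lemma godunov_state_value:
  assumes lip: "\<And>A. \<exists>L. L-lipschitz_on {-A..A} f" and us: "godunov_state f ul ur us"
  shows "f us = godunov_value f ul ur"
proof -
  obtain w wm wp where w: "riemann_solution f ul ur w" and lim: "(w \<longlongrightarrow> wm) (at_left 0)" "(w \<longlongrightarrow> wp) (at_right 0)"
    and us: "us = wm \<or> us = wp"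
    using us unfolding godunov_state_def by blast
  obtain V M where V: "kruzhkov_solution f V M"
    "\<And>t. 0 \<le> t \<Longrightarrow> AE y in lborel. V t y = (if t = 0 then riemann_data ul ur y else w (y / t))"
    "AE y in lborel. V 0 y = riemann_data ul ur y"
    by (rule kruzhkov_solution_of_entropy_solution[OF lip w[unfolded riemann_solution_def]]) blast
  interpret kruzhkov_solution f V M by (rule V(1))
  have sim: "AE y in lborel. V t y = w (y / t)" if "0 < t" for t
    using V(2)[of t] that by simp
  have "((\<lambda>\<xi>. w (1 * \<xi>)) \<longlongrightarrow> wp) (at_right 0)" using lim(2) by simp
  from self_similar_flux_value[OF V(3) sim _ this] have "f wp = godunov_value f ul ur" by simp
  moreover have "((\<lambda>\<xi>. w (-1 * \<xi>)) \<longlongrightarrow> wm) (at_right 0)" using lim(1) unfolding filterlim_at_left_to_right by simp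
  from self_similar_flux_value[OF V(3) sim _ this] have "f wm = godunov_value f ul ur" by simp
  ultimately show ?thesis using us by blast
qed

section \<open>The balance of one cell\<close>

context kruzhkov_solution
begin

lemma weak_form_nonneg:
  assumes d\<psi>: "\<And>y. (\<psi> has_real_derivative \<psi>' y) (at y)" and cont: "continuous_on UNIV \<psi>'"
    and supp: "\<And>y. R < \<bar>y\<bar> \<Longrightarrow> \<psi> y = 0 \<and> \<psi>' y = 0" and T: "0 < T" and nn: "\<And>y. 0 \<le> \<psi> y"
  shows "(LINT y|lborel. \<psi> y * V T y) - (LINT y|lborel. \<psi> y * V 0 y) = flux f \<psi>' T"
proof -
  have c\<psi>: "continuous_on UNIV \<psi>"
    using d\<psi> DERIV_isCont by (auto simp: continuous_on_eq_continuous_at)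
  have c: "continuous_on UNIV (\<lambda>p::real\<times>real. \<psi> (snd p))" "continuous_on UNIV (\<lambda>p::real\<times>real. 0::real)"
    "continuous_on UNIV (\<lambda>p::real\<times>real. \<psi>' (snd p))"
    by (auto intro!: continuous_on_compose2[OF c\<psi>] continuous_on_compose2[OF cont] continuous_intros)
  have ineq: "(LINT y|lborel. \<eta> (V T y) * \<psi> y) \<le> (LINT y|lborel. \<eta> (V 0 y) * \<psi> y)
      + (LINT t:{0<..<T}|lborel. LINT y|lborel. q (V t y) * \<psi>' y)" if "entropy_pair \<eta> q" for \<eta> q
  proof -
    have "(LINT y|lborel. \<eta> (V T y) * \<psi> (snd (T, y))) \<le> (LINT y|lborel. \<eta> (V 0 y) * \<psi> (snd (0::real, y)))
      + (LINT t:{0<..<T}|lborel. LINT y|lborel. \<eta> (V t y) * 0 + q (V t y) * \<psi>' (snd (t, y)))"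
      by (rule entropy_inequality_from_initial_time(1)[OF that, where R = R and \<Psi> = "\<lambda>p. \<psi> (snd p)"
            and \<Psi>t = "\<lambda>_. 0" and \<Psi>y = "\<lambda>p. \<psi>' (snd p)"])
         (use nn d\<psi> supp T c in auto)
    then show ?thesis by simp
  qed
  show ?thesis
    using ineq[OF entropy_pair_id] ineq[OF entropy_pair_uminus]
    by (simp add: flux_def mult.commute[of "\<psi> _"] mult.commute[of "\<psi>' _"] set_lebesgue_integral_def)
qed

text \<open>
  Test functions are nonnegative, so a multiple of a nonnegative cutoff that equals \<open>1\<close> on the support
  of \<open>\<psi>\<close> is added and subtracted.
\<close>

lemma weak_form:
  assumes d\<psi>: "\<And>y. (\<psi> has_real_derivative \<psi>' y) (at y)" and cont: "continuous_on UNIV \<psi>'"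
    and supp: "\<And>y. R < \<bar>y\<bar> \<Longrightarrow> \<psi> y = 0 \<and> \<psi>' y = 0" and T: "0 < T"
  shows "(LINT y|lborel. \<psi> y * V T y) - (LINT y|lborel. \<psi> y * V 0 y) = flux f \<psi>' T"
proof -
  have c\<psi>: "continuous_on UNIV \<psi>"
    using d\<psi> DERIV_isCont by (auto simp: continuous_on_eq_continuous_at)
  have w: "weight \<psi>" "weight \<psi>'"
    by (rule weight_continuous[of _ "-R" R]; use c\<psi> cont supp in auto)+
  obtain K where K: "0 \<le> K" "\<And>y. \<bar>\<psi> y\<bar> \<le> K" using weightE[OF w(1)] by metis
  define \<kappa> where "\<kappa> = (\<lambda>y. smoothstep (y + R + 1) * smoothstep (R + 1 - y))"
  define \<kappa>' where "\<kappa>' = (\<lambda>y. smoothstep_deriv (y + R + 1) * smoothstep (R + 1 - y)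
     - smoothstep (y + R + 1) * smoothstep_deriv (R + 1 - y))"
  have d\<kappa>: "(\<kappa> has_real_derivative \<kappa>' y) (at y)" for y
    unfolding \<kappa>_def \<kappa>'_def by (auto intro!: derivative_eq_intros)
  have c\<kappa>: "continuous_on UNIV \<kappa>" "continuous_on UNIV \<kappa>'"
    unfolding \<kappa>_def \<kappa>'_def by (intro continuous_intros)+
  have s\<kappa>: "\<kappa> y = 0 \<and> \<kappa>' y = 0" if "\<bar>R\<bar> + 1 < \<bar>y\<bar>" for y
  proof -
    have "y + R + 1 \<le> 0 \<or> R + 1 - y \<le> 0" using that by linarith
    then show ?thesis by (auto simp: \<kappa>_def \<kappa>'_def)
  qed
  have wk: "weight \<kappa>" "weight \<kappa>'"
    by (rule weight_continuous[of _ "-(\<bar>R\<bar>+1)" "\<bar>R\<bar>+1"]; use c\<kappa> s\<kappa> in auto)+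
  obtain B where B: "\<And>v. \<bar>v\<bar> \<le> M \<Longrightarrow> \<bar>f v\<bar> \<le> B" using f_bounded by metis
  have 1: "(LINT y|lborel. K * \<kappa> y * V T y) - (LINT y|lborel. K * \<kappa> y * V 0 y) = flux f (\<lambda>y. K * \<kappa>' y) T"
  proof (rule weak_form_nonneg[OF _ _ _ T])
    show "((\<lambda>y. K * \<kappa> y) has_real_derivative K * \<kappa>' y) (at y)" for y by (intro DERIV_cmult d\<kappa>)
    show "continuous_on UNIV (\<lambda>y. K * \<kappa>' y)" by (intro continuous_intros c\<kappa>)
    show "K * \<kappa> y = 0 \<and> K * \<kappa>' y = 0" if "\<bar>R\<bar> + 1 < \<bar>y\<bar>" for y using s\<kappa>[OF that] by simp
    show "0 \<le> K * \<kappa> y" for y using K by (simp add: \<kappa>_def)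
  qed
  have 2: "(LINT y|lborel. (\<psi> y + K * \<kappa> y) * V T y) - (LINT y|lborel. (\<psi> y + K * \<kappa> y) * V 0 y)
      = flux f (\<lambda>y. \<psi>' y + K * \<kappa>' y) T"
  proof (rule weak_form_nonneg[OF _ _ _ T])
    show "((\<lambda>y. \<psi> y + K * \<kappa> y) has_real_derivative \<psi>' y + K * \<kappa>' y) (at y)" for y
      by (intro DERIV_add DERIV_cmult d\<kappa> d\<psi>)
    show "continuous_on UNIV (\<lambda>y. \<psi>' y + K * \<kappa>' y)" by (intro continuous_intros c\<kappa> cont)
    show "\<psi> y + K * \<kappa> y = 0 \<and> \<psi>' y + K * \<kappa>' y = 0" if "\<bar>R\<bar> + 1 < \<bar>y\<bar>" for y
      using s\<kappa>[OF that] supp[of y] that by simp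
    show "0 \<le> \<psi> y + K * \<kappa> y" for y
    proof (cases "R < \<bar>y\<bar>")
      case True then show ?thesis using supp[OF True] K by (simp add: \<kappa>_def)
    next
      case False
      then have "\<kappa> y = 1" by (auto simp: \<kappa>_def)
      then show ?thesis using K(2)[of y] by simp
    qed
  qed
  have 3: "flux f (\<lambda>y. \<psi>' y + K * \<kappa>' y) T = flux f \<psi>' T + flux f (\<lambda>y. K * \<kappa>' y) T"
    by (rule flux_weight_add[OF w(2) weight_cmult[OF wk(2)] _ B]) auto
  have 4: "(LINT y|lborel. (\<psi> y + K * \<kappa> y) * V t y) = (LINT y|lborel. \<psi> y * V t y) + (LINT y|lborel. K * \<kappa> y * V t y)" for t
    unfolding distrib_right
    by (rule Bochner_Integration.integral_add;
        rule slice_integrable(1)[where q = "\<lambda>v. v" and B = M]; (intro w weight_cmult wk)?; simp)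
  show ?thesis using 1 2 unfolding 3 4 by linarith
qed

lemma flux_initial_time:
  assumes h: "weight h"
  shows "((\<lambda>T. flux f h T / T) \<longlongrightarrow> (LINT y|lborel. h y * f (V 0 y))) (at_right 0)"
proof (rule tendstoI)
  fix e :: real assume e: "0 < e"
  obtain C R where C: "0 \<le> C" "0 \<le> R" "\<And>y. \<bar>h y\<bar> \<le> C" "\<And>y. R < \<bar>y\<bar> \<Longrightarrow> h y = 0"
    using weightE[OF h] by metis
  note [measurable] = weight_measurable[OF h]
  obtain L where Lip: "L-lipschitz_on {-M..M} f" using f_lipschitz by blast
  have L0: "0 \<le> L" using Lip by (rule lipschitz_on_nonneg)
  have L: "\<bar>f (V t y) - f (V s y)\<bar> \<le> L * \<bar>V t y - V s y\<bar>" for t s y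
  proof -
    have "V t y \<in> {-M..M}" "V s y \<in> {-M..M}" using V_bound[of t y] V_bound[of s y] by auto
    from lipschitz_onD[OF Lip this] show ?thesis by (simp add: dist_real_def)
  qed
  obtain B where B: "\<And>v. \<bar>v\<bar> \<le> M \<Longrightarrow> \<bar>f v\<bar> \<le> B" using f_bounded by metis
  define I where "I = (\<lambda>t. LINT y|lborel. h y * f (V t y))"
  define D where "D = (\<lambda>t. LINT y:{-R..R}|lborel. \<bar>V t y - V 0 y\<bar>)"
  have I: "\<bar>I t - I 0\<bar> \<le> C * L * D t" for t
  proof -
    have "I t - I 0 = (LINT y|lborel. h y * f (V t y) - h y * f (V 0 y))"
      unfolding I_def using slice_integrable(1)[OF h f_measurable B, of t] slice_integrable(1)[OF h f_measurable B, of 0] by simp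
    also have "\<bar>\<dots>\<bar> \<le> (LINT y|lborel. C * L * (indicator {-R..R} y * \<bar>V t y - V 0 y\<bar>))"
    proof (rule abs_integral_le[OF _ AE_I2])
      show "integrable lborel (\<lambda>y. C * L * (indicator {-R..R} y * \<bar>V t y - V 0 y\<bar>))"
      proof (intro integrable_mult_right integrable_bounded_interval[of _ "2 * M" "-R" R])
        show "\<bar>indicator {-R..R} y * \<bar>V t y - V 0 y\<bar>\<bar> \<le> 2 * M" for y
          using V_bound[of t y] V_bound[of 0 y] by (auto simp: indicator_def)
      qed auto
      show "\<bar>h y * f (V t y) - h y * f (V 0 y)\<bar> \<le> C * L * (indicator {-R..R} y * \<bar>V t y - V 0 y\<bar>)" for y
      proof (cases "\<bar>y\<bar> \<le> R")
        case True
        have "\<bar>h y * f (V t y) - h y * f (V 0 y)\<bar> = \<bar>h y\<bar> * \<bar>f (V t y) - f (V 0 y)\<bar>"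
          by (simp add: abs_mult[symmetric] algebra_simps)
        also have "\<dots> \<le> C * (L * \<bar>V t y - V 0 y\<bar>)" using C L by (intro mult_mono) auto
        finally show ?thesis using True by (simp add: indicator_def abs_le_iff mult_ac)
      qed (use C L0 in auto)
    qed
    also have "\<dots> = C * L * D t" by (simp add: D_def set_lebesgue_integral_def)
    finally show ?thesis .
  qed
  have "(D \<longlongrightarrow> 0) (at 0 within {0..})" unfolding D_def by (rule V_continuous) simp
  then have "(D \<longlongrightarrow> 0) (at_right 0)" by (rule tendsto_within_subset) auto
  then have "((\<lambda>t. C * L * D t) \<longlongrightarrow> 0) (at_right 0)" by (rule tendsto_mult_right_zero)
  then have "\<forall>\<^sub>F t in at_right 0. dist (C * L * D t) 0 < e/2" by (rule tendstoD) (use e in simp)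
  then obtain T0 where T0: "0 < T0" "\<And>t. 0 < t \<Longrightarrow> t < T0 \<Longrightarrow> dist (C * L * D t) 0 < e/2"
    unfolding eventually_at_right_field by blast
  have "dist (flux f h T / T) (I 0) < e" if T: "0 < T" "T < T0" for T
  proof -
    have "flux f h T - T * I 0 = (LINT t:{0<..<T}|lborel. I t - I 0)"
    proof -
      have i: "set_integrable lborel {0<..<T} I"
        unfolding I_def by (rule slice_integrable(2)[OF h f_measurable B])
      have c: "set_integrable lborel {0<..<T} (\<lambda>_. I 0)"
        unfolding set_integrable_def
        by (rule integrable_bounded_interval[of _ "\<bar>I 0\<bar>" 0 T]) (auto simp: indicator_def)
      have "(LINT t:{0<..<T}|lborel. I 0) = T * I 0" using T(1) by (simp add: set_lebesgue_integral_def)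
      then show ?thesis using set_integral_diff(2)[OF i c] by (simp add: flux_def I_def)
    qed
    also have "\<bar>\<dots>\<bar> \<le> (LINT t|lborel. e/2 * indicator {0..T} t)"
      unfolding set_lebesgue_integral_def
    proof (rule abs_integral_le[OF integrable_const_indicator_interval AE_I2])
      fix t show "\<bar>indicator {0<..<T} t *\<^sub>R (I t - I 0)\<bar> \<le> e/2 * indicator {0..T} t"
      proof (cases "t \<in> {0<..<T}")
        case True
        then have "dist (C * L * D t) 0 < e/2" by (intro T0(2)) (use T in auto)
        then have "\<bar>I t - I 0\<bar> \<le> e/2" using I[of t] unfolding dist_real_def by linarith
        then show ?thesis using True by simp
      next
        case False
        then show ?thesis using e by simp
      qed
    qed
    also have "\<dots> = e/2 * T" using T by simp
    finally have "\<bar>flux f h T - T * I 0\<bar> \<le> e/2 * T" .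
    also have "flux f h T - T * I 0 = T * (flux f h T / T - I 0)" using T by (simp add: field_simps)
    also have "\<bar>\<dots>\<bar> = T * \<bar>flux f h T / T - I 0\<bar>" using T by (simp add: abs_mult)
    finally have "\<bar>flux f h T / T - I 0\<bar> \<le> e/2" using T by (simp add: mult.commute)
    then show ?thesis using e by (simp add: dist_real_def)
  qed
  then show "\<forall>\<^sub>F T in at_right 0. dist (flux f h T / T) (LINT y|lborel. h y * f (V 0 y)) < e"
    unfolding eventually_at_right_field I_def using T0(1) by blast
qed


text \<open>
  The weak form is applied to \<open>g \<kappa>\<close>, where \<open>\<kappa>\<close> rises from \<open>0\<close> to \<open>1\<close> just inside the left edge and falls
  just inside the right one.  Replacing \<open>\<kappa>\<close> by the indicator of the cell, and \<open>g\<close> by its values at the edges in the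
  edge terms, costs \<open>O(d)\<close> for fixed \<open>T\<close>; these errors, collected in \<open>C'\<close>, disappear as \<open>d\<close> tends to \<open>0\<close>,
  and only the \<open>e T\<close> of the edge fluxes survives.
\<close>

lemma cell_flux_estimate:
  assumes ab: "\<alpha> < \<beta>"
    and g: "\<And>y. (g has_real_derivative g' y) (at y)" "continuous_on UNIV g'"
    and edge_\<alpha>: "\<And>d \<sigma> \<sigma>'. step_profile \<alpha> d \<sigma> \<sigma>' \<Longrightarrow> 0 < d \<Longrightarrow> d \<le> d0 \<Longrightarrow> \<bar>flux f \<sigma>' T - T * G\<alpha>\<bar> \<le> e * T + C * d"
    and edge_\<beta>: "\<And>d \<sigma> \<sigma>'. step_profile \<beta> d \<sigma> \<sigma>' \<Longrightarrow> 0 < d \<Longrightarrow> d \<le> d0 \<Longrightarrow> \<bar>flux f \<sigma>' T - T * G\<beta>\<bar> \<le> e * T + C * d"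
    and T: "0 < T" and d0: "0 < d0"
  shows "\<bar>(LINT y|lborel. indicator {\<alpha>..\<beta>} y * g y * V T y) - (LINT y|lborel. indicator {\<alpha>..\<beta>} y * g y * V 0 y)
      - flux f (\<lambda>y. indicator {\<alpha>..\<beta>} y * g' y) T - T * (g \<alpha> * G\<alpha> - g \<beta> * G\<beta>)\<bar>
    \<le> (\<bar>g \<alpha>\<bar> + \<bar>g \<beta>\<bar>) * e * T"
    (is "?lhs \<le> _")
proof -
  let ?\<chi> = "indicator {\<alpha>..\<beta>} :: real \<Rightarrow> real"
  have cg: "continuous_on UNIV g"
    using DERIV_isCont[OF g(1)] by (simp add: continuous_on_eq_continuous_at)
  have w\<chi>: "weight (\<lambda>y. ?\<chi> y * g y)" "weight (\<lambda>y. ?\<chi> y * g' y)"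
    by (rule weight_indicator_times[OF cg] weight_indicator_times[OF g(2)])+
  obtain K where K: "0 \<le> K" "\<And>v. \<bar>v\<bar> \<le> M \<Longrightarrow> \<bar>f v\<bar> \<le> K" by (rule f_bounded) (rule that)
  obtain g0 where g0: "0 \<le> g0" "\<And>y. \<bar>?\<chi> y * g y\<bar> \<le> g0" by (rule weightE[OF w\<chi>(1)]) (rule that)
  obtain g1 where g1: "0 \<le> g1" "\<And>y. \<bar>?\<chi> y * g' y\<bar> \<le> g1" by (rule weightE[OF w\<chi>(2)]) (rule that)
  have g0': "\<bar>g y\<bar> \<le> g0" and g1': "\<bar>g' y\<bar> \<le> g1" if "\<alpha> \<le> y" "y \<le> \<beta>" for y
    using g0(2)[of y] g1(2)[of y] that by simp_all
  have mvt: "\<bar>g y - g z\<bar> \<le> g1 * \<bar>y - z\<bar>" if "y \<in> {\<alpha>..\<beta>}" "z \<in> {\<alpha>..\<beta>}" for y z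
  proof -
    have "norm (g y - g z) \<le> g1 * norm (y - z)"
    proof (rule field_differentiable_bound[OF _ _ _ that])
      show "(g has_field_derivative g' w) (at w within {\<alpha>..\<beta>})" for w
        by (rule has_field_derivative_at_within[OF g(1)])
      show "norm (g' w) \<le> g1" if "w \<in> {\<alpha>..\<beta>}" for w using g1'[of w] that by simp
    qed simp
    then show ?thesis by simp
  qed
  define C' where "C' = 4 * M * g0 + 2 * K * g1 * T + 2 * K * g1 * T + (\<bar>g \<alpha>\<bar> + \<bar>g \<beta>\<bar>) * C"
  have est: "?lhs \<le> (\<bar>g \<alpha>\<bar> + \<bar>g \<beta>\<bar>) * e * T + C' * d" if d: "0 < d" "d \<le> d0" "2 * d < \<beta> - \<alpha>" for d
  proof -
    define \<sigma>a where "\<sigma>a = (\<lambda>y. smoothstep ((y - \<alpha>) / d))"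
    define \<sigma>a' where "\<sigma>a' = (\<lambda>y. smoothstep_deriv ((y - \<alpha>) / d) / d)"
    define \<sigma>b where "\<sigma>b = (\<lambda>y. smoothstep ((y - (\<beta> - d)) / d))"
    define \<sigma>b' where "\<sigma>b' = (\<lambda>y. smoothstep_deriv ((y - (\<beta> - d)) / d) / d)"
    have sa: "step_profile \<alpha> d \<sigma>a \<sigma>a'" unfolding \<sigma>a_def \<sigma>a'_def by (rule step_profile_smoothstep) (use d in auto)
    have sb: "step_profile \<beta> d \<sigma>b \<sigma>b'" unfolding \<sigma>b_def \<sigma>b'_def by (rule step_profile_smoothstep) (use d in auto)
    have a0: "\<sigma>a y = 0" "\<sigma>a' y = 0" if "y \<le> \<alpha>" for y
      using that d(1) by (auto simp: \<sigma>a_def \<sigma>a'_def divide_nonpos_pos)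
    have a1: "\<sigma>a y = 1" "\<sigma>a' y = 0" if "\<alpha> + d \<le> y" for y
    proof -
      have "1 \<le> (y - \<alpha>) / d" using that d(1) by (simp add: le_divide_eq)
      then show "\<sigma>a y = 1" "\<sigma>a' y = 0" by (auto simp: \<sigma>a_def \<sigma>a'_def)
    qed
    have b0: "\<sigma>b y = 0" "\<sigma>b' y = 0" if "y \<le> \<beta> - d" for y
      using that d(1) by (auto simp: \<sigma>b_def \<sigma>b'_def divide_nonpos_pos)
    have b1: "\<sigma>b y = 1" "\<sigma>b' y = 0" if "\<beta> \<le> y" for y
    proof -
      have "1 \<le> (y - (\<beta> - d)) / d" using that d(1) by (simp add: le_divide_eq)
      then show "\<sigma>b y = 1" "\<sigma>b' y = 0" by (auto simp: \<sigma>b_def \<sigma>b'_def)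
    qed
    define \<kappa> where "\<kappa> = (\<lambda>y. \<sigma>a y * (1 - \<sigma>b y))"
    \<comment> \<open>The product rule for \<open>g \<kappa>\<close>: since \<open>2 d < \<beta> - \<alpha>\<close>, one ramp is constant where the other one moves.\<close>
    define \<psi>' where "\<psi>' = (\<lambda>y. g' y * \<kappa> y + (g y * \<sigma>a' y + - 1 * (g y * \<sigma>b' y)))"
    define J where "J = (\<lambda>y. indicator {\<alpha>..\<alpha> + d} y + indicator {\<beta> - d..\<beta>} y :: real)"
    have iJ: "integrable lborel J" unfolding J_def
      using integrable_const_indicator_interval[of 1 \<alpha> "\<alpha> + d"] integrable_const_indicator_interval[of 1 "\<beta> - d" \<beta>] by simp
    have intJ: "integral\<^sup>L lborel J = 2 * d" unfolding J_def
      using integrable_const_indicator_interval[of 1 \<alpha> "\<alpha> + d"] integrable_const_indicator_interval[of 1 "\<beta> - d" \<beta>] d(1) by simp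
    have \<kappa>r: "0 \<le> \<kappa> y" "\<kappa> y \<le> 1" for y
      using step_profile_range[OF sa, of y] step_profile_range[OF sb, of y] by (auto simp: \<kappa>_def mult_le_one)
    have \<kappa>out: "\<kappa> y = 0" if "y \<notin> {\<alpha>..\<beta>}" for y using a0[of y] b1[of y] that by (auto simp: \<kappa>_def)
    have \<kappa>J: "\<bar>\<kappa> y - ?\<chi> y\<bar> \<le> J y" for y
    proof (cases "y \<in> {\<alpha>..\<beta>}")
      case True
      show ?thesis
      proof (cases "\<alpha> + d \<le> y \<and> y \<le> \<beta> - d")
        case True then show ?thesis using a1[of y] b0[of y] d(1) by (simp add: \<kappa>_def J_def)
      next
        case False
        then have "1 \<le> J y" using True by (auto simp: J_def indicator_def)
        then show ?thesis using \<kappa>r[of y] True by simp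
      qed
    next
      case False then show ?thesis using \<kappa>out[OF False] by (simp add: J_def)
    qed
    have ca: "continuous_on UNIV \<sigma>a" "continuous_on UNIV \<sigma>a'" "continuous_on UNIV \<sigma>b" "continuous_on UNIV \<sigma>b'"
      using continuous_on_step_profile[OF sa continuous_on_id] continuous_on_step_profile[OF sb continuous_on_id]
      by (auto simp: id_def)
    have c\<kappa>: "continuous_on UNIV \<kappa>" unfolding \<kappa>_def by (intro continuous_intros ca)
    have w\<kappa>: "weight (\<lambda>y. g y * \<kappa> y)" "weight (\<lambda>y. g' y * \<kappa> y)"
      by (rule weight_continuous[of _ \<alpha> \<beta>]; (intro continuous_intros c\<kappa> cg g(2))?; use \<kappa>out in auto)+
    have wa: "weight (\<lambda>y. g y * \<sigma>a' y)" "weight \<sigma>a'"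
      by (rule weight_continuous[of _ \<alpha> "\<alpha> + d"]; (intro continuous_intros ca cg)?; use a0 a1 in auto)+
    have wb: "weight (\<lambda>y. g y * \<sigma>b' y)" "weight \<sigma>b'"
      by (rule weight_continuous[of _ "\<beta> - d" \<beta>]; (intro continuous_intros ca cg)?; use b0 b1 in auto)+
    have d\<psi>: "((\<lambda>y. g y * \<kappa> y) has_real_derivative \<psi>' y) (at y)" for y
    proof -
      have D: "((\<lambda>y. g y * \<kappa> y) has_real_derivative
          g' y * \<kappa> y + (\<sigma>a' y * (1 - \<sigma>b y) + (0 - \<sigma>b' y) * \<sigma>a y) * g y) (at y)"
        unfolding \<kappa>_def
        by (intro DERIV_mult g(1) DERIV_diff DERIV_const step_profileD(1)[OF sa] step_profileD(1)[OF sb])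
      have h1: "\<sigma>a' y * (1 - \<sigma>b y) = \<sigma>a' y" using a1(2)[of y] b0(1)[of y] d(3) by (cases "\<alpha> + d \<le> y") auto
      have h2: "(0 - \<sigma>b' y) * \<sigma>a y = - \<sigma>b' y" using b0(2)[of y] a1(1)[of y] d(3) by (cases "y \<le> \<beta> - d") auto
      have "g' y * \<kappa> y + (\<sigma>a' y + - \<sigma>b' y) * g y = \<psi>' y" by (simp add: \<psi>'_def algebra_simps)
      then show ?thesis using D unfolding h1 h2 by simp
    qed
    have c\<psi>': "continuous_on UNIV \<psi>'" unfolding \<psi>'_def by (intro continuous_intros ca cg g(2) c\<kappa>)
    have s\<psi>: "g y * \<kappa> y = 0 \<and> \<psi>' y = 0" if "\<bar>\<alpha>\<bar> + \<bar>\<beta>\<bar> < \<bar>y\<bar>" for y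
    proof -
      have "y < \<alpha> \<or> \<beta> < y" using that by linarith
      then show ?thesis using \<kappa>out[of y] a0[of y] a1[of y] b0[of y] b1[of y] d by (auto simp: \<psi>'_def)
    qed
    have weak: "(LINT y|lborel. g y * \<kappa> y * V T y) - (LINT y|lborel. g y * \<kappa> y * V 0 y) = flux f \<psi>' T"
      by (rule weak_form[OF d\<psi> c\<psi>' s\<psi> T]) auto
    have split: "flux f \<psi>' T = flux f (\<lambda>y. g' y * \<kappa> y) T + (flux f (\<lambda>y. g y * \<sigma>a' y) T - flux f (\<lambda>y. g y * \<sigma>b' y) T)"
    proof -
      have "flux f \<psi>' T = flux f (\<lambda>y. g' y * \<kappa> y) T + flux f (\<lambda>y. g y * \<sigma>a' y + - 1 * (g y * \<sigma>b' y)) T"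
        unfolding \<psi>'_def by (rule flux_weight_add[OF w\<kappa>(2) weight_add[OF wa(1) weight_cmult[OF wb(1)]] f_measurable K(2)])
      also have "flux f (\<lambda>y. g y * \<sigma>a' y + - 1 * (g y * \<sigma>b' y)) T
         = flux f (\<lambda>y. g y * \<sigma>a' y) T + flux f (\<lambda>y. - 1 * (g y * \<sigma>b' y)) T"
        by (rule flux_weight_add[OF wa(1) weight_cmult[OF wb(1)] f_measurable K(2)])
      also have "flux f (\<lambda>y. - 1 * (g y * \<sigma>b' y)) T = - 1 * flux f (\<lambda>y. g y * \<sigma>b' y) T" by (rule flux_weight_cmult)
      finally show ?thesis by simp
    qed
    have J0: "0 \<le> J y" for y by (simp add: J_def)
    have mulJ: "\<bar>k y\<bar> * \<bar>\<kappa> y - ?\<chi> y\<bar> \<le> c * J y"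
      if "0 \<le> c" "\<And>y. \<alpha> \<le> y \<Longrightarrow> y \<le> \<beta> \<Longrightarrow> \<bar>k y\<bar> \<le> c" for k c y
    proof (cases "y \<in> {\<alpha>..\<beta>}")
      case True
      then show ?thesis by (intro mult_mono \<kappa>J that) simp_all
    next
      case False
      then show ?thesis using \<kappa>out[OF False] J0[of y] that(1) by simp
    qed
    have gJ: "\<bar>g y * \<kappa> y - ?\<chi> y * g y\<bar> \<le> g0 * J y" for y
    proof -
      have "g y * \<kappa> y - ?\<chi> y * g y = g y * (\<kappa> y - ?\<chi> y)" by (simp add: algebra_simps)
      then have "\<bar>g y * \<kappa> y - ?\<chi> y * g y\<bar> = \<bar>g y\<bar> * \<bar>\<kappa> y - ?\<chi> y\<bar>" by (simp only: abs_mult)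
      also have "\<dots> \<le> g0 * J y"
        by (rule mulJ[OF g0(1) g0'])
      finally show ?thesis .
    qed
    have g'J: "\<bar>g' y * \<kappa> y + - 1 * (?\<chi> y * g' y)\<bar> \<le> g1 * J y" for y
    proof -
      have "g' y * \<kappa> y + - 1 * (?\<chi> y * g' y) = g' y * (\<kappa> y - ?\<chi> y)" by (simp add: algebra_simps)
      then have "\<bar>g' y * \<kappa> y + - 1 * (?\<chi> y * g' y)\<bar> = \<bar>g' y\<bar> * \<bar>\<kappa> y - ?\<chi> y\<bar>" by (simp only: abs_mult)
      also have "\<dots> \<le> g1 * J y"
        by (rule mulJ[OF g1(1) g1'])
      finally show ?thesis .
    qed
    have mass: "\<bar>(LINT y|lborel. g y * \<kappa> y * V t y) - (LINT y|lborel. ?\<chi> y * g y * V t y)\<bar> \<le> M * (g0 * (2 * d))" for t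
    proof -
      have i: "integrable lborel (\<lambda>y. g y * \<kappa> y * V t y)"
        by (rule slice_integrable(1)[OF w\<kappa>(1), of "\<lambda>v. v" M t]) auto
      have i': "integrable lborel (\<lambda>y. ?\<chi> y * g y * V t y)"
        by (rule slice_integrable(1)[OF w\<chi>(1), of "\<lambda>v. v" M t]) auto
      have eq: "(LINT y|lborel. g y * \<kappa> y * V t y) - (LINT y|lborel. ?\<chi> y * g y * V t y)
          = (LINT y|lborel. g y * \<kappa> y * V t y - ?\<chi> y * g y * V t y)"
        by (rule Bochner_Integration.integral_diff[OF i i', symmetric])
      have "\<bar>LINT y|lborel. g y * \<kappa> y * V t y - ?\<chi> y * g y * V t y\<bar> \<le> (LINT y|lborel. M * (g0 * J y))"
      proof (rule abs_integral_le[OF _ AE_I2])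
        show "integrable lborel (\<lambda>y. M * (g0 * J y))" using iJ by simp
        fix y
        have "\<bar>g y * \<kappa> y * V t y - ?\<chi> y * g y * V t y\<bar> = \<bar>V t y\<bar> * \<bar>g y * \<kappa> y - ?\<chi> y * g y\<bar>"
        proof -
          have "g y * \<kappa> y * V t y - ?\<chi> y * g y * V t y = V t y * (g y * \<kappa> y - ?\<chi> y * g y)"
            by (simp only: right_diff_distrib mult_ac)
          then show ?thesis by (simp only: abs_mult)
        qed
        also have "\<dots> \<le> M * (g0 * J y)" by (intro mult_mono V_bound gJ M_nonneg abs_ge_zero)
        finally show "\<bar>g y * \<kappa> y * V t y - ?\<chi> y * g y * V t y\<bar> \<le> M * (g0 * J y)" .
      qed
      also have "\<dots> = M * (g0 * (2 * d))" using intJ by simp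
      finally show ?thesis unfolding eq .
    qed
    have bulk: "\<bar>flux f (\<lambda>y. g' y * \<kappa> y) T - flux f (\<lambda>y. ?\<chi> y * g' y) T\<bar> \<le> K * (g1 * (2 * d)) * T"
    proof -
      have 1: "flux f (\<lambda>y. g' y * \<kappa> y + - 1 * (?\<chi> y * g' y)) T = flux f (\<lambda>y. g' y * \<kappa> y) T + flux f (\<lambda>y. - 1 * (?\<chi> y * g' y)) T"
        by (rule flux_weight_add[OF w\<kappa>(2) weight_cmult[OF w\<chi>(2)] f_measurable K(2)])
      have 2: "flux f (\<lambda>y. - 1 * (?\<chi> y * g' y)) T = - 1 * flux f (\<lambda>y. ?\<chi> y * g' y) T" by (rule flux_weight_cmult)
      have 3: "\<bar>flux f (\<lambda>y. g' y * \<kappa> y + - 1 * (?\<chi> y * g' y)) T\<bar> \<le> K * (LINT y|lborel. g1 * J y) * T"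
        by (rule flux_weight_abs_le[OF weight_add[OF w\<kappa>(2) weight_cmult[OF w\<chi>(2)]] K(2) _ _ g'J])
           (use T iJ in auto)
      have 4: "(LINT y|lborel. g1 * J y) = g1 * (2 * d)" using intJ by simp
      show ?thesis using 3 unfolding 4 1 2 by simp
    qed
    have edge: "\<bar>flux f (\<lambda>y. g y * \<sigma>' y) T - g z * flux f \<sigma>' T\<bar> \<le> K * (g1 * d) * T"
      if s: "step_profile z d \<sigma> \<sigma>'" and w: "weight (\<lambda>y. g y * \<sigma>' y)" "weight \<sigma>'"
        and z: "z \<in> {\<alpha>..\<beta>}" and supp: "\<And>y. y \<notin> {\<alpha>..\<beta>} \<Longrightarrow> \<sigma>' y = 0" for z \<sigma> \<sigma>'
    proof -
      have 1: "flux f (\<lambda>y. g y * \<sigma>' y + - g z * \<sigma>' y) T = flux f (\<lambda>y. g y * \<sigma>' y) T + flux f (\<lambda>y. - g z * \<sigma>' y) T"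
        by (rule flux_weight_add[OF w(1) weight_cmult[OF w(2)] f_measurable K(2)])
      have 2: "flux f (\<lambda>y. - g z * \<sigma>' y) T = - g z * flux f \<sigma>' T" by (rule flux_weight_cmult)
      have 3: "\<bar>flux f (\<lambda>y. g y * \<sigma>' y + - g z * \<sigma>' y) T\<bar> \<le> K * (LINT y|lborel. g1 * d * \<sigma>' y) * T"
      proof (rule flux_weight_abs_le[OF weight_add[OF w(1) weight_cmult[OF w(2)]] K(2)])
        fix y
        show "\<bar>g y * \<sigma>' y + - g z * \<sigma>' y\<bar> \<le> g1 * d * \<sigma>' y"
        proof (cases "\<sigma>' y = 0")
          case False
          then have y: "y \<in> {\<alpha>..\<beta>}" "\<bar>y - z\<bar> \<le> d" using supp step_profile_deriv_0[OF s, of y] by (blast, linarith)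
          have "\<bar>g y * \<sigma>' y + - g z * \<sigma>' y\<bar> = \<bar>g y - g z\<bar> * \<sigma>' y"
          proof -
            have "g y * \<sigma>' y + - g z * \<sigma>' y = (g y - g z) * \<sigma>' y" by (simp add: left_diff_distrib)
            then show ?thesis using step_profileD(3)[OF s, of y] by (simp add: abs_mult)
          qed
          also have "\<dots> \<le> (g1 * d) * \<sigma>' y"
            using mvt[OF y(1) z] mult_left_mono[OF y(2) g1(1)] step_profileD(3)[OF s, of y] by (intro mult_right_mono) auto
          finally show ?thesis .
        qed simp
      qed (use T integral_step_profile_deriv[OF s d(1)] in auto)
      have 4: "(LINT y|lborel. g1 * d * \<sigma>' y) = g1 * d" using integral_step_profile_deriv[OF s d(1)] by simp
      show ?thesis using 3 unfolding 4 1 2 by simp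
    qed
    have ea: "\<bar>flux f (\<lambda>y. g y * \<sigma>a' y) T - g \<alpha> * flux f \<sigma>a' T\<bar> \<le> K * (g1 * d) * T"
      by (rule edge[OF sa wa]) (use ab a0 a1 d in auto)
    have eb: "\<bar>flux f (\<lambda>y. g y * \<sigma>b' y) T - g \<beta> * flux f \<sigma>b' T\<bar> \<le> K * (g1 * d) * T"
      by (rule edge[OF sb wb]) (use ab b0 b1 d in auto)
    have fa: "\<bar>g \<alpha> * flux f \<sigma>a' T - g \<alpha> * (T * G\<alpha>)\<bar> \<le> \<bar>g \<alpha>\<bar> * (e * T + C * d)"
      unfolding right_diff_distrib[symmetric] abs_mult by (intro mult_left_mono edge_\<alpha>[OF sa d(1,2)]) auto
    have fb: "\<bar>g \<beta> * flux f \<sigma>b' T - g \<beta> * (T * G\<beta>)\<bar> \<le> \<bar>g \<beta>\<bar> * (e * T + C * d)"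
      unfolding right_diff_distrib[symmetric] abs_mult by (intro mult_left_mono edge_\<beta>[OF sb d(1,2)]) auto
    have "?lhs \<le> M * (g0 * (2 * d)) + M * (g0 * (2 * d)) + K * (g1 * (2 * d)) * T + K * (g1 * d) * T + K * (g1 * d) * T
        + \<bar>g \<alpha>\<bar> * (e * T + C * d) + \<bar>g \<beta>\<bar> * (e * T + C * d)"
    proof -
      have eq: "T * (g \<alpha> * G\<alpha> - g \<beta> * G\<beta>) = g \<alpha> * (T * G\<alpha>) - g \<beta> * (T * G\<beta>)" by (simp add: algebra_simps)
      obtain pa pb where p: "\<bar>g \<alpha>\<bar> = pa" "\<bar>g \<beta>\<bar> = pb" by blast
      note bounds = mass[of T, unfolded abs_le_iff] mass[of 0, unfolded abs_le_iff] bulk[unfolded abs_le_iff]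
        ea[unfolded abs_le_iff] eb[unfolded abs_le_iff] fa[unfolded abs_le_iff p] fb[unfolded abs_le_iff p]
      show ?thesis using bounds weak[unfolded split] unfolding abs_le_iff eq p by linarith
    qed
    also have "\<dots> = (\<bar>g \<alpha>\<bar> + \<bar>g \<beta>\<bar>) * e * T + C' * d" by (simp add: C'_def algebra_simps)
    finally show ?thesis .
  qed
  show ?thesis
  proof (rule tendsto_lowerbound)
    have "((\<lambda>d. (\<bar>g \<alpha>\<bar> + \<bar>g \<beta>\<bar>) * e * T + C' * d) \<longlongrightarrow> (\<bar>g \<alpha>\<bar> + \<bar>g \<beta>\<bar>) * e * T + C' * 0) (at_right 0)"
      by (intro tendsto_intros)
    then show "((\<lambda>d. (\<bar>g \<alpha>\<bar> + \<bar>g \<beta>\<bar>) * e * T + C' * d) \<longlongrightarrow> (\<bar>g \<alpha>\<bar> + \<bar>g \<beta>\<bar>) * e * T) (at_right 0)" by simp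
    show "\<forall>\<^sub>F d in at_right 0. ?lhs \<le> (\<bar>g \<alpha>\<bar> + \<bar>g \<beta>\<bar>) * e * T + C' * d"
      unfolding eventually_at_right_field
    proof (intro exI[of _ "min d0 ((\<beta> - \<alpha>) / 2)"] conjI allI impI)
      show "0 < min d0 ((\<beta> - \<alpha>) / 2)" using d0 ab by simp
      show "?lhs \<le> (\<bar>g \<alpha>\<bar> + \<bar>g \<beta>\<bar>) * e * T + C' * d" if "0 < d" "d < min d0 ((\<beta> - \<alpha>) / 2)" for d
        by (rule est) (use that in auto)
    qed
  qed simp
qed

text \<open>
  Per unit time, the edge fluxes approach Osher's values at the one-sided limits of the initial data,
  and the interior term approaches its value at time \<open>0\<close>.
\<close>

lemma cell_balance:
  assumes ab: "\<alpha> < \<beta>"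
    and g: "\<And>y. (g has_real_derivative g' y) (at y)" "continuous_on UNIV g'"
    and init: "AE y in lborel. V 0 y = u0 y"
    and \<alpha>: "(u0 \<longlongrightarrow> a1) (at_left \<alpha>)" "(u0 \<longlongrightarrow> a2) (at_right \<alpha>)"
    and \<beta>: "(u0 \<longlongrightarrow> b1) (at_left \<beta>)" "(u0 \<longlongrightarrow> b2) (at_right \<beta>)"
  shows "((\<lambda>T. ((LINT y|lborel. indicator {\<alpha>..\<beta>} y * g y * V T y) - (LINT y|lborel. indicator {\<alpha>..\<beta>} y * g y * V 0 y)) / T)
    \<longlongrightarrow> (LINT y|lborel. indicator {\<alpha>..\<beta>} y * g' y * f (V 0 y))
        + (g \<alpha> * godunov_value f a1 a2 - g \<beta> * godunov_value f b1 b2)) (at_right 0)"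
proof -
  let ?Q = "\<lambda>T. (LINT y|lborel. indicator {\<alpha>..\<beta>} y * g y * V T y) - (LINT y|lborel. indicator {\<alpha>..\<beta>} y * g y * V 0 y)"
  let ?F = "\<lambda>T. flux f (\<lambda>y. indicator {\<alpha>..\<beta>} y * g' y) T"
  let ?G = "g \<alpha> * godunov_value f a1 a2 - g \<beta> * godunov_value f b1 b2"
  have 1: "((\<lambda>T. ?F T / T) \<longlongrightarrow> (LINT y|lborel. indicator {\<alpha>..\<beta>} y * g' y * f (V 0 y))) (at_right 0)"
    by (rule flux_initial_time[OF weight_indicator_times[OF g(2)]])
  have 2: "((\<lambda>T. (?Q T - ?F T) / T) \<longlongrightarrow> ?G) (at_right 0)"
  proof (rule tendstoI)
    fix r :: real assume r: "0 < r"
    define S where "S = \<bar>g \<alpha>\<bar> + \<bar>g \<beta>\<bar> + 1"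
    have S: "0 < S" by (simp add: S_def add_nonneg_pos)
    define e where "e = r / S"
    have e: "0 < e" using r S by (simp add: e_def)
    obtain Ta da Ca where a: "0 < Ta" "0 < da" "0 \<le> Ca"
      "\<And>T d \<sigma> \<sigma>'. step_profile \<alpha> d \<sigma> \<sigma>' \<Longrightarrow> 0 < d \<Longrightarrow> d \<le> da \<Longrightarrow> 0 < T \<Longrightarrow> T \<le> Ta \<Longrightarrow>
         \<bar>flux f \<sigma>' T - T * godunov_value f a1 a2\<bar> \<le> e * T + Ca * d"
      by (rule edge_flux[OF \<alpha> init e]) (rule that)
    obtain Tb db Cb where b: "0 < Tb" "0 < db" "0 \<le> Cb"
      "\<And>T d \<sigma> \<sigma>'. step_profile \<beta> d \<sigma> \<sigma>' \<Longrightarrow> 0 < d \<Longrightarrow> d \<le> db \<Longrightarrow> 0 < T \<Longrightarrow> T \<le> Tb \<Longrightarrow>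
         \<bar>flux f \<sigma>' T - T * godunov_value f b1 b2\<bar> \<le> e * T + Cb * d"
      by (rule edge_flux[OF \<beta> init e]) (rule that)
    have "dist ((?Q T - ?F T) / T) ?G < r" if T: "0 < T" "T < min Ta Tb" for T
    proof -
      have mono: "Ca * d \<le> max Ca Cb * d" "Cb * d \<le> max Ca Cb * d" if "0 < d" for d
        using that by (auto intro!: mult_right_mono)
      have "\<bar>?Q T - ?F T - T * ?G\<bar> \<le> (\<bar>g \<alpha>\<bar> + \<bar>g \<beta>\<bar>) * e * T"
      proof (rule cell_flux_estimate[OF ab g _ _ T(1), of "min da db" _ e "max Ca Cb"])
        show "\<bar>flux f \<sigma>' T - T * godunov_value f a1 a2\<bar> \<le> e * T + max Ca Cb * d"
          if "step_profile \<alpha> d \<sigma> \<sigma>'" "0 < d" "d \<le> min da db" for d \<sigma> \<sigma>'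
        proof -
          have "\<bar>flux f \<sigma>' T - T * godunov_value f a1 a2\<bar> \<le> e * T + Ca * d"
            by (rule a(4)[OF that(1,2) _ T(1)]) (use that(3) T(2) in auto)
          then show ?thesis using mono(1)[OF that(2)] by linarith
        qed
        show "\<bar>flux f \<sigma>' T - T * godunov_value f b1 b2\<bar> \<le> e * T + max Ca Cb * d"
          if "step_profile \<beta> d \<sigma> \<sigma>'" "0 < d" "d \<le> min da db" for d \<sigma> \<sigma>'
        proof -
          have "\<bar>flux f \<sigma>' T - T * godunov_value f b1 b2\<bar> \<le> e * T + Cb * d"
            by (rule b(4)[OF that(1,2) _ T(1)]) (use that(3) T(2) in auto)
          then show ?thesis using mono(2)[OF that(2)] by linarith
        qed
      qed (use a(2) b(2) in auto)
      also have "\<dots> < S * e * T" using e T by (simp add: S_def)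
      also have "S * e = r" using S by (simp add: e_def)
      finally have "\<bar>?Q T - ?F T - T * ?G\<bar> < r * T" .
      also have "?Q T - ?F T - T * ?G = T * ((?Q T - ?F T) / T - ?G)" using T by (simp add: field_simps)
      also have "\<bar>\<dots>\<bar> = \<bar>(?Q T - ?F T) / T - ?G\<bar> * T" using T by (simp add: abs_mult)
      finally show ?thesis using T by (simp add: dist_real_def)
    qed
    then show "\<forall>\<^sub>F T in at_right 0. dist ((?Q T - ?F T) / T) ?G < r"
      unfolding eventually_at_right_field using a(1) b(1)
      by (intro exI[of _ "min Ta Tb"] conjI allI impI) simp_all
  qed
  show ?thesis using tendsto_add[OF 1 2] by (simp add: diff_divide_distrib)
qed

end

section \<open>Polynomials on one cell\<close>

definition moment :: "real \<Rightarrow> real \<Rightarrow> (real \<Rightarrow> real) \<Rightarrow> real poly \<Rightarrow> real" where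
  "moment \<alpha> \<beta> h p = (LINT y:{\<alpha>..\<beta>}|lborel. h y * poly p y)"

definition essentially_bounded :: "(real \<Rightarrow> real) \<Rightarrow> bool" where
  "essentially_bounded h \<longleftrightarrow> h \<in> borel_measurable borel \<and> (\<exists>C. AE y in lborel. \<bar>h y\<bar> \<le> C)"

lemma poly_bounded_on_interval:
  fixes p :: "real poly"
  obtains C where "0 \<le> C" "\<And>y. y \<in> {\<alpha>..\<beta>} \<Longrightarrow> \<bar>poly p y\<bar> \<le> C"
  by (rule continuous_on_compact_bounded[OF compact_Icc continuous_on_poly[OF continuous_on_id]]) (rule that)

lemma poly_borel_measurable [measurable]: "poly p \<in> borel_measurable borel" for p :: "real poly"
  by (rule borel_measurable_continuous_onI) (intro continuous_intros)

lemma essentially_bounded_set_integrable: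
  assumes h: "essentially_bounded h" and A: "A \<in> sets borel" "A \<subseteq> {\<alpha>..\<beta>}"
  shows "set_integrable lborel A (\<lambda>y. h y * poly p y)"
proof -
  obtain C where C: "AE y in lborel. \<bar>h y\<bar> \<le> C" and [measurable]: "h \<in> borel_measurable borel"
    using h unfolding essentially_bounded_def by blast
  obtain D where D: "0 \<le> D" "\<And>y. y \<in> {\<alpha>..\<beta>} \<Longrightarrow> \<bar>poly p y\<bar> \<le> D"
    by (rule poly_bounded_on_interval[of \<alpha> \<beta> p]) (rule that)
  note [measurable] = A(1)
  show ?thesis
    unfolding set_integrable_def
  proof (rule Bochner_Integration.integrable_bound[of _ "\<lambda>y. \<bar>C\<bar> * D * indicator {\<alpha>..\<beta>} y"])
    show "integrable lborel (\<lambda>y. \<bar>C\<bar> * D * indicator {\<alpha>..\<beta>} y :: real)" by (rule integrable_const_indicator_interval)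
    show "AE y in lborel. norm (indicator A y *\<^sub>R (h y * poly p y)) \<le> norm (\<bar>C\<bar> * D * indicator {\<alpha>..\<beta>} y)"
      using C
    proof eventually_elim
      case (elim y)
      show ?case
      proof (cases "y \<in> A")
        case True
        then have y: "y \<in> {\<alpha>..\<beta>}" using A by blast
        have "\<bar>h y\<bar> * \<bar>poly p y\<bar> \<le> \<bar>C\<bar> * D" using elim D(2)[OF y] by (intro mult_mono) auto
        then show ?thesis using True y D(1) by (simp add: abs_mult)
      qed simp
    qed
  qed measurable
qed

lemma moment_integrable:
  "essentially_bounded h \<Longrightarrow> set_integrable lborel {\<alpha>..\<beta>} (\<lambda>y. h y * poly p y)"
  by (rule essentially_bounded_set_integrable) auto

lemma moment_add: "essentially_bounded h \<Longrightarrow> moment \<alpha> \<beta> h (p + q) = moment \<alpha> \<beta> h p + moment \<alpha> \<beta> h q"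
  unfolding moment_def using moment_integrable[of h \<alpha> \<beta> p] moment_integrable[of h \<alpha> \<beta> q]
  by (simp add: distrib_left set_integral_add)

lemma moment_smult: "moment \<alpha> \<beta> h (smult c p) = c * moment \<alpha> \<beta> h p"
  unfolding moment_def by (simp add: mult.left_commute[of _ c])

definition inner_poly :: "real \<Rightarrow> real \<Rightarrow> real poly \<Rightarrow> real poly \<Rightarrow> real" where
  "inner_poly \<alpha> \<beta> p q = (LINT y:{\<alpha>..\<beta>}|lborel. poly p y * poly q y)"

lemma inner_poly_integrable: "set_integrable lborel {\<alpha>..\<beta>} (\<lambda>y. poly p y * poly q y)"
  for p q :: "real poly"
  by (rule borel_integrable_atLeastAtMost') (intro continuous_intros)

lemma inner_poly_sym: "inner_poly \<alpha> \<beta> p q = inner_poly \<alpha> \<beta> q p"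
  by (simp add: inner_poly_def mult.commute)

lemma inner_poly_add: "inner_poly \<alpha> \<beta> p (q + r) = inner_poly \<alpha> \<beta> p q + inner_poly \<alpha> \<beta> p r"
  unfolding inner_poly_def using inner_poly_integrable[of \<alpha> \<beta> p q] inner_poly_integrable[of \<alpha> \<beta> p r]
  by (simp add: distrib_left set_integral_add)

lemma inner_poly_smult: "inner_poly \<alpha> \<beta> p (smult c q) = c * inner_poly \<alpha> \<beta> p q"
  unfolding inner_poly_def by (simp add: mult.left_commute[of _ c])

lemma inner_poly_add_left: "inner_poly \<alpha> \<beta> (p + q) r = inner_poly \<alpha> \<beta> p r + inner_poly \<alpha> \<beta> q r"
  unfolding inner_poly_sym[of \<alpha> \<beta> _ r] by (rule inner_poly_add)

lemma inner_poly_smult_left: "inner_poly \<alpha> \<beta> (smult c p) q = c * inner_poly \<alpha> \<beta> p q"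
  unfolding inner_poly_sym[of \<alpha> \<beta> _ q] by (rule inner_poly_smult)

lemma inner_poly_pos:
  assumes "\<alpha> < \<beta>" "p \<noteq> 0"
  shows "0 < inner_poly \<alpha> \<beta> p p"
proof -
  let ?g = "\<lambda>y. indicator {\<alpha>..\<beta>} y * (poly p y * poly p y)"
  have i: "integrable lborel ?g" using inner_poly_integrable[of \<alpha> \<beta> p p] by (simp add: set_integrable_def)
  have nn: "AE y in lborel. 0 \<le> ?g y" by simp
  have eq: "inner_poly \<alpha> \<beta> p p = integral\<^sup>L lborel ?g"
    by (simp add: inner_poly_def set_lebesgue_integral_def)
  have "integral\<^sup>L lborel ?g \<noteq> 0"
  proof
    assume "integral\<^sup>L lborel ?g = 0"
    then have "AE y in lborel. ?g y = 0" using integral_nonneg_eq_0_iff_AE[OF i nn] by blast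
    moreover have "AE y in lborel. y \<notin> {y. poly p y = 0}"
      by (rule AE_not_in, rule finite_imp_null_set_lborel, rule poly_roots_finite, rule assms(2))
    ultimately have "AE y in lborel. y \<notin> {\<alpha>..\<beta>}" by eventually_elim (auto simp: indicator_def)
    then have "{\<alpha>..\<beta>} \<in> null_sets lborel" by (subst AE_iff_null_sets) simp_all
    then have "emeasure lborel {\<alpha>..\<beta>} = 0" by (rule null_setsD1)
    then show False using assms(1) by simp
  qed
  moreover have "0 \<le> integral\<^sup>L lborel ?g" by (rule integral_nonneg_AE[OF nn])
  ultimately show ?thesis using eq by linarith
qed

lemma linear_sum_smult:
  fixes l :: "real poly \<Rightarrow> real"
  assumes "\<And>p q. l (p + q) = l p + l q" "\<And>c p. l (smult c p) = c * l p"
  shows "l (\<Sum>i\<in>A. smult (c i) (e i)) = (\<Sum>i\<in>A. c i * l (e i))"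
proof -
  have "l 0 = 0" using assms(2)[of 0 0] by simp
  then show ?thesis by (induction A rule: infinite_finite_induct) (auto simp: assms)
qed

text \<open>
  The expansion property of an orthonormal basis.  Together with the symmetry of the inner product it
  is all that representing functionals takes.
\<close>

definition expansion_basis :: "real \<Rightarrow> real \<Rightarrow> nat \<Rightarrow> (nat \<Rightarrow> real poly) \<Rightarrow> bool" where
  "expansion_basis \<alpha> \<beta> k e \<longleftrightarrow> (\<forall>i\<le>k. degree (e i) \<le> k) \<and>
     (\<forall>p. degree p \<le> k \<longrightarrow> p = (\<Sum>i\<le>k. smult (inner_poly \<alpha> \<beta> p (e i)) (e i)))"

text \<open>
  The Riesz representer of the functional \<open>l\<close> on polynomials of degree at most \<open>k\<close>.
\<close>

definition representer :: "nat \<Rightarrow> (nat \<Rightarrow> real poly) \<Rightarrow> (real poly \<Rightarrow> real) \<Rightarrow> real poly" where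
  "representer k e l = (\<Sum>i\<le>k. smult (l (e i)) (e i))"

lemma representer_degree: "expansion_basis \<alpha> \<beta> k e \<Longrightarrow> degree (representer k e l) \<le> k"
  unfolding representer_def expansion_basis_def
  by (intro degree_sum_le) (auto intro: order_trans[OF degree_smult_le])

lemma inner_representer:
  assumes e: "expansion_basis \<alpha> \<beta> k e"
    and l: "\<And>p q. l (p + q) = l p + l q" "\<And>c p. l (smult c p) = c * l p" and v: "degree v \<le> k"
  shows "inner_poly \<alpha> \<beta> (representer k e l) v = l v"
proof -
  have "inner_poly \<alpha> \<beta> (representer k e l) v = inner_poly \<alpha> \<beta> v (representer k e l)" by (rule inner_poly_sym)
  also have "\<dots> = (\<Sum>i\<le>k. l (e i) * inner_poly \<alpha> \<beta> v (e i))"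
    unfolding representer_def by (rule linear_sum_smult) (rule inner_poly_add inner_poly_smult)+
  also have "\<dots> = (\<Sum>i\<le>k. inner_poly \<alpha> \<beta> v (e i) * l (e i))" by (simp add: mult.commute)
  also have "\<dots> = l (\<Sum>i\<le>k. smult (inner_poly \<alpha> \<beta> v (e i)) (e i))" by (rule linear_sum_smult[symmetric, OF l])
  also have "(\<Sum>i\<le>k. smult (inner_poly \<alpha> \<beta> v (e i)) (e i)) = v" using e v unfolding expansion_basis_def by metis
  finally show ?thesis .
qed

lemma representer_unique:
  assumes e: "expansion_basis \<alpha> \<beta> k e" and p: "degree p \<le> k"
    and "\<And>v. degree v \<le> k \<Longrightarrow> inner_poly \<alpha> \<beta> p v = l v"
  shows "p = representer k e l"
proof -
  have "p = (\<Sum>i\<le>k. smult (inner_poly \<alpha> \<beta> p (e i)) (e i))" using e p unfolding expansion_basis_def by blast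
  also have "\<dots> = representer k e l"
    unfolding representer_def using assms(3) e by (intro sum.cong) (auto simp: expansion_basis_def)
  finally show ?thesis .
qed

text \<open>
  One step of the Gram-Schmidt process per degree.  The projection of the next monomial is the representer of
  its inner products, so the orthogonality of the earlier basis polynomials is never spelled out.
\<close>

lemma expansion_basis_exists:
  assumes ab: "\<alpha> < \<beta>"
  shows "\<exists>e. expansion_basis \<alpha> \<beta> k e"
proof (induction k)
  case 0
  let ?c = "1 / sqrt (\<beta> - \<alpha>)"
  have "p = smult (inner_poly \<alpha> \<beta> p [:?c:]) [:?c:]" if "degree p \<le> 0" for p
  proof -
    have "degree p = 0" using that by simp
    then obtain a where p: "p = [:a:]" by (rule degree_eq_zeroE)
    have "inner_poly \<alpha> \<beta> p [:?c:] = a * ?c * (\<beta> - \<alpha>)"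
      using ab by (simp add: p inner_poly_def set_lebesgue_integral_def)
    moreover have "?c * (\<beta> - \<alpha>) * ?c = 1" using ab by (simp add: field_simps)
    ultimately show ?thesis by (simp add: p)
  qed
  then have "expansion_basis \<alpha> \<beta> 0 (\<lambda>_. [:?c:])" unfolding expansion_basis_def by simp
  then show ?case by blast
next
  case (Suc k)
  then obtain e where e: "expansion_basis \<alpha> \<beta> k e" by blast
  let ?ip = "inner_poly \<alpha> \<beta>"
  define P where "P = representer k e (?ip (monom 1 (Suc k)))"
  define q where "q = monom 1 (Suc k) - P"
  have dP: "degree P \<le> k" unfolding P_def by (rule representer_degree[OF e])
  have cq: "coeff q (Suc k) = 1" using dP by (simp add: q_def coeff_eq_0)
  have dq: "degree q \<le> Suc k"
    unfolding q_def using dP by (intro degree_diff_le) (auto simp: degree_monom_eq)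
  have q0: "q \<noteq> 0" using cq by auto
  have orth: "?ip q v = 0" if "degree v \<le> k" for v
  proof -
    have "?ip P v = ?ip (monom 1 (Suc k)) v"
      unfolding P_def by (rule inner_representer[OF e _ _ that]) (rule inner_poly_add inner_poly_smult)+
    moreover have "?ip (monom 1 (Suc k)) v = ?ip q v + ?ip P v"
      using inner_poly_add_left[of \<alpha> \<beta> q P v] by (simp add: q_def)
    ultimately show ?thesis by simp
  qed
  define n where "n = ?ip q q"
  have n: "0 < n" unfolding n_def by (rule inner_poly_pos[OF ab q0])
  define e' where "e' = e(Suc k := smult (1 / sqrt n) q)"
  have "p = (\<Sum>i\<le>Suc k. smult (?ip p (e' i)) (e' i))" if p: "degree p \<le> Suc k" for p
  proof -
    define c where "c = coeff p (Suc k)"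
    define r where "r = p - smult c q"
    have dr: "degree r \<le> k"
    proof (rule degree_le, intro allI impI)
      fix i assume "k < i"
      then consider "i = Suc k" | "Suc k < i" by linarith
      then show "coeff r i = 0"
        using cq p dq by cases (auto simp: r_def c_def coeff_eq_0)
    qed
    have pr: "p = r + smult c q" by (simp add: r_def)
    have ipe: "?ip p v = ?ip r v" if "degree v \<le> k" for v
      unfolding pr inner_poly_add_left inner_poly_smult_left orth[OF that] by simp
    have ipq: "?ip p q = c * n"
      unfolding pr inner_poly_add_left inner_poly_smult_left inner_poly_sym[of \<alpha> \<beta> r q] orth[OF dr] n_def by simp
    have "(\<Sum>i\<le>k. smult (?ip p (e' i)) (e' i)) = (\<Sum>i\<le>k. smult (?ip r (e i)) (e i))"
      using e ipe by (intro sum.cong) (auto simp: e'_def expansion_basis_def)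
    also have "\<dots> = r" using e dr unfolding expansion_basis_def by metis
    finally have 1: "(\<Sum>i\<le>k. smult (?ip p (e' i)) (e' i)) = r" .
    have "smult (?ip p (e' (Suc k))) (e' (Suc k)) = smult (1 / sqrt n * (c * n) * (1 / sqrt n)) q"
      by (simp add: e'_def inner_poly_smult ipq)
    also have "1 / sqrt n * (c * n) * (1 / sqrt n) = c" using n by (simp add: field_simps)
    finally show ?thesis using 1 pr by simp
  qed
  moreover have "\<forall>i\<le>Suc k. degree (e' i) \<le> Suc k"
    using e dq unfolding e'_def expansion_basis_def by (auto intro: order_trans[OF degree_smult_le] simp: le_Suc_eq)
  ultimately have "expansion_basis \<alpha> \<beta> (Suc k) e'" unfolding expansion_basis_def by blast
  then show ?case by blast
qed

section \<open>Piecewise polynomials\<close>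

text \<open>
  The canonical form of an element of the discontinuous Galerkin space; \<open>P j\<close> is its polynomial on
  the cell \<open>[x (j - 1), x j)\<close>.
\<close>

definition piecewise :: "(nat \<Rightarrow> real) \<Rightarrow> nat \<Rightarrow> (nat \<Rightarrow> real poly) \<Rightarrow> real \<Rightarrow> real" where
  "piecewise x N P y = (\<Sum>j\<in>{1..N}. indicator {x (j - 1)..<x j} y * poly (P j) y)"

lemma mesh_le:
  assumes "mesh x N" "i \<le> j" "j \<le> N"
  shows "x i \<le> x j"
  using assms(2,3)
proof (induction j rule: dec_induct)
  case (step n)
  then have "x n < x (Suc n)" using assms(1) by (auto simp: mesh_def)
  then show ?case using step by simp
qed simp

lemma mesh_less: "mesh x N \<Longrightarrow> j \<in> {1..N} \<Longrightarrow> x (j - 1) < x j"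
  unfolding mesh_def by (cases j) auto

lemma mesh_cell:
  assumes "mesh x N" "y \<in> {x 0..<x N}"
  obtains j where "j \<in> {1..N}" "y \<in> {x (j - 1)..<x j}"
proof -
  define j where "j = (LEAST j. y < x j)"
  have 1: "y < x j" unfolding j_def by (rule LeastI[of _ N]) (use assms in auto)
  have 2: "j \<le> N" unfolding j_def by (rule Least_le) (use assms in auto)
  have "j \<noteq> 0" using 1 assms(2) by (intro notI) auto
  then have "\<not> y < x (j - 1)" unfolding j_def by (intro not_less_Least) auto
  then show thesis using that[of j] 1 2 \<open>j \<noteq> 0\<close> by auto
qed

lemma piecewise_eq:
  assumes "mesh x N" "j \<in> {1..N}" "y \<in> {x (j - 1)..<x j}"
  shows "piecewise x N P y = poly (P j) y"
proof -
  have "indicator {x (i - 1)..<x i} y * poly (P i) y = (if i = j then poly (P j) y else 0)" if "i \<in> {1..N}" for i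
  proof (cases i j rule: linorder_cases)
    case less
    then have "x i \<le> x (j - 1)" using assms(2) by (intro mesh_le[OF assms(1)]) auto
    then show ?thesis using assms(3) less by (auto simp: indicator_def)
  next
    case greater
    then have "x j \<le> x (i - 1)" using that by (intro mesh_le[OF assms(1)]) auto
    then show ?thesis using assms(3) greater by (auto simp: indicator_def)
  qed (use assms(3) in simp)
  then have "piecewise x N P y = (\<Sum>i\<in>{1..N}. if i = j then poly (P j) y else 0)"
    unfolding piecewise_def by (rule sum.cong[OF refl])
  also have "\<dots> = poly (P j) y" using assms(2) by (simp add: sum.delta)
  finally show ?thesis .
qed

lemma piecewise_outside:
  assumes "mesh x N" "y \<notin> {x 0..<x N}"
  shows "piecewise x N P y = 0"
proof -
  have "indicator {x (i - 1)..<x i} y * poly (P i) y = 0" if "i \<in> {1..N}" for i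
  proof -
    have "x 0 \<le> x (i - 1)" "x i \<le> x N" using that by (auto intro!: mesh_le[OF assms(1)])
    then show ?thesis using assms(2) by (auto simp: indicator_def)
  qed
  then show ?thesis unfolding piecewise_def by (intro sum.neutral) blast
qed

lemma dg_space_iff:
  assumes m: "mesh x N"
  shows "v \<in> dg_space x N k \<longleftrightarrow> (\<exists>P. (\<forall>j\<in>{1..N}. degree (P j) \<le> k) \<and> v = piecewise x N P)"
proof
  assume v: "v \<in> dg_space x N k"
  then obtain P where P: "\<And>j. j \<in> {1..N} \<Longrightarrow> degree (P j) \<le> k \<and> (\<forall>y\<in>{x (j - 1)..<x j}. v y = poly (P j) y)"
    unfolding dg_space_def mem_Collect_eq by metis
  have "v y = piecewise x N P y" for y
  proof (cases "y \<in> {x 0..<x N}")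
    case True
    obtain j where "j \<in> {1..N}" "y \<in> {x (j - 1)..<x j}" by (rule mesh_cell[OF m True]) (rule that)
    then show ?thesis using P piecewise_eq[OF m] by metis
  next
    case False
    then show ?thesis using v piecewise_outside[OF m False] by (auto simp: dg_space_def)
  qed
  then show "\<exists>P. (\<forall>j\<in>{1..N}. degree (P j) \<le> k) \<and> v = piecewise x N P" using P by blast
next
  assume "\<exists>P. (\<forall>j\<in>{1..N}. degree (P j) \<le> k) \<and> v = piecewise x N P"
  then show "v \<in> dg_space x N k"
    unfolding dg_space_def using piecewise_eq[OF m] piecewise_outside[OF m] by blast
qed

lemma piecewise_cong: "(\<And>j. j \<in> {1..N} \<Longrightarrow> P j = Q j) \<Longrightarrow> piecewise x N P = piecewise x N Q"
  unfolding piecewise_def fun_eq_iff by (auto intro!: sum.cong)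

lemma set_integral_piecewise_cell:
  assumes m: "mesh x N" and j: "j \<in> {1..N}"
  shows "(LINT y:{x (j - 1)..x j}|lborel. h y * piecewise x N P y) = moment (x (j - 1)) (x j) h (P j)"
  unfolding moment_def set_lebesgue_integral_def
  by (rule integral_discrete_difference[of "{x j}"])
     (use piecewise_eq[OF m j] in \<open>auto simp: indicator_def\<close>)

lemma set_integral_piecewise:
  assumes m: "mesh x N" and h: "essentially_bounded h"
  shows "(LINT y:{x 0..x N}|lborel. h y * piecewise x N P y) = (\<Sum>j\<in>{1..N}. moment (x (j - 1)) (x j) h (P j))"
proof -
  have "(LINT y:{x 0..x N}|lborel. h y * piecewise x N P y)
      = (LINT y|lborel. (\<Sum>j\<in>{1..N}. indicator {x (j - 1)..<x j} y *\<^sub>R (h y * poly (P j) y)))"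
    unfolding set_lebesgue_integral_def
  proof (rule Bochner_Integration.integral_cong)
    fix y
    have "indicator {x 0..x N} y *\<^sub>R (h y * piecewise x N P y) = h y * piecewise x N P y"
    proof (cases "y \<in> {x 0..<x N}")
      case False
      then show ?thesis using piecewise_outside[OF m False] by simp
    qed auto
    also have "\<dots> = (\<Sum>j\<in>{1..N}. indicator {x (j - 1)..<x j} y *\<^sub>R (h y * poly (P j) y))"
      unfolding piecewise_def sum_distrib_left by (intro sum.cong) auto
    finally show "indicator {x 0..x N} y *\<^sub>R (h y * piecewise x N P y)
        = (\<Sum>j\<in>{1..N}. indicator {x (j - 1)..<x j} y *\<^sub>R (h y * poly (P j) y))" .
  qed simp
  also have "\<dots> = (\<Sum>j\<in>{1..N}. (LINT y|lborel. indicator {x (j - 1)..<x j} y *\<^sub>R (h y * poly (P j) y)))"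
  proof (rule Bochner_Integration.integral_sum)
    fix j
    show "integrable lborel (\<lambda>y. indicator {x (j - 1)..<x j} y *\<^sub>R (h y * poly (P j) y))"
      using essentially_bounded_set_integrable[OF h, of "{x (j - 1)..<x j}" "x (j - 1)" "x j" "P j"]
      by (simp add: set_integrable_def atLeastLessThan_subseteq_atLeastAtMost_iff)
  qed
  also have "\<dots> = (\<Sum>j\<in>{1..N}. moment (x (j - 1)) (x j) h (P j))"
  proof (rule sum.cong)
    fix j
    show "(LINT y|lborel. indicator {x (j - 1)..<x j} y *\<^sub>R (h y * poly (P j) y)) = moment (x (j - 1)) (x j) h (P j)"
      unfolding moment_def set_lebesgue_integral_def
      by (rule integral_discrete_difference[of "{x j}"]) (auto simp: indicator_def)
  qed simp
  finally show ?thesis .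
qed

lemma piecewise_measurable [measurable]: "piecewise x N P \<in> borel_measurable borel"
  unfolding piecewise_def[abs_def] by measurable

lemma piecewise_bounded:
  obtains C where "0 \<le> C" "\<And>y. \<bar>piecewise x N P y\<bar> \<le> C"
proof -
  have "\<exists>C. 0 \<le> C \<and> (\<forall>y\<in>{x (j - 1)..x j}. \<bar>poly (P j) y\<bar> \<le> C)" for j
    using poly_bounded_on_interval[of "x (j - 1)" "x j" "P j"] by metis
  then obtain C where C: "\<And>j. 0 \<le> C j" "\<And>j y. y \<in> {x (j - 1)..x j} \<Longrightarrow> \<bar>poly (P j) y\<bar> \<le> C j"
    by metis
  have "\<bar>piecewise x N P y\<bar> \<le> (\<Sum>j\<in>{1..N}. C j)" for y
    unfolding piecewise_def
  proof (rule order_trans[OF sum_abs], rule sum_mono)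
    fix j show "\<bar>indicator {x (j - 1)..<x j} y * poly (P j) y\<bar> \<le> C j"
      using C(1)[of j] C(2)[of y j] by (auto simp: indicator_def)
  qed
  then show thesis using C(1) by (intro that[of "\<Sum>j\<in>{1..N}. C j"] sum_nonneg) auto
qed

lemma essentially_bounded_piecewise: "essentially_bounded (piecewise x N P)"
proof -
  obtain C where "\<And>y. \<bar>piecewise x N P y\<bar> \<le> C" by (rule piecewise_bounded[of x N P]) (rule that)
  then show ?thesis unfolding essentially_bounded_def by auto
qed

lemma moment_piecewise:
  assumes m: "mesh x N" and j: "j \<in> {1..N}"
  shows "moment (x (j - 1)) (x j) (piecewise x N P) q = inner_poly (x (j - 1)) (x j) (P j) q"
  unfolding moment_def inner_poly_def set_lebesgue_integral_def
  by (rule integral_discrete_difference[of "{x j}"])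
     (use piecewise_eq[OF m j] in \<open>auto simp: indicator_def\<close>)

section \<open>The projection and the right-hand side in coordinates\<close>

text \<open>
  Test functions supported on one cell decouple the cells, and on each cell the defining equations say
  that the polynomial represents the moments of \<open>h\<close>.
\<close>

lemma L2_projection_eq:
  assumes m: "mesh x N" and h: "essentially_bounded h"
    and e: "\<And>j. j \<in> {1..N} \<Longrightarrow> expansion_basis (x (j - 1)) (x j) k (e j)"
  shows "L2_projection x N k h = piecewise x N (\<lambda>j. representer k (e j) (moment (x (j - 1)) (x j) h))"
    (is "_ = piecewise x N ?R")
  unfolding L2_projection_def
proof (rule the_equality)
  have "(LINT y:{x 0..x N}|lborel. piecewise x N ?R y * v y) = (LINT y:{x 0..x N}|lborel. h y * v y)"
    if v: "v \<in> dg_space x N k" for v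
  proof -
    obtain Q where Q: "\<And>j. j \<in> {1..N} \<Longrightarrow> degree (Q j) \<le> k" "v = piecewise x N Q"
      using v unfolding dg_space_iff[OF m] by blast
    have "(LINT y:{x 0..x N}|lborel. piecewise x N ?R y * v y)
        = (\<Sum>j\<in>{1..N}. moment (x (j - 1)) (x j) (piecewise x N ?R) (Q j))"
      unfolding Q(2) by (rule set_integral_piecewise[OF m essentially_bounded_piecewise])
    also have "\<dots> = (\<Sum>j\<in>{1..N}. moment (x (j - 1)) (x j) h (Q j))"
    proof (rule sum.cong)
      fix j assume j: "j \<in> {1..N}"
      show "moment (x (j - 1)) (x j) (piecewise x N ?R) (Q j) = moment (x (j - 1)) (x j) h (Q j)"
        unfolding moment_piecewise[OF m j]
        by (rule inner_representer[OF e[OF j] moment_add[OF h] moment_smult Q(1)[OF j]])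
    qed simp
    also have "\<dots> = (LINT y:{x 0..x N}|lborel. h y * v y)"
      unfolding Q(2) by (rule set_integral_piecewise[OF m h, symmetric])
    finally show ?thesis .
  qed
  moreover have "piecewise x N ?R \<in> dg_space x N k"
    unfolding dg_space_iff[OF m]
    by (intro exI[of _ ?R] conjI ballI representer_degree[OF e] refl)
  ultimately show "piecewise x N ?R \<in> dg_space x N k \<and> (\<forall>v\<in>dg_space x N k.
      (LINT y:{x 0..x N}|lborel. piecewise x N ?R y * v y) = (LINT y:{x 0..x N}|lborel. h y * v y))" by blast
next
  fix p
  assume p: "p \<in> dg_space x N k \<and> (\<forall>v\<in>dg_space x N k.
      (LINT y:{x 0..x N}|lborel. p y * v y) = (LINT y:{x 0..x N}|lborel. h y * v y))"
  then obtain P where P: "\<And>j. j \<in> {1..N} \<Longrightarrow> degree (P j) \<le> k" "p = piecewise x N P"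
    unfolding dg_space_iff[OF m] by blast
  have "P j = ?R j" if j: "j \<in> {1..N}" for j
  proof (rule representer_unique[OF e[OF j] P(1)[OF j]])
    fix q :: "real poly" assume q: "degree q \<le> k"
    let ?Q = "\<lambda>i. if i = j then q else 0"
    have "piecewise x N ?Q \<in> dg_space x N k" unfolding dg_space_iff[OF m] using q by (intro exI[of _ ?Q]) auto
    then have "(LINT y:{x 0..x N}|lborel. p y * piecewise x N ?Q y) = (LINT y:{x 0..x N}|lborel. h y * piecewise x N ?Q y)"
      using p by blast
    then have "(\<Sum>i\<in>{1..N}. moment (x (i - 1)) (x i) p (?Q i)) = (\<Sum>i\<in>{1..N}. moment (x (i - 1)) (x i) h (?Q i))"
      using set_integral_piecewise[OF m h, of ?Q] set_integral_piecewise[OF m essentially_bounded_piecewise[of x N P], of ?Q]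
      by (simp add: P(2))
    moreover have "moment (x (i - 1)) (x i) g (?Q i) = (if i = j then moment (x (j - 1)) (x j) g q else 0)" for g i
      using moment_smult[of "x (i - 1)" "x i" g 0 0] by simp
    ultimately have "moment (x (j - 1)) (x j) p q = moment (x (j - 1)) (x j) h q"
      using j by (simp add: sum.delta)
    then show "inner_poly (x (j - 1)) (x j) (P j) q = moment (x (j - 1)) (x j) h q"
      unfolding P(2) moment_piecewise[OF m j] .
  qed
  then show "p = piecewise x N ?R" unfolding P(2) by (rule piecewise_cong)
qed

lemma tendsto_at_left_agree:
  fixes g k :: "real \<Rightarrow> real"
  assumes "a' < a" "\<And>y. a' < y \<Longrightarrow> y < a \<Longrightarrow> g y = k y" "isCont k a"
  shows "(g \<longlongrightarrow> k a) (at_left a)"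
proof (rule Lim_transform_eventually)
  show "(k \<longlongrightarrow> k a) (at_left a)" using assms(3) unfolding isCont_def by (rule tendsto_within_subset) simp
  show "\<forall>\<^sub>F y in at_left a. k y = g y" unfolding eventually_at_left_field using assms by (intro exI[of _ a']) auto
qed

lemma tendsto_at_right_agree:
  fixes g k :: "real \<Rightarrow> real"
  assumes "a < a'" "\<And>y. a < y \<Longrightarrow> y < a' \<Longrightarrow> g y = k y" "isCont k a"
  shows "(g \<longlongrightarrow> k a) (at_right a)"
proof (rule Lim_transform_eventually)
  show "(k \<longlongrightarrow> k a) (at_right a)" using assms(3) unfolding isCont_def by (rule tendsto_within_subset) simp
  show "\<forall>\<^sub>F y in at_right a. k y = g y" unfolding eventually_at_right_field using assms by (intro exI[of _ a']) auto
qed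

lemma trace_left_eq: "(v \<longlongrightarrow> l) (at_left z) \<Longrightarrow> trace_left v z = l" for z :: real
  unfolding trace_left_def by (rule tendsto_Lim) simp_all

lemma trace_right_eq: "(v \<longlongrightarrow> l) (at_right z) \<Longrightarrow> trace_right v z = l" for z :: real
  unfolding trace_right_def by (rule tendsto_Lim) simp_all

lemma piecewise_at_left:
  assumes m: "mesh x N" and j: "j \<in> {1..N}"
  shows "(piecewise x N P \<longlongrightarrow> poly (P j) (x j)) (at_left (x j))"
  by (rule tendsto_at_left_agree[OF mesh_less[OF m j]]) (use piecewise_eq[OF m j] in auto)

lemma piecewise_at_right:
  assumes m: "mesh x N" and j: "j \<in> {1..N}"
  shows "(piecewise x N P \<longlongrightarrow> poly (P j) (x (j - 1))) (at_right (x (j - 1)))"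
  by (rule tendsto_at_right_agree[OF mesh_less[OF m j]]) (use piecewise_eq[OF m j] in auto)

lemma deriv_piecewise:
  assumes m: "mesh x N" and j: "j \<in> {1..N}" and y: "x (j - 1) < y" "y < x j"
  shows "deriv (piecewise x N P) y = poly (pderiv (P j)) y"
proof (rule DERIV_imp_deriv, rule has_field_derivative_transform_within_open[OF poly_DERIV])
  show "open {x (j - 1)<..<x j}" by simp
qed (use piecewise_eq[OF m j] y in auto)

text \<open>
  The right-hand side of the method on one cell, as a functional of the test polynomial: \<open>g\<close> is \<open>f(u)\<close>,
  and \<open>G\<alpha>\<close>, \<open>G\<beta>\<close> are the numerical fluxes at the edges.
\<close>

definition cell_rhs :: "real \<Rightarrow> real \<Rightarrow> (real \<Rightarrow> real) \<Rightarrow> real \<Rightarrow> real \<Rightarrow> real poly \<Rightarrow> real" where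
  "cell_rhs \<alpha> \<beta> g G\<alpha> G\<beta> q = moment \<alpha> \<beta> g (pderiv q) - G\<beta> * poly q \<beta> + G\<alpha> * poly q \<alpha>"

lemma cell_rhs_linear:
  assumes "essentially_bounded g"
  shows "cell_rhs \<alpha> \<beta> g G\<alpha> G\<beta> (p + q) = cell_rhs \<alpha> \<beta> g G\<alpha> G\<beta> p + cell_rhs \<alpha> \<beta> g G\<alpha> G\<beta> q"
    and "cell_rhs \<alpha> \<beta> g G\<alpha> G\<beta> (smult c p) = c * cell_rhs \<alpha> \<beta> g G\<alpha> G\<beta> p"
  unfolding cell_rhs_def by (simp_all add: pderiv_add pderiv_smult moment_add[OF assms] moment_smult algebra_simps)

lemma dg_rhs_eq:
  assumes m: "mesh x N" and g: "essentially_bounded (\<lambda>y. f (u y))"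
    and e: "\<And>j. j \<in> {1..N} \<Longrightarrow> expansion_basis (x (j - 1)) (x j) k (e j)"
  shows "dg_rhs bc x N k f fhat u = piecewise x N (\<lambda>j. representer k (e j)
      (cell_rhs (x (j - 1)) (x j) (\<lambda>y. f (u y)) (interface_flux bc x N fhat u (j - 1)) (interface_flux bc x N fhat u j)))"
    (is "_ = piecewise x N ?R")
proof -
  let ?l = "\<lambda>j. cell_rhs (x (j - 1)) (x j) (\<lambda>y. f (u y)) (interface_flux bc x N fhat u (j - 1)) (interface_flux bc x N fhat u j)"
  have rhs: "(LINT y:{x (j - 1)..x j}|lborel. f (u y) * deriv v y)
             - interface_flux bc x N fhat u j * trace_left v (x j)
             + interface_flux bc x N fhat u (j - 1) * trace_right v (x (j - 1)) = ?l j (Q j)"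
    if v: "v = piecewise x N Q" and j: "j \<in> {1..N}" for v Q j
  proof -
    have "(LINT y:{x (j - 1)..x j}|lborel. f (u y) * deriv v y) = moment (x (j - 1)) (x j) (\<lambda>y. f (u y)) (pderiv (Q j))"
      unfolding moment_def set_lebesgue_integral_def
      by (rule integral_discrete_difference[of "{x (j - 1), x j}"])
         (use deriv_piecewise[OF m j] in \<open>auto simp: indicator_def v\<close>)
    moreover have "trace_left v (x j) = poly (Q j) (x j)" unfolding v by (rule trace_left_eq[OF piecewise_at_left[OF m j]])
    moreover have "trace_right v (x (j - 1)) = poly (Q j) (x (j - 1))" unfolding v by (rule trace_right_eq[OF piecewise_at_right[OF m j]])
    ultimately show ?thesis by (simp add: cell_rhs_def)
  qed
  have lhs: "(LINT y:{x (j - 1)..x j}|lborel. piecewise x N P y * v y) = inner_poly (x (j - 1)) (x j) (P j) (Q j)"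
    if v: "v = piecewise x N Q" and j: "j \<in> {1..N}" for v P Q j
    unfolding v set_integral_piecewise_cell[OF m j] by (rule moment_piecewise[OF m j])
  show ?thesis
    unfolding dg_rhs_def
  proof (rule the_equality)
    have "piecewise x N ?R \<in> dg_space x N k"
      unfolding dg_space_iff[OF m]
    by (intro exI[of _ ?R] conjI ballI representer_degree[OF e] refl)
    moreover have "(LINT y:{x (j - 1)..x j}|lborel. piecewise x N ?R y * v y) =
          (LINT y:{x (j - 1)..x j}|lborel. f (u y) * deriv v y)
             - interface_flux bc x N fhat u j * trace_left v (x j)
             + interface_flux bc x N fhat u (j - 1) * trace_right v (x (j - 1))"
      if v: "v \<in> dg_space x N k" and j: "j \<in> {1..N}" for v j
    proof -
      obtain Q where Q: "\<And>j. j \<in> {1..N} \<Longrightarrow> degree (Q j) \<le> k" "v = piecewise x N Q"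
        using v unfolding dg_space_iff[OF m] by blast
      show ?thesis
        unfolding rhs[OF Q(2) j] lhs[OF Q(2) j]
        by (rule inner_representer[OF e[OF j] cell_rhs_linear[OF g] Q(1)[OF j]])
    qed
    ultimately show "piecewise x N ?R \<in> dg_space x N k \<and> (\<forall>v\<in>dg_space x N k. \<forall>j\<in>{1..N}.
        (LINT y:{x (j - 1)..x j}|lborel. piecewise x N ?R y * v y) =
          (LINT y:{x (j - 1)..x j}|lborel. f (u y) * deriv v y)
             - interface_flux bc x N fhat u j * trace_left v (x j)
             + interface_flux bc x N fhat u (j - 1) * trace_right v (x (j - 1)))" by blast
  next
    fix F
    assume F: "F \<in> dg_space x N k \<and> (\<forall>v\<in>dg_space x N k. \<forall>j\<in>{1..N}.
        (LINT y:{x (j - 1)..x j}|lborel. F y * v y) =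
          (LINT y:{x (j - 1)..x j}|lborel. f (u y) * deriv v y)
             - interface_flux bc x N fhat u j * trace_left v (x j)
             + interface_flux bc x N fhat u (j - 1) * trace_right v (x (j - 1)))"
    then obtain P where P: "\<And>j. j \<in> {1..N} \<Longrightarrow> degree (P j) \<le> k" "F = piecewise x N P"
      unfolding dg_space_iff[OF m] by blast
    have "P j = ?R j" if j: "j \<in> {1..N}" for j
    proof (rule representer_unique[OF e[OF j] P(1)[OF j]])
      fix q :: "real poly" assume q: "degree q \<le> k"
      have "piecewise x N (\<lambda>_. q) \<in> dg_space x N k" unfolding dg_space_iff[OF m] using q by (intro exI[of _ "\<lambda>_. q"]) auto
      then have "(LINT y:{x (j - 1)..x j}|lborel. piecewise x N P y * piecewise x N (\<lambda>_. q) y) = ?l j q"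
        using F j unfolding P(2) rhs[OF refl j, of "\<lambda>_. q", symmetric] by blast
      then show "inner_poly (x (j - 1)) (x j) (P j) q = ?l j q"
        unfolding lhs[OF refl j, of P "\<lambda>_. q"] .
    qed
    then show "F = piecewise x N ?R" unfolding P(2) by (rule piecewise_cong)
  qed
qed

section \<open>Extension of the data and passage to the limit\<close>

lemma smooth_locally_lipschitz:
  assumes "smooth f"
  shows "\<exists>L. L-lipschitz_on {-A..A} f"
proof -
  have d: "f differentiable_on UNIV" "deriv f differentiable_on UNIV"
    using assms[unfolded smooth_def, rule_format, of 0] assms[unfolded smooth_def, rule_format, of 1] by simp_all
  have D: "(f has_real_derivative deriv f v) (at v)" for v
    using d(1) by (simp add: differentiable_on_def DERIV_deriv_iff_real_differentiable)
  have "continuous_on {-A..A} (deriv f)"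
    using differentiable_imp_continuous_on[OF d(2)] by (rule continuous_on_subset) simp
  then obtain C where C: "\<And>v. v \<in> {-A..A} \<Longrightarrow> \<bar>deriv f v\<bar> \<le> C"
    by (rule continuous_on_compact_bounded[OF compact_Icc]) blast
  have "(max 0 C)-lipschitz_on {-A..A} f"
  proof (rule lipschitz_onI)
    fix v w assume vw: "v \<in> {-A..A}" "w \<in> {-A..A}"
    have "norm (f v - f w) \<le> max 0 C * norm (v - w)"
    proof (rule field_differentiable_bound[OF _ _ _ vw])
      show "(f has_field_derivative deriv f z) (at z within {-A..A})" for z
        by (rule has_field_derivative_at_within[OF D])
      show "norm (deriv f z) \<le> max 0 C" if "z \<in> {-A..A}" for z using C[OF that] by simp
    qed simp
    then show "dist (f v) (f w) \<le> max 0 C * dist v w" by (simp add: dist_norm)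
  qed simp
  then show ?thesis by blast
qed

lemma extend_inside:
  assumes "y \<in> {a..<b}"
  shows "extend bc a b u y = u y"
proof (cases bc)
  case Periodic
  have "frac ((y - a) / (b - a)) = (y - a) / (b - a)" using assms by (intro frac_eq_id) auto
  then show ?thesis using assms Periodic by simp
qed (use assms in simp)

lemma extend_range: "extend bc a b u y \<in> insert 0 (range u)"
  by (cases bc) auto

lemma extend_measurable:
  assumes [measurable]: "u \<in> borel_measurable borel"
  shows "extend bc a b u \<in> borel_measurable borel"
proof (cases bc)
  case Periodic
  have "(\<lambda>y. u (a + (b - a) * ((y - a) / (b - a) - real_of_int \<lfloor>(y - a) / (b - a)\<rfloor>))) \<in> borel_measurable borel"
    by measurable
  then show ?thesis using Periodic by (simp add: frac_def[abs_def] cong: measurable_cong)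
next
  case Compactly_Supported
  have "(\<lambda>y. if y \<in> {a..<b} then u y else 0) \<in> borel_measurable borel" by measurable
  then show ?thesis using Compactly_Supported by (simp cong: measurable_cong)
qed

text \<open>
  At interior mesh points the traces come from the adjacent cells.  At the two ends of the interval the
  outer trace is that of the opposite end, or zero, according to the boundary condition.
\<close>

lemma extend_one_sided_limits:
  assumes m: "mesh x N" and bc: "satisfies_bc bc (x 0) (x N) (extend bc (x 0) (x N) (piecewise x N P))" and j: "j \<le> N"
  shows "\<exists>l. (extend bc (x 0) (x N) (piecewise x N P) \<longlongrightarrow> l) (at_left (x j))"
    and "\<exists>l. (extend bc (x 0) (x N) (piecewise x N P) \<longlongrightarrow> l) (at_right (x j))"
proof -
  let ?u = "extend bc (x 0) (x N) (piecewise x N P)"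
  have N: "N \<in> {1..N}" "1 \<in> {1..N}" using m by (auto simp: mesh_def)
  have inside: "?u y = poly (P i) y" if "i \<in> {1..N}" "x (i - 1) < y" "y < x i" for i y
  proof -
    have "x 0 \<le> x (i - 1)" "x i \<le> x N" using that(1) by (auto intro!: mesh_le[OF m])
    then show ?thesis using that extend_inside[of y "x 0" "x N" bc] piecewise_eq[OF m that(1), of y] by simp
  qed
  have left: "\<exists>l. (?u \<longlongrightarrow> l) (at_left (x j))" if "j \<noteq> 0"
  proof -
    have j': "j \<in> {1..N}" using that j by auto
    have "(?u \<longlongrightarrow> poly (P j) (x j)) (at_left (x j))"
      by (rule tendsto_at_left_agree[OF mesh_less[OF m j']]) (use inside[OF j'] in auto)
    then show ?thesis by blast
  qed
  have right: "\<exists>l. (?u \<longlongrightarrow> l) (at_right (x j))" if "j \<noteq> N"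
  proof -
    have j': "Suc j \<in> {1..N}" using that j by auto
    have lt: "x j < x (Suc j)" using mesh_less[OF m j'] by simp
    have "(?u \<longlongrightarrow> poly (P (Suc j)) (x j)) (at_right (x j))"
      by (rule tendsto_at_right_agree[OF lt]) (use inside[OF j'] in auto)
    then show ?thesis by blast
  qed
  have ends: "(\<exists>l. (?u \<longlongrightarrow> l) (at_left (x 0))) \<and> (\<exists>l. (?u \<longlongrightarrow> l) (at_right (x N)))"
  proof (cases bc)
    case Periodic
    have per: "?u (y + (x N - x 0)) = ?u y" for y using bc Periodic by simp
    have "(?u \<longlongrightarrow> poly (P N) (x 0 + (x N - x 0))) (at_left (x 0))"
    proof (rule tendsto_at_left_agree[where k = "\<lambda>y. poly (P N) (y + (x N - x 0))"])
      show "x 0 - (x N - x (N - 1)) < x 0" using mesh_less[OF m N(1)] by simp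
      show "?u y = poly (P N) (y + (x N - x 0))" if "x 0 - (x N - x (N - 1)) < y" "y < x 0" for y
        using inside[OF N(1), of "y + (x N - x 0)"] that per[of y] by simp
    qed (intro continuous_intros)
    moreover have "(?u \<longlongrightarrow> poly (P 1) (x N - (x N - x 0))) (at_right (x N))"
    proof (rule tendsto_at_right_agree[where k = "\<lambda>y. poly (P 1) (y - (x N - x 0))"])
      show "x N < x N + (x 1 - x 0)" using mesh_less[OF m N(2)] by simp
      show "?u y = poly (P 1) (y - (x N - x 0))" if "x N < y" "y < x N + (x 1 - x 0)" for y
        using inside[OF N(2), of "y - (x N - x 0)"] that per[of "y - (x N - x 0)"] by simp
    qed (intro continuous_intros)
    ultimately show ?thesis by blast
  next
    case Compactly_Supported
    have "(?u \<longlongrightarrow> (\<lambda>_. 0) (x 0)) (at_left (x 0))"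
      by (rule tendsto_at_left_agree[of "x 0 - 1"]) (use Compactly_Supported in auto)
    moreover have "(?u \<longlongrightarrow> (\<lambda>_. 0) (x N)) (at_right (x N))"
      by (rule tendsto_at_right_agree[of _ "x N + 1"]) (use Compactly_Supported in auto)
    ultimately show ?thesis by blast
  qed
  show "\<exists>l. (?u \<longlongrightarrow> l) (at_left (x j))" using left ends by (cases "j = 0") auto
  show "\<exists>l. (?u \<longlongrightarrow> l) (at_right (x j))" using right ends by (cases "j = N") auto
qed

lemma moment_cong_AE:
  assumes [measurable]: "g \<in> borel_measurable borel" "h \<in> borel_measurable borel"
    and "AE y in lborel. y \<in> {\<alpha>..\<beta>} \<longrightarrow> g y = h y"
  shows "moment \<alpha> \<beta> g q = moment \<alpha> \<beta> h q"
  unfolding moment_def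
proof (rule set_lebesgue_integral_cong_AE)
  show "AE y\<in>{\<alpha>..\<beta>} in lborel. g y * poly q y = h y * poly q y"
    using assms(3) by eventually_elim simp
qed measurable

lemma moment_eq_LINT: "(LINT y|lborel. indicator {\<alpha>..\<beta>} y * poly q y * h y) = moment \<alpha> \<beta> h q"
  unfolding moment_def set_lebesgue_integral_def
  by (rule Bochner_Integration.integral_cong) simp_all

lemma uniform_limit_sum:
  fixes F :: "'i \<Rightarrow> 'a \<Rightarrow> 'b \<Rightarrow> 'c :: real_normed_vector"
  assumes "\<And>i. i \<in> I \<Longrightarrow> uniform_limit X (F i) (l i) A"
  shows "uniform_limit X (\<lambda>n y. \<Sum>i\<in>I. F i n y) (\<lambda>y. \<Sum>i\<in>I. l i y) A"
  using assms
proof (induction I rule: infinite_finite_induct)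
  case (insert i I)
  then show ?case by (simp add: uniform_limit_add)
qed (auto intro: uniform_limit_const)

lemma uniform_limit_scaled:
  fixes a :: "'a \<Rightarrow> real" and h :: "'b \<Rightarrow> real"
  assumes a: "(a \<longlongrightarrow> b) A" and h: "\<And>y. \<bar>h y\<bar> \<le> C"
  shows "uniform_limit X (\<lambda>n y. a n * h y) (\<lambda>y. b * h y) A"
proof (rule uniform_limitI)
  fix e :: real assume e: "0 < e"
  define D where "D = max 1 C"
  have D: "0 < D" "\<And>y. \<bar>h y\<bar> \<le> D" using h by (auto simp: D_def le_max_iff_disj)
  have "\<forall>\<^sub>F n in A. dist (a n) b < e / D" by (rule tendstoD[OF a]) (use e D in simp)
  then show "\<forall>\<^sub>F n in A. \<forall>y\<in>X. dist (a n * h y) (b * h y) < e"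
  proof eventually_elim
    case (elim n)
    show ?case
    proof
      fix y
      have "dist (a n * h y) (b * h y) = \<bar>a n - b\<bar> * \<bar>h y\<bar>"
        by (simp add: dist_real_def left_diff_distrib[symmetric] abs_mult)
      moreover have "\<bar>a n - b\<bar> * \<bar>h y\<bar> \<le> \<bar>a n - b\<bar> * D" by (intro mult_left_mono D(2)) simp
      moreover have "\<bar>a n - b\<bar> * D < e" using elim D(1) by (simp add: dist_real_def pos_less_divide_eq)
      ultimately show "dist (a n * h y) (b * h y) < e" by linarith
    qed
  qed
qed

lemma piecewise_representer:
  "piecewise x N (\<lambda>j. representer k (e j) (l j)) y
     = (\<Sum>j\<in>{1..N}. \<Sum>i\<le>k. l j (e j i) * (indicator {x (j - 1)..<x j} y * poly (e j i) y))"
  unfolding piecewise_def representer_def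
  by (intro sum.cong refl) (simp add: poly_sum sum_distrib_left mult_ac)

text \<open>
  The balance of one cell, stated for the entropy solution itself rather than for its bounded
  representative.
\<close>

lemma cell_rhs_limit:
  assumes lip: "\<And>A. \<exists>L. L-lipschitz_on {-A..A} f" and sol: "entropy_solution f u0 U"
    and ab: "\<alpha> < \<beta>" and u0: "u0 \<in> borel_measurable borel"
    and u: "u \<in> borel_measurable borel" "\<And>y. y \<in> {\<alpha>..<\<beta>} \<Longrightarrow> u0 y = u y"
    and \<alpha>: "(u0 \<longlongrightarrow> a1) (at_left \<alpha>)" "(u0 \<longlongrightarrow> a2) (at_right \<alpha>)"
    and \<beta>: "(u0 \<longlongrightarrow> b1) (at_left \<beta>)" "(u0 \<longlongrightarrow> b2) (at_right \<beta>)"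
  shows "((\<lambda>T. (moment \<alpha> \<beta> (U T) q - moment \<alpha> \<beta> u q) / T)
    \<longlongrightarrow> cell_rhs \<alpha> \<beta> (\<lambda>y. f (u y)) (godunov_value f a1 a2) (godunov_value f b1 b2) q) (at_right 0)"
proof -
  obtain V M where V: "kruzhkov_solution f V M" "\<And>t. 0 \<le> t \<Longrightarrow> AE y in lborel. V t y = U t y"
    "\<And>t. 0 \<le> t \<Longrightarrow> U t \<in> borel_measurable borel" "AE y in lborel. V 0 y = u0 y"
    by (rule kruzhkov_solution_of_entropy_solution[OF lip sol]) (rule that)
  interpret kruzhkov_solution f V M by (rule V(1))
  note [measurable] = u0 u(1)
  have Vm: "V t \<in> borel_measurable borel" for t by measurable
  have VU: "moment \<alpha> \<beta> (V t) q = moment \<alpha> \<beta> (U t) q" if "0 < t" for t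
  proof (rule moment_cong_AE[OF Vm V(3)])
    show "AE y in lborel. y \<in> {\<alpha>..\<beta>} \<longrightarrow> V t y = U t y"
      using V(2)[of t] that by (auto elim: eventually_mono)
  qed (use that in simp)
  have "AE y in lborel. y \<noteq> \<beta>" by (rule AE_lborel_singleton)
  with V(4) have V0: "AE y in lborel. y \<in> {\<alpha>..\<beta>} \<longrightarrow> V 0 y = u y"
    by eventually_elim (use u(2) in auto)
  have 1: "moment \<alpha> \<beta> (V 0) q = moment \<alpha> \<beta> u q" by (rule moment_cong_AE[OF Vm u(1) V0])
  have 2: "moment \<alpha> \<beta> (\<lambda>y. f (V 0 y)) (pderiv q) = moment \<alpha> \<beta> (\<lambda>y. f (u y)) (pderiv q)"
    by (rule moment_cong_AE) (measurable, use V0 in \<open>auto elim: eventually_mono\<close>)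
  have lim: "((\<lambda>T. (moment \<alpha> \<beta> (V T) q - moment \<alpha> \<beta> u q) / T)
    \<longlongrightarrow> moment \<alpha> \<beta> (\<lambda>y. f (u y)) (pderiv q)
        + (poly q \<alpha> * godunov_value f a1 a2 - poly q \<beta> * godunov_value f b1 b2)) (at_right 0)"
    using cell_balance[OF ab poly_DERIV[of q] _ V(4) \<alpha> \<beta>] unfolding moment_eq_LINT 1 2
    by (simp add: continuous_on_poly continuous_on_id)
  have "((\<lambda>T. (moment \<alpha> \<beta> (U T) q - moment \<alpha> \<beta> u q) / T)
    \<longlongrightarrow> moment \<alpha> \<beta> (\<lambda>y. f (u y)) (pderiv q)
        + (poly q \<alpha> * godunov_value f a1 a2 - poly q \<beta> * godunov_value f b1 b2)) (at_right 0)"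
    by (rule Lim_transform_eventually[OF lim])
       (use VU in \<open>auto simp: eventually_at_right_field intro!: exI[of _ 1]\<close>)
  then show ?thesis by (simp add: cell_rhs_def algebra_simps)
qed

theorem theorem2p1:
  fixes f :: "real \<Rightarrow> real" and fhat :: "real \<Rightarrow> real \<Rightarrow> real"
    and S :: "real \<Rightarrow> (real \<Rightarrow> real) \<Rightarrow> (real \<Rightarrow> real)"
    and bc :: boundary_condition
    and x :: "nat \<Rightarrow> real" and N k :: nat and u :: "real \<Rightarrow> real"
  assumes "smooth f"
    and "mesh x N"
    and "k \<ge> 1"
    and "solution_operator bc (x 0) (x N) f S"
    and "godunov_flux f fhat"
    and "u \<in> dg_space x N k"
    and "satisfies_bc bc (x 0) (x N) (extend bc (x 0) (x N) u)"
  shows "uniform_limit {x 0..x N}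
           (\<lambda>dt y. (L2_projection x N k (S dt (extend bc (x 0) (x N) u)) y - u y) / dt)
           (dg_rhs bc x N k f fhat u)
           (at_right 0)"
proof -
  note m = assms(2)
  define u0 where "u0 = extend bc (x 0) (x N) u"
  obtain P where P: "\<And>j. j \<in> {1..N} \<Longrightarrow> degree (P j) \<le> k" "u = piecewise x N P"
    using assms(6) unfolding dg_space_iff[OF m] by blast
  have lip: "\<exists>L. L-lipschitz_on {-A..A} f" for A by (rule smooth_locally_lipschitz[OF assms(1)])
  have um: "u \<in> borel_measurable borel" unfolding P(2) by measurable
  have u0m: "u0 \<in> borel_measurable borel" unfolding u0_def by (rule extend_measurable[OF um])
  obtain C where C': "0 \<le> C" "\<And>y. \<bar>piecewise x N P y\<bar> \<le> C"
    by (rule piecewise_bounded[of x N P]) (rule that)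
  note C = C'(1) C'(2)[folded P(2)]
  have "\<bar>u0 y\<bar> \<le> C" for y
    using extend_range[of bc "x 0" "x N" u y] C unfolding u0_def by auto
  then have "bounded (range u0)" unfolding bounded_iff by auto
  then have sol: "entropy_solution f u0 (\<lambda>t. S t u0)"
    using assms(4,7) u0m unfolding solution_operator_def u0_def by blast
  define tl where "tl = (\<lambda>j. trace_left u0 (x j))"
  define tr where "tr = (\<lambda>j. trace_right u0 (x j))"
  have lims: "(u0 \<longlongrightarrow> tl j) (at_left (x j))" "(u0 \<longlongrightarrow> tr j) (at_right (x j))" if j: "j \<le> N" for j
  proof -
    note ex = extend_one_sided_limits[OF m assms(7)[unfolded P(2)] j, folded P(2), folded u0_def]
    show "(u0 \<longlongrightarrow> tl j) (at_left (x j))" using ex(1) trace_left_eq unfolding tl_def by blast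
    show "(u0 \<longlongrightarrow> tr j) (at_right (x j))" using ex(2) trace_right_eq unfolding tr_def by blast
  qed
  have flux: "interface_flux bc x N fhat u j = godunov_value f (tl j) (tr j)" for j
  proof -
    obtain us where "godunov_state f (tl j) (tr j) us" "fhat (tl j) (tr j) = f us"
      using assms(5) unfolding godunov_flux_def by blast
    then show ?thesis
      using godunov_state_value[OF lip] by (simp add: interface_flux_def tl_def tr_def u0_def)
  qed
  have "\<forall>j. \<exists>e. j \<in> {1..N} \<longrightarrow> expansion_basis (x (j - 1)) (x j) k e"
    using expansion_basis_exists[OF mesh_less[OF m]] by blast
  from choice[OF this] obtain e
    where e: "\<And>j. j \<in> {1..N} \<Longrightarrow> expansion_basis (x (j - 1)) (x j) k (e j)" by blast
  obtain V M where V: "kruzhkov_solution f V M" "\<And>t. 0 \<le> t \<Longrightarrow> AE y in lborel. V t y = S t u0 y"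
    "\<And>t. 0 \<le> t \<Longrightarrow> S t u0 \<in> borel_measurable borel" "AE y in lborel. V 0 y = u0 y"
    by (rule kruzhkov_solution_of_entropy_solution[OF lip sol]) (rule that)
  interpret kruzhkov_solution f V M by (rule V(1))
  have S_bounded: "essentially_bounded (S t u0)" if "0 < t" for t
  proof -
    have "AE y in lborel. V t y = S t u0 y" using V(2)[of t] that by simp
    then have "AE y in lborel. \<bar>S t u0 y\<bar> \<le> M" by eventually_elim (use V_bound in metis)
    then show ?thesis using V(3)[of t] that unfolding essentially_bounded_def by auto
  qed
  obtain K where K: "\<And>v. v \<in> {-C..C} \<Longrightarrow> \<bar>f v\<bar> \<le> K"
    by (rule continuous_on_compact_bounded[OF compact_Icc continuous_on_subset[OF f_continuous subset_UNIV]]) blast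
  have "u y \<in> {-C..C}" for y using C(2)[of y] by (simp add: abs_le_iff)
  then have fu: "essentially_bounded (\<lambda>y. f (u y))"
    unfolding essentially_bounded_def using K measurable_compose[OF um f_measurable] by (intro conjI exI AE_I2) auto
  let ?m = "\<lambda>j h. moment (x (j - 1)) (x j) h"
  let ?l = "\<lambda>j. cell_rhs (x (j - 1)) (x j) (\<lambda>y. f (u y)) (interface_flux bc x N fhat u (j - 1)) (interface_flux bc x N fhat u j)"
  let ?h = "\<lambda>j i y. indicator {x (j - 1)..<x j} y * poly (e j i) y :: real"
  have u_eq: "u = piecewise x N (\<lambda>j. representer k (e j) (?m j u))"
  proof -
    have "P j = representer k (e j) (?m j u)" if j: "j \<in> {1..N}" for j
      by (rule representer_unique[OF e[OF j] P(1)[OF j]]) (simp add: P(2) moment_piecewise[OF m j, simplified])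
    then show ?thesis unfolding P(2) by (rule piecewise_cong)
  qed
  have quotient: "(L2_projection x N k (S dt u0) y - u y) / dt
      = (\<Sum>j\<in>{1..N}. \<Sum>i\<le>k. (?m j (S dt u0) (e j i) - ?m j u (e j i)) / dt * ?h j i y)" if dt: "0 < dt" for dt y
  proof -
    have "L2_projection x N k (S dt u0) y = (\<Sum>j\<in>{1..N}. \<Sum>i\<le>k. ?m j (S dt u0) (e j i) * ?h j i y)"
      by (subst L2_projection_eq[OF m S_bounded[OF dt]], rule e, assumption) (rule piecewise_representer)
    moreover have "u y = (\<Sum>j\<in>{1..N}. \<Sum>i\<le>k. ?m j u (e j i) * ?h j i y)"
      by (subst u_eq) (rule piecewise_representer)
    ultimately show ?thesis
      by (simp add: sum_subtractf[symmetric] left_diff_distrib[symmetric] sum_divide_distrib)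
  qed
  have rhs: "dg_rhs bc x N k f fhat u y = (\<Sum>j\<in>{1..N}. \<Sum>i\<le>k. ?l j (e j i) * ?h j i y)" for y
    by (subst dg_rhs_eq[where f = f and u = u and e = e, OF m fu], rule e, assumption) (rule piecewise_representer)
  have "uniform_limit {x 0..x N}
      (\<lambda>dt y. \<Sum>j\<in>{1..N}. \<Sum>i\<le>k. (?m j (S dt u0) (e j i) - ?m j u (e j i)) / dt * ?h j i y)
      (\<lambda>y. \<Sum>j\<in>{1..N}. \<Sum>i\<le>k. ?l j (e j i) * ?h j i y) (at_right 0)"
  proof (intro uniform_limit_sum)
    fix j i assume j: "j \<in> {1..N}"
    have j': "j - 1 \<le> N" "j \<le> N" using j by auto
    obtain D where D: "0 \<le> D" "\<And>y. y \<in> {x (j - 1)..x j} \<Longrightarrow> \<bar>poly (e j i) y\<bar> \<le> D"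
      by (rule poly_bounded_on_interval[of "x (j - 1)" "x j" "e j i"]) (rule that)
    have h: "\<bar>?h j i y\<bar> \<le> D" for y
      using D(1) D(2)[of y] by (cases "y \<in> {x (j - 1)..<x j}") auto
    have ends: "x 0 \<le> x (j - 1)" "x j \<le> x N" using j by (auto intro!: mesh_le[OF m])
    have agree: "u0 y = u y" if "y \<in> {x (j - 1)..<x j}" for y
      unfolding u0_def by (rule extend_inside) (use that ends in auto)
    show "uniform_limit {x 0..x N} (\<lambda>dt y. (?m j (S dt u0) (e j i) - ?m j u (e j i)) / dt * ?h j i y)
        (\<lambda>y. ?l j (e j i) * ?h j i y) (at_right 0)"
      unfolding flux
      by (rule uniform_limit_scaled[OF cell_rhs_limit[OF lip sol mesh_less[OF m j] u0m um agree
            lims[OF j'(1)] lims[OF j'(2)]] h])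
  qed
  then show ?thesis
  proof (rule uniform_limit_cong[THEN iffD1, rotated 2])
    show "\<forall>\<^sub>F dt in at_right 0. \<forall>y\<in>{x 0..x N}.
        (\<Sum>j\<in>{1..N}. \<Sum>i\<le>k. (?m j (S dt u0) (e j i) - ?m j u (e j i)) / dt * ?h j i y)
        = (L2_projection x N k (S dt (extend bc (x 0) (x N) u)) y - u y) / dt"
      unfolding eventually_at_right_field using quotient by (intro exI[of _ 1]) (auto simp: u0_def)
    show "(\<Sum>j\<in>{1..N}. \<Sum>i\<le>k. ?l j (e j i) * ?h j i y) = dg_rhs bc x N k f fhat u y" for y
      by (rule rhs[symmetric])
  qed
qed

end
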